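(* Let $D_1,D_2\subset\mathbb{C}$ be bounded simply connected domains with $\overline{D_2}\subset D_1$ whose boundaries $\Gamma_j=\partial D_j$ $(j=1,2)$ are Jordan curves of class $C^1$. Let $\alpha\in\mathbb{R}$, $\alpha\neq 1$, and let $\omega_0=\chi_{D_1}+(\alpha-1)\chi_{D_2}$ (assumed to have non-zero total mass $\int_{\mathbb{C}}\omega_0\,dA$). Assume that the solution $\omega_t$ of the vorticity equation of the planar Euler equations with initial datum $\omega_0$ rotates uniformly. If $\Gamma_1$ or $\Gamma_2$ is a circle, then the other curve must be a circle with the same center.
   Context: The plane $\mathbb{R}^2$ is identified with $\mathbb{C}$, $dA$ is Lebesgue measure and $\chi_E$ is the characteristic function of $E$. The vorticity form of the 2D incompressible Euler equations is $\partial_t\omega+v\cdot\nabla\omega=0$, where the velocity is recovered from the vorticity by the Biot--Savart law $v=\nabla^\perp\Psi$, with $\nabla^\perp=(-\partial_2,\partial_1)$ and $\Psi_t(z)=\frac{1}{2\pi}\int_{\mathbb{C}}\omega_t(\xi)\log|z-\xi|\,dA(\xi)$. For $\omega_0\in L^1\cap L^\infty$ there is a unique global weak solution (Yudovich), and $\omega_t=\omega_0\circ\psi(t,\cdot)^{-1}$, where $\psi$ is the flow of $v$. The solution $\omega_t$ rotates uniformly if there is a real number $\Omega$ (the angular velocity) such that for all $t\ge 0$ one has $\omega_t(c+\zeta)=\omega_0(c+e^{-it\Omega}\zeta)$ for (almost) all $\zeta\in\mathbb{C}$, where $c=\frac{1}{\int\omega_0\,dA}\int_{\mathbb{C}}z\,\omega_0(z)\,dA(z)$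 is the center of mass of $\omega_0$. *)

theory Defs
  imports "HOL-Analysis.Analysis"
begin

text \<open>The plane is the type \<^typ>\<open>complex\<close>, \<open>dA\<close> is \<^term>\<open>lebesgue :: complex measure\<close>, and the
  Euclidean scalar product of plane vectors is \<^const>\<open>inner\<close>.\<close>

text \<open>A closed Jordan curve of class \<open>C\<^sup>1\<close>, as a set: it has a regular parametrization that is
  \<open>C\<^sup>1\<close> as a periodic function, whence the matching of the one-sided derivatives at the base point.\<close>

definition C1_jordan_curve :: "complex set \<Rightarrow> bool" where
  "C1_jordan_curve \<Gamma> \<longleftrightarrow>
     (\<exists>\<gamma> \<gamma>'. simple_path \<gamma> \<and> pathfinish \<gamma> = pathstart \<gamma> \<and> path_image \<gamma> = \<Gamma> \<and>
        (\<forall>s\<in>{0..1}. (\<gamma> has_vector_derivative \<gamma>' s) (at s within {0..1}) \<and> \<gamma>' s \<noteq> 0) \<and>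
        continuous_on {0..1} \<gamma>' \<and> \<gamma>' 0 = \<gamma>' 1)"

definition stream_function :: "(complex \<Rightarrow> real) \<Rightarrow> complex \<Rightarrow> real" where
  "stream_function \<omega> z = 1 / (2 * pi) * (LINT \<xi>|lebesgue. \<omega> \<xi> * ln (cmod (z - \<xi>)))"

text \<open>The Biot--Savart law \<open>v = \<nabla>\<^sup>\<bottom>\<Psi> = (-\<partial>\<^sub>2\<Psi>, \<partial>\<^sub>1\<Psi>)\<close>. In terms of the
  differential it reads \<open>d\<Psi>(h) = h\<^sub>1 v\<^sub>2 - h\<^sub>2 v\<^sub>1\<close>. That \<open>\<Psi>\<close> is given by a convergent integral and
  is differentiable is part of the predicate, so that it never speaks about default values; both
  hold for every bounded vorticity of bounded support.\<close>

definition biot_savart :: "(complex \<Rightarrow> real) \<Rightarrow> (complex \<Rightarrow> complex) \<Rightarrow> bool" where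
  "biot_savart \<omega> v \<longleftrightarrow>
     (\<forall>z. integrable lebesgue (\<lambda>\<xi>. \<omega> \<xi> * ln (cmod (z - \<xi>)))) \<and>
     (\<forall>z. (stream_function \<omega> has_derivative (\<lambda>h. Re h * Im (v z) - Im h * Re (v z))) (at z))"

text \<open>\<open>C\<^sup>1\<close> functions of time and space whose supports in space lie in a common compact set;
  \<open>\<phi>\<^sub>t\<close> is the time derivative and \<open>g\<close> the spatial gradient of \<open>\<phi>\<close>.\<close>

definition test_function ::
  "(real \<Rightarrow> complex \<Rightarrow> real) \<Rightarrow> (real \<Rightarrow> complex \<Rightarrow> real) \<Rightarrow> (real \<Rightarrow> complex \<Rightarrow> complex) \<Rightarrow> bool" where
  "test_function \<phi> \<phi>\<^sub>t g \<longleftrightarrow>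
     (\<forall>t z. ((\<lambda>(s, w). \<phi> s w) has_derivative (\<lambda>(s, w). s * \<phi>\<^sub>t t z + w \<bullet> g t z)) (at (t, z))) \<and>
     continuous_on UNIV (\<lambda>(t, z). \<phi>\<^sub>t t z) \<and> continuous_on UNIV (\<lambda>(t, z). g t z) \<and>
     (\<exists>K. compact K \<and> (\<forall>t. \<forall>z. z \<notin> K \<longrightarrow> \<phi> t z = 0))"

text \<open>Global weak solutions (in the sense of Yudovich) of \<open>\<partial>\<^sub>t\<omega> + v \<cdot> \<nabla>\<omega> = 0\<close> with initial
  datum \<open>\<omega>0\<close>: the vorticity is bounded in \<open>L\<^sup>1 \<inter> L\<^sup>\<infinity>\<close> on bounded time intervals, and
  \<open>\<integral> \<phi>(T) \<omega>(T) dA - \<integral> \<phi>(0) \<omega>0 dA = \<integral>\<^sub>0\<^sup>T \<integral> \<omega> (\<partial>\<^sub>t\<phi> + v \<cdot> \<nabla>\<phi>) dA dt\<close> for all \<open>T \<ge> 0\<close>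
  and all test functions. The case \<open>T = 0\<close> says that \<open>\<omega> 0 = \<omega>0\<close> almost everywhere.
  Measurability in time need not be demanded: the identity makes \<open>t \<mapsto> \<integral> \<phi> \<omega>(t) dA\<close> continuous.
  Values of \<open>\<omega>\<close> at negative times are irrelevant.\<close>

definition euler_weak_solution :: "(complex \<Rightarrow> real) \<Rightarrow> (real \<Rightarrow> complex \<Rightarrow> real) \<Rightarrow> bool" where
  "euler_weak_solution \<omega>0 \<omega> \<longleftrightarrow>
     (\<forall>T. \<exists>M. \<forall>t\<in>{0..T}. integrable lebesgue (\<omega> t) \<and>
        (LINT z|lebesgue. \<bar>\<omega> t z\<bar>) \<le> M \<and> (AE z in lebesgue. \<bar>\<omega> t z\<bar> \<le> M)) \<and>
     (\<exists>v. (\<forall>t\<ge>0. biot_savart (\<omega> t) (v t)) \<and>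
        (\<forall>\<phi> \<phi>\<^sub>t g. test_function \<phi> \<phi>\<^sub>t g \<longrightarrow>
          (\<forall>T\<ge>0. ((\<lambda>t. LINT z|lebesgue. \<omega> t z * (\<phi>\<^sub>t t z + v t z \<bullet> g t z)) has_integral
             ((LINT z|lebesgue. \<phi> T z * \<omega> T z) - (LINT z|lebesgue. \<phi> 0 z * \<omega>0 z))) {0..T})))"

definition center_of_mass :: "(complex \<Rightarrow> real) \<Rightarrow> complex" where
  "center_of_mass \<omega> = (1 / (LINT z|lebesgue. \<omega> z)) *\<^sub>R (LINT z|lebesgue. \<omega> z *\<^sub>R z)"

definition rotates_uniformly :: "(complex \<Rightarrow> real) \<Rightarrow> (real \<Rightarrow> complex \<Rightarrow> real) \<Rightarrow> bool" where
  "rotates_uniformly \<omega>0 \<omega> \<longleftrightarrow>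
     (\<exists>\<Omega>::real. \<forall>t\<ge>0. AE \<zeta> in lebesgue.
        \<omega> t (center_of_mass \<omega>0 + \<zeta>) = \<omega>0 (center_of_mass \<omega>0 + exp (- \<i> * of_real (t * \<Omega>)) * \<zeta>))"

end

theory Submission
  imports Defs "HOL-Complex_Analysis.Complex_Analysis"
begin

text \<open>Testing the weak formulation against functions that rotate with the vorticity gives
  \<open>Re (q \<gamma>') = 0\<close> along both boundary curves, where \<open>q = C / (2 pi) - \<Omega> cnj (z - c)\<close> is twice the
  Wirtinger derivative of the relative stream function and \<open>C\<close> the Cauchy transform of the vorticity.
  If the curve \<open>\<Gamma>2\<close> is a circle, this condition on \<open>\<Gamma>2\<close> and unique continuation determine the Cauchy
  transform of \<open>D1\<close> inside \<open>D1\<close>; the relative stream function on \<open>\<Gamma>1\<close> is then a nonconstant combination of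
  \<open>|z - a|\<^sup>2\<close> and \<open>ln |z - a|\<close>, so \<open>|z - a|\<close> is constant on \<open>\<Gamma>1\<close>. If \<open>\<Gamma>1\<close> is a circle, the Cauchy transform of
  \<open>D2\<close> outside \<open>D2\<close> is a monopole plus a dipole at the centre. Without dipole one concludes as before. With
  a dipole, \<open>D2\<close> has a Schwarz function with a double pole at the centre; inserting it for \<open>cnj z\<close> in the
  relative stream function yields a constant holomorphic function whose logarithmic term has nonzero
  residue at the centre, a contradiction.\<close>

subsection \<open>Rigid motions and singular kernels\<close>

text \<open>The boundaries are merely C1, so nothing can be differentiated across them and every
  condition is extracted from integrals. The tests are small radial bumps: near a boundary point the
  vorticity is a constant plus a nonzero multiple of the indicator of one patch, and the constant
  integrates to zero, so each curve is treated alone. Since only vanishing boundary integrals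
  matter, Green's theorem suffices up to a nonzero factor, and neither orientation nor kernel masses
  are computed. The dipole has strength proportional to \<open>\<Omega> * (c - a)\<close>; it arises
  because the centre of mass \<open>c\<close> is not known in advance to be the centre
  \<open>a\<close> of the given circle. The Schwarz function of \<open>D2\<close> lives only inside
  \<open>D2\<close>, with continuous boundary values. Hence a function that is constant on the curve
  is identified from one side, by a maximum principle. The Schwarz function may also have zeros in
  \<open>D2\<close>, where its logarithm branches; the exponential avoids the branches, and removing
  countably many points keeps the domain connected.\<close>

definition cplx_of_vec :: "real^2 \<Rightarrow> complex" where
  "cplx_of_vec v = Complex (v $ 1) (v $ 2)"

definition vec_of_cplx :: "complex \<Rightarrow> real^2" where
  "vec_of_cplx z = (\<chi> i. if i = 1 then Re z else Im z)"

lemma vec_of_cplx_nth [simp]: "vec_of_cplx z $ 1 = Re z" "vec_of_cplx z $ 2 = Im z"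
  by (simp_all add: vec_of_cplx_def)

lemma vec_of_cplx_inverse [simp]: "cplx_of_vec (vec_of_cplx z) = z"
  by (simp add: cplx_of_vec_def)

lemma cplx_of_vec_inverse [simp]: "vec_of_cplx (cplx_of_vec v) = v"
  by (simp add: cplx_of_vec_def vec_eq_iff forall_2)

lemma borel_measurable_cplx_of_vec [measurable]: "cplx_of_vec \<in> borel_measurable borel"
  unfolding cplx_of_vec_def by (intro borel_measurable_continuous_onI continuous_intros)

lemma vimage_cplx_of_vec_box: "cplx_of_vec -` box l u = box (vec_of_cplx l) (vec_of_cplx u)"
  by (auto simp: cplx_of_vec_def in_box_complex_iff mem_box_cart forall_2)

text \<open>Orthogonal maps of \<open>real^2\<close> preserve Lebesgue measure; this identification
  transports that fact to \<open>complex\<close>.\<close>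

lemma lborel_cplx_of_vec: "lborel = distr lborel borel cplx_of_vec"
proof (rule lborel_eqI)
  fix l u :: complex
  assume lu: "\<And>b. b \<in> Basis \<Longrightarrow> l \<bullet> b \<le> u \<bullet> b"
  have lu': "Re l \<le> Re u" "Im l \<le> Im u"
    using lu[of 1] lu[of \<i>] by (auto simp: Basis_complex_def inner_complex_def)
  have "emeasure (distr lborel borel cplx_of_vec) (box l u) =
      emeasure lborel (box (vec_of_cplx l) (vec_of_cplx u))"
    by (simp add: emeasure_distr vimage_cplx_of_vec_box)
  also have "\<dots> = (\<Prod>b\<in>Basis. (vec_of_cplx u - vec_of_cplx l) \<bullet> b)"
  proof (rule emeasure_lborel_box)
    fix b :: "real^2" assume "b \<in> Basis"
    then obtain i where "b = axis i 1" by (auto simp: Basis_vec_def)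
    then show "vec_of_cplx l \<bullet> b \<le> vec_of_cplx u \<bullet> b"
      using lu' exhaust_2[of i] by (auto simp: inner_axis)
  qed
  also have "(\<Prod>b\<in>Basis. (vec_of_cplx u - vec_of_cplx l) \<bullet> b) = (\<Prod>b\<in>Basis. (u - l) \<bullet> b)"
  proof -
    have B: "(Basis :: (real^2) set) = {axis 1 1, axis 2 1}"
      by (auto simp: Basis_vec_def UNIV_2)
    have "axis 1 1 \<noteq> (axis 2 1 :: real^2)" by (simp add: axis_eq_axis)
    then show ?thesis
      by (simp add: B inner_axis Basis_complex_def inner_complex_def)
  qed
  finally show "emeasure (distr lborel borel cplx_of_vec) (box l u) = (\<Prod>b\<in>Basis. (u - l) \<bullet> b)" .
qed simp

lemma lborel_distr_rotation:
  assumes "cmod u = 1"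
  shows "distr lborel borel (\<lambda>z. u * z) = lborel"
proof (rule lborel_eqI[symmetric])
  fix l r :: complex
  assume lr: "\<And>b. b \<in> Basis \<Longrightarrow> l \<bullet> b \<le> r \<bullet> b"
  \<comment> \<open>The rotation by \<open>inverse u\<close> in real coordinates: a push-forward
    measures preimages under multiplication by \<open>u\<close>, and these are images under
    \<open>f\<close>.\<close>
  define f where "f = (\<lambda>v. vec_of_cplx (inverse u * cplx_of_vec v))"
  have u: "Re u * Re u + Im u * Im u = 1"
    using assms by (simp add: cmod_def power2_eq_square)
  have inv: "inverse u = cnj u"
    using assms by (metis complex_norm_square inverse_unique mult.commute of_real_1 power_one)
  have u0: "u \<noteq> 0" using assms by auto
  have f: "orthogonal_transformation f"
    unfolding orthogonal_transformation
  proof (intro conjI allI)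
    show "linear f"
      by (rule linearI; simp add: vec_eq_iff f_def cplx_of_vec_def inv forall_2 algebra_simps)
    fix v :: "real^2"
    have "(Re u * v$1 + Im u * v$2)^2 + (Re u * v$2 - Im u * v$1)^2 =
       (Re u * Re u + Im u * Im u) * ((v$1)^2 + (v$2)^2)"
      by (simp add: algebra_simps power2_eq_square)
    then show "norm (f v) = norm v"
      by (simp add: norm_vec_def L2_set_def sum_2 f_def cplx_of_vec_def inv u)
  qed
  define B where "B = box (vec_of_cplx l) (vec_of_cplx r)"
  have fB: "f ` B = cplx_of_vec -` ((\<lambda>z. u * z) -` box l r)"
  proof (intro equalityI subsetI)
    fix w assume "w \<in> f ` B"
    then show "w \<in> cplx_of_vec -` ((\<lambda>z. u * z) -` box l r)"
      unfolding B_def using u0 by (auto simp: f_def vimage_cplx_of_vec_box[symmetric] mult.assoc[symmetric])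
  next
    fix w assume w: "w \<in> cplx_of_vec -` ((\<lambda>z. u * z) -` box l r)"
    show "w \<in> f ` B"
    proof (rule image_eqI)
      show "w = f (vec_of_cplx (u * cplx_of_vec w))"
        using u0 by (simp add: f_def mult.assoc[symmetric])
      show "vec_of_cplx (u * cplx_of_vec w) \<in> B"
        using w by (simp add: B_def vimage_cplx_of_vec_box[symmetric])
    qed
  qed
  have uB: "(\<lambda>z. u * z) -` box l r \<in> sets borel"
    by (rule measurable_sets_borel[where M=borel]) auto
  have fBs: "f ` B \<in> sets borel"
    unfolding fB by (rule measurable_sets_borel[OF borel_measurable_cplx_of_vec uB])
  have "emeasure (distr lborel borel (\<lambda>z. u * z)) (box l r) = emeasure lborel (f ` B)"
    unfolding fB by (subst lborel_cplx_of_vec) (simp add: emeasure_distr uB)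
  also have "\<dots> = emeasure lborel B"
  proof -
    have B: "B \<in> lmeasurable" unfolding B_def by simp
    have fBm: "f ` B \<in> lmeasurable" by (rule measurable_orthogonal_image[OF f B])
    have "emeasure lebesgue (f ` B) = ennreal (measure lebesgue (f ` B))"
      by (rule emeasure_eq_ennreal_measure) (rule fmeasurableD2[OF fBm])
    also have "\<dots> = ennreal (measure lebesgue B)"
      by (simp only: measure_orthogonal_image[OF f B])
    also have "\<dots> = emeasure lebesgue B"
      by (rule emeasure_eq_ennreal_measure[symmetric]) (rule fmeasurableD2[OF B])
    finally have "emeasure lebesgue (f ` B) = emeasure lebesgue B" .
    moreover have "emeasure lebesgue (f ` B) = emeasure lborel (f ` B)"
      using fBs by simp
    moreover have "emeasure lebesgue B = emeasure lborel B"
      by (simp add: B_def)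
    ultimately show ?thesis by simp
  qed
  also have "\<dots> = emeasure lborel (box l r)"
  proof -
    have "emeasure (distr lborel borel cplx_of_vec) (box l r) = emeasure lborel B"
      by (simp add: emeasure_distr B_def vimage_cplx_of_vec_box)
    then show ?thesis by (simp add: lborel_cplx_of_vec[symmetric])
  qed
  also have "\<dots> = (\<Prod>b\<in>Basis. (r - l) \<bullet> b)"
    by (rule emeasure_lborel_box) (use lr in auto)
  finally show "emeasure (distr lborel borel (\<lambda>z. u * z)) (box l r) = (\<Prod>b\<in>Basis. (r - l) \<bullet> b)" .
qed simp

lemma lborel_distr_motion:
  assumes "cmod u = 1"
  shows "distr lborel borel (\<lambda>z. b + u * z) = lborel"
proof -
  have "distr lborel borel (\<lambda>z. b + u * z) = distr (distr lborel borel (\<lambda>z. u * z)) borel (\<lambda>z. b + z)"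
    by (subst distr_distr) (auto simp: o_def)
  then show ?thesis
    by (simp add: lborel_distr_rotation[OF assms] lborel_distr_plus)
qed

section \<open>Integrals of inverse distance and logarithmic kernels\<close>

lemma emeasure_ball_complex: "r \<ge> 0 \<Longrightarrow> emeasure lborel (ball (z::complex) r) = ennreal (pi * r\<^sup>2)"
  by (simp add: emeasure_ball unit_ball_vol_2)

lemma measure_ball_complex: "r \<ge> 0 \<Longrightarrow> measure lborel (ball (z::complex) r) = pi * r\<^sup>2"
  by (simp add: measure_def emeasure_ball_complex)

text \<open>Domination by a weighted sum of indicators of concentric balls: at each point one term
  suffices and the others only add. Shrinking radii handle the singularity of the inverse distance,
  growing radii the decay of \<open>bump_kernel\<close>.\<close>

lemma nn_integral_le_balls:
  fixes f :: "complex \<Rightarrow> ennreal" and c \<rho> :: "nat \<Rightarrow> real"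
  assumes cover: "\<And>\<xi>. f \<xi> = 0 \<or> (\<exists>n. \<xi> \<in> ball z (\<rho> n) \<and> f \<xi> \<le> ennreal (c n))"
    and nonneg: "\<And>n. c n \<ge> 0" "\<And>n. \<rho> n \<ge> 0" and sums: "(\<lambda>n. c n * (pi * (\<rho> n)\<^sup>2)) sums S"
  shows "(\<integral>\<^sup>+\<xi>. f \<xi> \<partial>lborel) \<le> ennreal S"
proof -
  have "(\<integral>\<^sup>+\<xi>. f \<xi> \<partial>lborel) \<le> (\<integral>\<^sup>+\<xi>. (\<Sum>n. ennreal (c n) * indicator (ball z (\<rho> n)) \<xi>) \<partial>lborel)"
  proof (rule nn_integral_mono)
    fix \<xi> :: complex
    let ?g = "\<lambda>n. ennreal (c n) * indicator (ball z (\<rho> n)) \<xi>"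
    show "f \<xi> \<le> (\<Sum>n. ?g n)"
    proof (cases "f \<xi> = 0")
      case False
      then obtain n where n: "\<xi> \<in> ball z (\<rho> n)" "f \<xi> \<le> ennreal (c n)" using cover by blast
      then have "f \<xi> \<le> sum ?g {n}" by simp
      also have "\<dots> \<le> (\<Sum>n. ?g n)" by (rule sum_le_suminf) auto
      finally show ?thesis .
    qed simp
  qed
  also have "\<dots> = (\<Sum>n. \<integral>\<^sup>+\<xi>. ennreal (c n) * indicator (ball z (\<rho> n)) \<xi> \<partial>lborel)"
    by (rule nn_integral_suminf) (auto intro!: borel_measurable_times_ennreal borel_measurable_indicator)
  also have "\<dots> = (\<Sum>n. ennreal (c n * (pi * (\<rho> n)\<^sup>2)))"
    using nonneg by (intro suminf_cong) (simp add: nn_integral_cmult_indicator emeasure_ball_complex ennreal_mult)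
  also have "\<dots> = ennreal S"
    by (rule suminf_ennreal_eq) (use nonneg sums in auto)
  finally show ?thesis .
qed

text \<open>Dyadic shells: at distance between \<open>\<delta> / 2^(n+1)\<close> and
  \<open>\<delta> / 2^n\<close> the kernel is at most \<open>2^(n+1) / \<delta>\<close>. Counting
  whole balls instead of shells doubles the exact value \<open>2 * pi * \<delta>\<close> but keeps
  the bound linear in \<open>\<delta>\<close>.\<close>

lemma nn_integral_inverse_dist_ball:
  assumes "\<delta> > 0"
  shows "(\<integral>\<^sup>+\<xi>. ennreal (1 / cmod (z - \<xi>)) * indicator (ball z \<delta>) \<xi> \<partial>lborel) \<le> ennreal (4 * pi * \<delta>)"
proof (rule nn_integral_le_balls[where c = "\<lambda>n. 2 ^ (n + 1) / \<delta>" and \<rho> = "\<lambda>n. \<delta> / 2 ^ n"])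
  have "(\<lambda>n. 2 * pi * \<delta> * (1/2)^n) sums (4 * pi * \<delta>)"
    using sums_mult[OF geometric_sums[of "1/2::real"], of "2 * pi * \<delta>"] by (simp add: mult.assoc)
  moreover have "2 ^ (n + 1) / \<delta> * (pi * (\<delta> / 2 ^ n)\<^sup>2) = 2 * pi * \<delta> * (1/2)^n" for n
    using assms by (simp add: field_simps power2_eq_square)
  ultimately show "(\<lambda>n. 2 ^ (n + 1) / \<delta> * (pi * (\<delta> / 2 ^ n)\<^sup>2)) sums (4 * pi * \<delta>)" by (simp only:)
  fix \<xi> :: complex
  let ?f = "ennreal (1 / cmod (z - \<xi>)) * indicator (ball z \<delta>) \<xi>"
  show "?f = 0 \<or> (\<exists>n. \<xi> \<in> ball z (\<delta> / 2 ^ n) \<and> ?f \<le> ennreal (2 ^ (n + 1) / \<delta>))"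
  \<comment> \<open>At \<open>\<xi> = z\<close> division by zero makes the integrand 0, so the first
    alternative applies.\<close>
  proof (cases "\<xi> = z \<or> \<xi> \<notin> ball z \<delta>")
    case False
    define d where "d = cmod (z - \<xi>)"
    have d: "0 < d" "d < \<delta>" using False by (auto simp: d_def dist_norm)
    \<comment> \<open>The first ball missing \<open>\<xi>\<close>; it is not ball 0 because
      \<open>d < \<delta>\<close>, so its predecessor \<open>k\<close> is the last ball containing
      \<open>\<xi>\<close>.\<close>
    define N where "N = (LEAST n. \<delta> / 2^n \<le> d)"
    obtain m where "\<delta> / d < 2 ^ m" using real_arch_pow[of 2 "\<delta> / d"] by auto
    then have "\<delta> / 2^m \<le> d" using d by (simp add: field_simps)
    then have N: "\<delta> / 2^N \<le> d" unfolding N_def by (rule LeastI)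
    have "N \<noteq> 0" using N d by (intro notI) auto
    then obtain k where k: "N = Suc k" by (cases N) auto
    have "\<not> \<delta> / 2^k \<le> d" using not_less_Least[of k "\<lambda>n. \<delta> / 2^n \<le> d"] k by (simp add: N_def)
    then have "\<xi> \<in> ball z (\<delta> / 2^k)" by (simp add: d_def dist_norm)
    moreover have "1 / d \<le> 2^(k+1) / \<delta>" using N d assms by (simp add: k field_simps)
    ultimately show ?thesis using False by (intro disjI2 exI[of _ k]) (simp add: d_def ennreal_leI)
  qed auto
qed (use assms in auto)

lemma set_integrable_inverse_dist:
  assumes "E \<in> sets lborel" "emeasure lborel E < \<infinity>"
  shows "set_integrable lborel E (\<lambda>\<xi>. 1 / cmod (z - \<xi>))"
  unfolding set_integrable_def
proof (rule integrableI_bounded)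
  show "(\<lambda>x. indicat_real E x *\<^sub>R (1 / cmod (z - x))) \<in> borel_measurable lborel"
    using assms(1) by measurable
  have "(\<integral>\<^sup>+ x. ennreal (norm (indicat_real E x *\<^sub>R (1 / cmod (z - x)))) \<partial>lborel)
    \<le> (\<integral>\<^sup>+\<xi>. ennreal (1 / cmod (z - \<xi>)) * indicator (ball z 1) \<xi> + indicator E \<xi> \<partial>lborel)"
  proof (rule nn_integral_mono)
    fix x
    show "ennreal (norm (indicat_real E x *\<^sub>R (1 / cmod (z - x)))) \<le>
        ennreal (1 / cmod (z - x)) * indicator (ball z 1) x + indicator E x"
    proof (cases "x \<in> E \<and> x \<notin> ball z 1")
      case True
      then have "1 / cmod (z - x) \<le> 1" by (simp add: dist_norm not_less divide_le_eq)
      then show ?thesis using True by (simp add: ennreal_leI)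
    qed (auto simp: indicator_def)
  qed
  also have "\<dots> = (\<integral>\<^sup>+\<xi>. ennreal (1 / cmod (z - \<xi>)) * indicator (ball z 1) \<xi> \<partial>lborel) + emeasure lborel E"
    using assms(1) by (subst nn_integral_add) (auto intro!: borel_measurable_times_ennreal borel_measurable_indicator)
  also have "\<dots> < \<infinity>"
    using nn_integral_inverse_dist_ball[of 1 z] assms(2) by (auto simp: le_less_trans)
  finally show "(\<integral>\<^sup>+ x. ennreal (norm (indicat_real E x *\<^sub>R (1 / cmod (z - x)))) \<partial>lborel) < \<infinity>" .
qed

lemma set_integral_inverse_dist_ball:
  assumes "E \<in> sets lborel" "E \<subseteq> ball z \<delta>" "\<delta> > 0"
  shows "(LINT \<xi>:E|lborel. 1 / cmod (z - \<xi>)) \<le> 4 * pi * \<delta>"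
proof -
  have "(LINT \<xi>:E|lborel. 1 / cmod (z - \<xi>)) = enn2real (\<integral>\<^sup>+\<xi>. ennreal (indicat_real E \<xi> * (1 / cmod (z - \<xi>))) \<partial>lborel)"
    unfolding set_lebesgue_integral_def using assms(1) by (subst integral_eq_nn_integral) auto
  also have "\<dots> \<le> enn2real (ennreal (4 * pi * \<delta>))"
  proof (rule enn2real_mono)
    have "(\<integral>\<^sup>+\<xi>. ennreal (indicat_real E \<xi> * (1 / cmod (z - \<xi>))) \<partial>lborel) \<le>
       (\<integral>\<^sup>+\<xi>. ennreal (1 / cmod (z - \<xi>)) * indicator (ball z \<delta>) \<xi> \<partial>lborel)"
      using assms(2) by (intro nn_integral_mono) (auto simp: indicator_def)
    also have "\<dots> \<le> ennreal (4 * pi * \<delta>)" by (rule nn_integral_inverse_dist_ball) fact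
    finally show "(\<integral>\<^sup>+\<xi>. ennreal (indicat_real E \<xi> * (1 / cmod (z - \<xi>))) \<partial>lborel) \<le> ennreal (4 * pi * \<delta>)" .
  qed simp
  also have "\<dots> = 4 * pi * \<delta>" using assms(3) by simp
  finally show ?thesis .
qed

lemma set_integrable_cauchy_kernel:
  fixes z :: complex
  assumes "E \<in> sets lborel" "emeasure lborel E < \<infinity>"
  shows "set_integrable lborel E (\<lambda>\<xi>. 1 / (z - \<xi>))"
proof -
  have "integrable lborel (\<lambda>\<xi>. indicat_real E \<xi> *\<^sub>R (1 / cmod (z - \<xi>)))"
    using set_integrable_inverse_dist[OF assms, of z] by (simp only: set_integrable_def)
  then show ?thesis
    unfolding set_integrable_def
  proof (rule Bochner_Integration.integrable_bound)
    show "(\<lambda>\<xi>. indicat_real E \<xi> *\<^sub>R (1 / (z - \<xi>))) \<in> borel_measurable lborel"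
      using assms(1) by measurable
  qed (simp add: norm_divide)
qed

text \<open>Apply \<open>ln y \<le> y - 1\<close> to \<open>x\<close> and to \<open>1 / x\<close>.
  The default value \<open>ln 0 = 0\<close> admits \<open>x = 0\<close>, so the bound can be used
  pointwise.\<close>

lemma abs_ln_le: "x \<ge> 0 \<Longrightarrow> \<bar>ln x\<bar> \<le> x + 1 / x" for x :: real
proof (cases "x = 0")
  case False
  assume "x \<ge> 0"
  then have "x > 0" using False by simp
  then have "ln x \<le> x - 1" "- ln x \<le> 1 / x - 1" "1 / x > 0"
    using ln_le_minus_one[of x] ln_le_minus_one[of "1 / x"] by (auto simp: ln_div)
  with \<open>x > 0\<close> show ?thesis by linarith
qed auto

lemma set_integrable_ln_dist:
  assumes "E \<in> sets lborel" "bounded E"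
  shows "set_integrable lborel E (\<lambda>\<xi>. ln (cmod (z - \<xi>)))"
proof -
  obtain R where R: "E \<subseteq> cball z R"
    using assms(2) unfolding bounded_any_center[of E z] by (auto simp: subset_eq)
  have fin: "emeasure lborel E < \<infinity>" using assms(2) by (rule emeasure_bounded_finite)
  have "set_integrable lborel E (\<lambda>\<xi>. R + 1 / cmod (z - \<xi>))"
  proof (rule set_integral_add(1))
    show "set_integrable lborel E (\<lambda>\<xi>. R)"
      using assms(1) fin by (auto simp: set_integrable_def)
    show "set_integrable lborel E (\<lambda>\<xi>. 1 / cmod (z - \<xi>))"
      by (rule set_integrable_inverse_dist) (use assms fin in auto)
  qed
  then show ?thesis
    unfolding set_integrable_def
  proof (rule Bochner_Integration.integrable_bound)
    show "(\<lambda>x. indicat_real E x *\<^sub>R ln (cmod (z - x))) \<in> borel_measurable lborel"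
      using assms(1) by measurable
    show "AE x in lborel. norm (indicat_real E x *\<^sub>R ln (cmod (z - x)))
         \<le> norm (indicat_real E x *\<^sub>R (R + 1 / cmod (z - x)))"
    proof (rule AE_I2)
      fix x
      show "norm (indicat_real E x *\<^sub>R ln (cmod (z - x))) \<le> norm (indicat_real E x *\<^sub>R (R + 1 / cmod (z - x)))"
      proof (cases "x \<in> E")
        case True
        then have "cmod (z - x) \<le> R" using R by (auto simp: dist_norm)
        then show ?thesis using True abs_ln_le[of "cmod (z - x)"] by auto
      qed auto
    qed
  qed
qed

section \<open>Regularity of the Cauchy transform and the logarithmic potential\<close>

definition cauchy_transform :: "complex set \<Rightarrow> complex \<Rightarrow> complex" where
  "cauchy_transform E z = (LINT \<xi>:E|lborel. 1 / (z - \<xi>))"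

definition log_potential :: "complex set \<Rightarrow> complex \<Rightarrow> real" where
  "log_potential E z = (LINT \<xi>:E|lborel. ln (cmod (z - \<xi>)))"

lemma norm_cauchy_transform_le:
  assumes "E \<in> sets lborel" "emeasure lborel E < \<infinity>"
  shows "norm (cauchy_transform E z) \<le> (LINT \<xi>:E|lborel. 1 / cmod (z - \<xi>))"
  using set_integral_norm_bound[OF set_integrable_cauchy_kernel[OF assms, of z]]
  unfolding cauchy_transform_def by (simp add: norm_divide)

lemma norm_cauchy_transform_ball_le:
  assumes "E \<in> sets lborel" "E \<subseteq> ball z \<delta>" "\<delta> > 0"
  shows "norm (cauchy_transform E z) \<le> 4 * pi * \<delta>"
proof -
  have "emeasure lborel E < \<infinity>"
    using assms(2) bounded_ball bounded_subset by (intro emeasure_bounded_finite) blast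
  from norm_cauchy_transform_le[OF assms(1) this, of z] set_integral_inverse_dist_ball[OF assms]
  show ?thesis by (rule order_trans)
qed

lemma cauchy_transform_Un:
  assumes "E \<in> sets lborel" "emeasure lborel E < \<infinity>" "F \<in> sets lborel" "emeasure lborel F < \<infinity>" "E \<inter> F = {}"
  shows "cauchy_transform (E \<union> F) z = cauchy_transform E z + cauchy_transform F z"
  unfolding cauchy_transform_def
  by (rule set_integral_Un) (use assms in \<open>auto intro!: set_integrable_cauchy_kernel\<close>)

lemma log_potential_Un:
  assumes "E \<in> sets lborel" "bounded E" "F \<in> sets lborel" "bounded F" "E \<inter> F = {}"
  shows "log_potential (E \<union> F) z = log_potential E z + log_potential F z"
  unfolding log_potential_def
  by (rule set_integral_Un) (use assms in \<open>auto intro!: set_integrable_ln_dist\<close>)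

text \<open>Both potentials have remainders quadratic in \<open>h\<close> away from their support;
  the same criterion settles the point 0 for powers of \<open>max 0 x\<close>.\<close>

lemma has_derivative_quadratic:
  fixes f :: "'a::real_normed_vector \<Rightarrow> 'b::real_normed_vector"
  assumes "bounded_linear D" "d > 0"
    and "\<And>h. norm h < d \<Longrightarrow> norm (f (z + h) - f z - D h) \<le> K * (norm h)\<^sup>2"
  shows "(f has_derivative D) (at z)"
  unfolding has_derivative_at_alt
proof (intro conjI allI impI assms(1))
  fix e :: real assume e: "e > 0"
  define d' where "d' = min d (e / (\<bar>K\<bar> + 1))"
  have "d' > 0" using assms e by (simp add: d'_def)
  moreover have "norm (f y - f z - D (y - z)) \<le> e * norm (y - z)" if "norm (y - z) < d'" for y
  proof -
    have "norm (f y - f z - D (y - z)) \<le> K * (norm (y - z))\<^sup>2"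
      using assms(3)[of "y - z"] that by (simp add: d'_def)
    also have "\<dots> \<le> (\<bar>K\<bar> + 1) * (norm (y - z))\<^sup>2"
      by (intro mult_right_mono) auto
    also have "\<dots> = ((\<bar>K\<bar> + 1) * norm (y - z)) * norm (y - z)"
      by (simp add: power2_eq_square)
    also have "(\<bar>K\<bar> + 1) * norm (y - z) \<le> e"
      using that by (simp add: d'_def field_simps add_pos_nonneg)
    finally show ?thesis by (simp add: mult_right_mono)
  qed
  ultimately show "\<exists>d>0. \<forall>y. norm (y - z) < d \<longrightarrow> norm (f y - f z - D (y - z)) \<le> e * norm (y - z)"
    by blast
qed

lemma norm_set_integral_le_const:
  fixes f :: "complex \<Rightarrow> 'a::{banach, second_countable_topology}"
  assumes "E \<in> sets lborel" "emeasure lborel E < \<infinity>" "set_integrable lborel E f"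
    and "\<And>\<xi>. \<xi> \<in> E \<Longrightarrow> norm (f \<xi>) \<le> B"
  shows "norm (LINT \<xi>:E|lborel. f \<xi>) \<le> B * measure lborel E"
proof -
  have "norm (LINT \<xi>:E|lborel. f \<xi>) \<le> (LINT \<xi>:E|lborel. norm (f \<xi>))"
    by (rule set_integral_norm_bound) fact
  also have "\<dots> \<le> (LINT \<xi>:E|lborel. B)"
  proof (rule set_integral_mono)
    show "set_integrable lborel E (\<lambda>\<xi>. norm (f \<xi>))" using assms(3) by (rule set_integrable_norm)
    show "set_integrable lborel E (\<lambda>\<xi>. B)" using assms(1,2) by (auto simp: set_integrable_def)
  qed (use assms(4) in auto)
  also have "\<dots> = B * measure lborel E"
    using assms(1,2) by (simp add: set_lebesgue_integral_def)
  finally show ?thesis .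
qed

text \<open>The second-order remainder of the kernel is exactly
  \<open>h\<^sup>2 / ((z + h - \<xi>) * (z - \<xi>)\<^sup>2)\<close>; for
  \<open>|h| < \<delta> / 2\<close> the denominator has modulus at least
  \<open>\<delta>^3 / 2\<close>, uniformly on \<open>E\<close>.\<close>

lemma cauchy_transform_has_field_derivative_off:
  assumes E: "E \<in> sets lborel" "emeasure lborel E < \<infinity>" and "\<delta> > 0" "E \<inter> ball z \<delta> = {}"
  shows "(cauchy_transform E has_field_derivative - (LINT \<xi>:E|lborel. 1 / (z - \<xi>)\<^sup>2)) (at z)"
  unfolding has_field_derivative_def
proof (rule has_derivative_quadratic[where d = "\<delta>/2" and K = "2 / \<delta>^3 * measure lborel E"])
  have far: "cmod (z - \<xi>) \<ge> \<delta>" if "\<xi> \<in> E" for \<xi>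
    using assms(4) that by (auto simp: dist_norm disjoint_iff not_less)
  fix h :: complex assume h: "norm h < \<delta>/2"
  have far2: "cmod (z + h - \<xi>) \<ge> \<delta>/2" if "\<xi> \<in> E" for \<xi>
    using far[OF that] h norm_triangle_ineq2[of "z - \<xi>" "-h"] by (simp add: algebra_simps)
  have int2: "set_integrable lborel E (\<lambda>\<xi>. 1 / (z - \<xi>)\<^sup>2)"
  proof -
    have "integrable lborel (\<lambda>\<xi>. indicat_real E \<xi> *\<^sub>R (1 / \<delta>\<^sup>2))"
      using E by auto
    then show ?thesis
      unfolding set_integrable_def
    proof (rule Bochner_Integration.integrable_bound)
      show "(\<lambda>\<xi>. indicat_real E \<xi> *\<^sub>R (1 / (z - \<xi>)\<^sup>2)) \<in> borel_measurable lborel"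
        using E(1) by measurable
      have "1 / (cmod (z - \<xi>))\<^sup>2 \<le> 1 / \<delta>\<^sup>2" if "\<xi> \<in> E" for \<xi>
        using far[OF that] assms(3) by (intro divide_left_mono power_mono) (auto intro!: mult_pos_pos zero_less_power)
      then show "AE \<xi> in lborel. norm (indicat_real E \<xi> *\<^sub>R (1 / (z - \<xi>)\<^sup>2)) \<le> norm (indicat_real E \<xi> *\<^sub>R (1 / \<delta>\<^sup>2))"
        by (auto simp: norm_divide norm_power indicator_def)
    qed
  qed
  note kern = set_integrable_cauchy_kernel[OF E]
  have intA: "set_integrable lborel E (\<lambda>\<xi>. 1 / (z + h - \<xi>) - 1 / (z - \<xi>))"
    by (rule set_integral_diff(1)[OF kern kern])
  have intB: "set_integrable lborel E (\<lambda>\<xi>. (1 / (z - \<xi>)\<^sup>2) * h)"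
    by (rule set_integrable_mult_left) (rule int2)
  have eq: "cauchy_transform E (z + h) - cauchy_transform E z - (- (LINT \<xi>:E|lborel. 1 / (z - \<xi>)\<^sup>2)) * h
     = (LINT \<xi>:E|lborel. 1 / (z + h - \<xi>) - 1 / (z - \<xi>) + (1 / (z - \<xi>)\<^sup>2) * h)"
    unfolding cauchy_transform_def
    by (simp only: set_integral_add(2)[OF intA intB] set_integral_diff(2)[OF kern kern] set_integral_mult_left) simp
  have int3: "set_integrable lborel E (\<lambda>\<xi>. 1 / (z + h - \<xi>) - 1 / (z - \<xi>) + (1 / (z - \<xi>)\<^sup>2) * h)"
    by (rule set_integral_add(1)[OF intA intB])
  have "norm (LINT \<xi>:E|lborel. 1 / (z + h - \<xi>) - 1 / (z - \<xi>) + (1 / (z - \<xi>)\<^sup>2) * h)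
      \<le> (2 / \<delta>^3 * (norm h)\<^sup>2) * measure lborel E"
  proof (rule norm_set_integral_le_const[OF E int3])
    fix \<xi> assume \<xi>: "\<xi> \<in> E"
    have nz: "z - \<xi> \<noteq> 0" "z + h - \<xi> \<noteq> 0" using far[OF \<xi>] far2[OF \<xi>] assms(3) by auto
    have "1 / (z + h - \<xi>) - 1 / (z - \<xi>) + (1 / (z - \<xi>)\<^sup>2) * h = h\<^sup>2 / ((z + h - \<xi>) * (z - \<xi>)\<^sup>2)"
      using nz by (simp add: divide_simps) (simp add: algebra_simps power2_eq_square)
    then have "norm (1 / (z + h - \<xi>) - 1 / (z - \<xi>) + (1 / (z - \<xi>)\<^sup>2) * h)
        = (norm h)\<^sup>2 / (cmod (z + h - \<xi>) * (cmod (z - \<xi>))\<^sup>2)"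
      by (simp add: norm_divide norm_mult norm_power)
    also have "\<dots> \<le> (norm h)\<^sup>2 / (\<delta>/2 * \<delta>\<^sup>2)"
      using far[OF \<xi>] far2[OF \<xi>] assms(3) nz
      by (intro divide_left_mono mult_mono power_mono) (auto intro!: mult_pos_pos)
    also have "\<dots> = 2 / \<delta>^3 * (norm h)\<^sup>2"
      using assms(3) by (simp add: field_simps power2_eq_square power3_eq_cube)
    finally show "norm (1 / (z + h - \<xi>) - 1 / (z - \<xi>) + (1 / (z - \<xi>)\<^sup>2) * h) \<le> 2 / \<delta>^3 * (norm h)\<^sup>2" .
  qed
  then show "norm (cauchy_transform E (z + h) - cauchy_transform E z - (- (LINT \<xi>:E|lborel. 1 / (z - \<xi>)\<^sup>2)) * h)
     \<le> 2 / \<delta>^3 * measure lborel E * (norm h)\<^sup>2"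
    unfolding eq by (simp add: mult_ac)
qed (use assms in \<open>auto intro: bounded_linear_mult_right\<close>)

lemma cauchy_transform_holomorphic_off:
  assumes "E \<in> sets lborel" "emeasure lborel E < \<infinity>"
  shows "cauchy_transform E holomorphic_on (- closure E)"
proof -
  have "cauchy_transform E field_differentiable at z" if "z \<in> - closure E" for z
  proof -
    have "open (- closure E)" by auto
    from openE[OF this that] obtain d where "d > 0" "ball z d \<subseteq> - closure E" by blast
    moreover from this have "E \<inter> ball z d = {}" using closure_subset[of E] by auto
    ultimately show ?thesis
      using cauchy_transform_has_field_derivative_off[OF assms] field_differentiable_def by blast
  qed
  then show ?thesis by (simp add: field_differentiable_at_within holomorphic_on_def)
qed

lemma cauchy_transform_split:
  assumes "E \<in> sets lborel" "emeasure lborel E < \<infinity>" "B \<in> sets lborel"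
  shows "cauchy_transform E z = cauchy_transform (E \<inter> B) z + cauchy_transform (E - B) z"
proof -
  have "E = (E \<inter> B) \<union> (E - B)" by auto
  moreover have "emeasure lborel (E \<inter> B) < \<infinity>" "emeasure lborel (E - B) < \<infinity>"
    using emeasure_mono[of "E \<inter> B" E lborel] emeasure_mono[of "E - B" E lborel] assms
    by (auto simp: le_less_trans)
  ultimately show ?thesis
    using cauchy_transform_Un[of "E \<inter> B" "E - B" z] assms(1,3)
    by (metis Diff_disjoint Int_Diff Int_empty_right Diff_Int_distrib2 inf_sup_aci(1) sets.Diff sets.Int inf.commute)
qed

text \<open>The part of \<open>E\<close> within \<open>\<delta>\<close> of \<open>z\<close>
  contributes \<open>O(\<delta>)\<close> at all nearby points, while the far part is differentiable
  at \<open>z\<close>. Hence continuity holds across the boundary of \<open>E\<close>, whatever its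
  shape.\<close>

lemma cauchy_transform_continuous:
  assumes E: "E \<in> sets lborel" "emeasure lborel E < \<infinity>"
  shows "continuous_on UNIV (cauchy_transform E)"
proof -
  have "isCont (cauchy_transform E) z" for z
    unfolding continuous_at_eps_delta
  proof (intro allI impI)
    fix e :: real assume e: "e > 0"
    \<comment> \<open>The near part costs \<open>e / 6\<close> at \<open>z\<close> and
      \<open>e / 3\<close> at \<open>w\<close>, whose ball has twice the radius; the far part costs
      less than \<open>e / 4\<close>.\<close>
    define \<delta> where "\<delta> = e / (24 * pi)"
    have \<delta>: "\<delta> > 0" using e by (simp add: \<delta>_def)
    have En: "E \<inter> ball z \<delta> \<in> sets lborel" "E - ball z \<delta> \<in> sets lborel" using E(1) by auto
    have Ef: "emeasure lborel (E - ball z \<delta>) < \<infinity>"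
      using emeasure_mono[of "E - ball z \<delta>" E lborel] E by (auto simp: le_less_trans)
    have "isCont (cauchy_transform (E - ball z \<delta>)) z"
      using cauchy_transform_has_field_derivative_off[OF En(2) Ef \<delta>] DERIV_isCont by blast
    then obtain d where d: "d > 0"
      "\<And>w. dist w z < d \<Longrightarrow> dist (cauchy_transform (E - ball z \<delta>) w) (cauchy_transform (E - ball z \<delta>) z) < e / 4"
      using e unfolding continuous_at_eps_delta by (metis zero_less_divide_iff zero_less_numeral)
    have "dist (cauchy_transform E w) (cauchy_transform E z) < e" if w: "dist w z < min d \<delta>" for w
    proof -
      have "norm (cauchy_transform (E \<inter> ball z \<delta>) z) \<le> 4 * pi * \<delta>"
        by (rule norm_cauchy_transform_ball_le[OF En(1)]) (use \<delta> in auto)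
      moreover have "norm (cauchy_transform (E \<inter> ball z \<delta>) w) \<le> 4 * pi * (2 * \<delta>)"
      proof (rule norm_cauchy_transform_ball_le[OF En(1)])
        show "E \<inter> ball z \<delta> \<subseteq> ball w (2 * \<delta>)"
        proof
          fix x assume "x \<in> E \<inter> ball z \<delta>"
          then show "x \<in> ball w (2 * \<delta>)" using w dist_triangle[of w x z] by auto
        qed
      qed (use \<delta> in auto)
      moreover have "4 * pi * \<delta> = e / 6" "4 * pi * (2 * \<delta>) = e / 3"
        by (simp_all add: \<delta>_def)
      moreover have "dist (cauchy_transform (E - ball z \<delta>) w) (cauchy_transform (E - ball z \<delta>) z) < e / 4"
        using d w by simp
      moreover have "dist (cauchy_transform E w) (cauchy_transform E z) \<le>
         norm (cauchy_transform (E \<inter> ball z \<delta>) w) + norm (cauchy_transform (E \<inter> ball z \<delta>) z)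
         + dist (cauchy_transform (E - ball z \<delta>) w) (cauchy_transform (E - ball z \<delta>) z)"
      proof -
        have "cauchy_transform E w - cauchy_transform E z = (cauchy_transform (E \<inter> ball z \<delta>) w - cauchy_transform (E \<inter> ball z \<delta>) z)
          + (cauchy_transform (E - ball z \<delta>) w - cauchy_transform (E - ball z \<delta>) z)"
          using cauchy_transform_split[OF E, of "ball z \<delta>" w] cauchy_transform_split[OF E, of "ball z \<delta>" z] by simp
        then show ?thesis
          unfolding dist_norm
          by (metis (no_types, lifting) norm_triangle_le add_mono norm_triangle_ineq4 order_refl)
      qed
      ultimately show ?thesis using e by linarith
    qed
    then show "\<exists>d>0. \<forall>w. dist w z < d \<longrightarrow> dist (cauchy_transform E w) (cauchy_transform E z) < e"
      using d(1) \<delta> by (intro exI[of _ "min d \<delta>"]) auto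
  qed
  then show ?thesis by (simp add: continuous_at_imp_continuous_on)
qed

text \<open>With \<open>w = h / \<zeta>\<close>, \<open>ln |1 + w|\<close> is the real part of
  \<open>Ln (1 + w)\<close>, whose linear approximation is controlled for
  \<open>|w| \<le> 1/2\<close>.\<close>

lemma ln_cmod_add_approx:
  assumes "2 * cmod h \<le> cmod \<zeta>" "\<zeta> \<noteq> 0"
  shows "\<bar>ln (cmod (\<zeta> + h)) - ln (cmod \<zeta>) - Re (h / \<zeta>)\<bar> \<le> 2 * (cmod h)\<^sup>2 / (cmod \<zeta>)\<^sup>2"
proof -
  define w where "w = h / \<zeta>"
  have w: "cmod w \<le> 1/2" using assms by (simp add: w_def norm_divide divide_le_eq)
  have nz: "1 + w \<noteq> 0"
  proof
    assume "1 + w = 0"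
    then have "w = -1" by (simp add: add_eq_0_iff)
    then show False using w by simp
  qed
  have "\<zeta> + h = \<zeta> * (1 + w)" using assms(2) by (simp add: w_def field_simps)
  then have "ln (cmod (\<zeta> + h)) = ln (cmod \<zeta>) + ln (cmod (1 + w))"
    using assms(2) nz by (simp add: norm_mult ln_mult)
  moreover have "Re (Ln (1 + w)) = ln (cmod (1 + w))" using nz by simp
  ultimately have "\<bar>ln (cmod (\<zeta> + h)) - ln (cmod \<zeta>) - Re (h / \<zeta>)\<bar> = \<bar>Re (Ln (1 + w) - w)\<bar>"
    by (simp add: w_def)
  also have "\<dots> \<le> cmod (Ln (1 + w) - w)" by (rule abs_Re_le_cmod)
  also have "\<dots> \<le> (cmod w)\<^sup>2 / (1 - cmod w)" by (rule Ln_approx_linear) (use w in linarith)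
  also have "\<dots> \<le> (cmod w)\<^sup>2 / (1/2)" using w by (intro divide_left_mono) auto
  also have "\<dots> = 2 * (cmod h)\<^sup>2 / (cmod \<zeta>)\<^sup>2" by (simp add: w_def norm_divide power_divide)
  finally show ?thesis .
qed

lemma set_integral_Re:
  "set_integrable M A f \<Longrightarrow> (LINT x:A|M. Re (f x)) = Re (LINT x:A|M. f x)"
  unfolding set_integrable_def set_lebesgue_integral_def
  by (subst integral_Re[symmetric]) simp_all

lemma set_integrable_Re:
  "set_integrable M A f \<Longrightarrow> set_integrable M A (\<lambda>x. Re (f x))"
  unfolding set_integrable_def using integrable_Re by fastforce

lemma log_potential_has_derivative_off:
  assumes E: "E \<in> sets lborel" "bounded E" and "\<delta> > 0" "E \<inter> ball z \<delta> = {}"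
  shows "(log_potential E has_derivative (\<lambda>h. Re (cauchy_transform E z * h))) (at z)"
proof (rule has_derivative_quadratic[where d = "\<delta>/2" and K = "2 / \<delta>\<^sup>2 * measure lborel E"])
  have Ef: "emeasure lborel E < \<infinity>" using E(2) by (rule emeasure_bounded_finite)
  have far: "cmod (z - \<xi>) \<ge> \<delta>" if "\<xi> \<in> E" for \<xi>
    using assms(4) that by (auto simp: dist_norm disjoint_iff not_less)
  show "bounded_linear (\<lambda>h. Re (cauchy_transform E z * h))"
    by (intro bounded_linear_compose[OF bounded_linear_Re] bounded_linear_mult_right)
  fix h :: complex assume h: "norm h < \<delta>/2"
  have int: "set_integrable lborel E (\<lambda>\<xi>. h * (1 / (z - \<xi>)))"
    by (intro set_integrable_mult_right set_integrable_cauchy_kernel E Ef)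
  have int3: "set_integrable lborel E (\<lambda>\<xi>. ln (cmod (z + h - \<xi>)) - ln (cmod (z - \<xi>)) - Re (h * (1 / (z - \<xi>))))"
    by (intro set_integral_diff set_integrable_Re int set_integrable_ln_dist E)
  have eq: "log_potential E (z + h) - log_potential E z - Re (cauchy_transform E z * h)
     = (LINT \<xi>:E|lborel. ln (cmod (z + h - \<xi>)) - ln (cmod (z - \<xi>)) - Re (h * (1 / (z - \<xi>))))"
  proof -
    have "cauchy_transform E z * h = (LINT \<xi>:E|lborel. h * (1 / (z - \<xi>)))"
      unfolding cauchy_transform_def by (simp only: set_integral_mult_right mult.commute)
    then show ?thesis
      using set_integral_Re[OF int] unfolding log_potential_def
      by (simp only: set_integral_diff set_integrable_Re[OF int] set_integrable_ln_dist[OF E])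
  qed
  have "norm (LINT \<xi>:E|lborel. ln (cmod (z + h - \<xi>)) - ln (cmod (z - \<xi>)) - Re (h * (1 / (z - \<xi>))))
      \<le> (2 / \<delta>\<^sup>2 * (norm h)\<^sup>2) * measure lborel E"
  proof (rule norm_set_integral_le_const[OF E(1) Ef int3])
    fix \<xi> assume \<xi>: "\<xi> \<in> E"
    have "norm (ln (cmod (z + h - \<xi>)) - ln (cmod (z - \<xi>)) - Re (h * (1 / (z - \<xi>)))) \<le> 2 * (cmod h)\<^sup>2 / (cmod (z - \<xi>))\<^sup>2"
      using ln_cmod_add_approx[of h "z - \<xi>"] far[OF \<xi>] h assms(3)
      by (cases "z = \<xi>") (simp_all add: diff_add_eq del: Re_divide)
    also have "\<dots> \<le> 2 * (cmod h)\<^sup>2 / \<delta>\<^sup>2"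
      using far[OF \<xi>] assms(3) by (intro divide_left_mono power_mono) (auto intro!: mult_pos_pos zero_less_power)
    finally show "norm (ln (cmod (z + h - \<xi>)) - ln (cmod (z - \<xi>)) - Re (h * (1 / (z - \<xi>)))) \<le> 2 / \<delta>\<^sup>2 * (norm h)\<^sup>2"
      by simp
  qed
  then show "norm (log_potential E (z + h) - log_potential E z - Re (cauchy_transform E z * h))
     \<le> 2 / \<delta>\<^sup>2 * measure lborel E * (norm h)\<^sup>2"
    unfolding eq by (simp add: mult_ac)
qed (use assms in auto)

text \<open>Replaces the mean value theorem by a bound in the two end points only; after integration
  it becomes a sum of two inverse distance integrals.\<close>

lemma abs_ln_diff_le:
  fixes a b :: real
  assumes "a > 0" "b > 0"
  shows "\<bar>ln a - ln b\<bar> \<le> \<bar>a - b\<bar> * (1 / a + 1 / b)"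
proof -
  have "ln (a / b) \<le> a / b - 1" "ln (b / a) \<le> b / a - 1" using assms by (auto intro!: ln_le_minus_one)
  then have "ln a - ln b \<le> (a - b) * (1 / b)" "ln b - ln a \<le> (b - a) * (1 / a)"
    using assms by (auto simp: ln_div field_simps)
  moreover have "(a - b) * (1 / b) \<le> \<bar>a - b\<bar> * (1 / a + 1 / b)" "(b - a) * (1 / a) \<le> \<bar>a - b\<bar> * (1 / a + 1 / b)"
    using assms by (intro mult_mono; simp add: add_nonneg_nonneg)+
  ultimately show ?thesis by linarith
qed

lemma log_potential_ball_lipschitz:
  assumes E: "E \<in> sets lborel" "E \<subseteq> ball z \<delta>" "\<delta> > 0" and w: "cmod h < \<delta>"
  shows "\<bar>log_potential E (z + h) - log_potential E z\<bar> \<le> 12 * pi * \<delta> * cmod h"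
proof -
  have bE: "bounded E" using E(2) bounded_ball bounded_subset by blast
  have Ef: "emeasure lborel E < \<infinity>" using bE by (rule emeasure_bounded_finite)
  have i: "set_integrable lborel E (\<lambda>\<xi>. cmod h * (1 / cmod (z + h - \<xi>) + 1 / cmod (z - \<xi>)))"
    using set_integrable_inverse_dist[OF E(1) Ef] by (simp add: set_integral_add)
  have il: "set_integrable lborel E (\<lambda>\<xi>. ln (cmod (z + h - \<xi>)) - ln (cmod (z - \<xi>)))"
    by (intro set_integral_diff set_integrable_ln_dist E(1) bE)
  have "\<bar>log_potential E (z + h) - log_potential E z\<bar> = norm (LINT \<xi>:E|lborel. ln (cmod (z + h - \<xi>)) - ln (cmod (z - \<xi>)))"
    unfolding log_potential_def
    by (simp only: set_integral_diff(2)[OF set_integrable_ln_dist[OF E(1) bE] set_integrable_ln_dist[OF E(1) bE]] real_norm_def)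
  also have "\<dots> \<le> (LINT \<xi>:E|lborel. norm (ln (cmod (z + h - \<xi>)) - ln (cmod (z - \<xi>))))"
    by (rule set_integral_norm_bound[OF il])
  also have "\<dots> \<le> (LINT \<xi>:E|lborel. cmod h * (1 / cmod (z + h - \<xi>) + 1 / cmod (z - \<xi>)))"
  proof (rule set_integral_mono_AE[OF set_integrable_norm[OF il] i])
    have "AE \<xi> in lborel. \<xi> \<noteq> z \<and> \<xi> \<noteq> z + h"
      by (intro AE_conjI AE_lborel_singleton)
    then show "AE \<xi>\<in>E in lborel. norm (ln (cmod (z + h - \<xi>)) - ln (cmod (z - \<xi>))) \<le> cmod h * (1 / cmod (z + h - \<xi>) + 1 / cmod (z - \<xi>))"
    proof eventually_elim
      case (elim \<xi>)
      have "norm (ln (cmod (z + h - \<xi>)) - ln (cmod (z - \<xi>))) \<le> \<bar>cmod (z + h - \<xi>) - cmod (z - \<xi>)\<bar> * (1 / cmod (z + h - \<xi>) + 1 / cmod (z - \<xi>))"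
        using abs_ln_diff_le[of "cmod (z + h - \<xi>)" "cmod (z - \<xi>)"] elim by auto
      also have "\<dots> \<le> cmod h * (1 / cmod (z + h - \<xi>) + 1 / cmod (z - \<xi>))"
        using norm_triangle_ineq3[of "z + h - \<xi>" "z - \<xi>"] by (intro mult_right_mono) auto
      finally show ?case by simp
    qed
  qed
  also have "\<dots> = cmod h * ((LINT \<xi>:E|lborel. 1 / cmod (z + h - \<xi>)) + (LINT \<xi>:E|lborel. 1 / cmod (z - \<xi>)))"
    using set_integrable_inverse_dist[OF E(1) Ef] by (simp add: set_integral_add)
  \<comment> \<open>About the shifted centre \<open>z + h\<close> the set \<open>E\<close> only fits
    into a ball of radius \<open>2 * \<delta>\<close>; this gives the constant 12.\<close>
  also have "\<dots> \<le> cmod h * (4 * pi * (2 * \<delta>) + 4 * pi * \<delta>)"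
  proof (intro mult_left_mono add_mono set_integral_inverse_dist_ball E)
    show "E \<subseteq> ball (z + h) (2 * \<delta>)"
    proof
      fix x assume "x \<in> E"
      then have "x \<in> ball z \<delta>" using E(2) by auto
      then show "x \<in> ball (z + h) (2 * \<delta>)"
        using w dist_triangle[of "z + h" x z] by (auto simp: dist_norm)
    qed
  qed (use E in auto)
  finally show ?thesis by (simp add: algebra_simps)
qed

text \<open>Valid at every point, on the boundary of \<open>E\<close> too. The part of
  \<open>E\<close> near \<open>z\<close> has a small Lipschitz quotient and also a small candidate
  derivative, so only the differentiable far part counts.\<close>

lemma log_potential_has_derivative:
  assumes E: "E \<in> sets lborel" "bounded E"
  shows "(log_potential E has_derivative (\<lambda>h. Re (cauchy_transform E z * h))) (at z)"
  unfolding has_derivative_at_alt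
proof (intro conjI allI impI)
  show "bounded_linear (\<lambda>h. Re (cauchy_transform E z * h))"
    by (intro bounded_linear_compose[OF bounded_linear_Re] bounded_linear_mult_right)
  have Ef: "emeasure lborel E < \<infinity>" using E(2) by (rule emeasure_bounded_finite)
  fix e :: real assume e: "e > 0"
  \<comment> \<open>The near part costs
    \<open>12 * pi * \<delta> + 4 * pi * \<delta> = e / 2\<close> per unit of \<open>|y - z|\<close>
    and leaves \<open>e / 2\<close> for the far part.\<close>
  define \<delta> where "\<delta> = e / (32 * pi)"
  have \<delta>: "\<delta> > 0" using e by (simp add: \<delta>_def)
  let ?N = "E \<inter> ball z \<delta>" and ?F = "E - ball z \<delta>"
  have En: "?N \<in> sets lborel" "?F \<in> sets lborel" using E(1) by auto
  have bd: "bounded ?N" "bounded ?F" using E(2) by (auto intro: bounded_subset)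
  have "(log_potential ?F has_derivative (\<lambda>h. Re (cauchy_transform ?F z * h))) (at z)"
    by (rule log_potential_has_derivative_off[OF En(2) bd(2) \<delta>]) auto
  then obtain d where d: "d > 0" "\<And>y. norm (y - z) < d \<Longrightarrow>
      norm (log_potential ?F y - log_potential ?F z - Re (cauchy_transform ?F z * (y - z))) \<le> e / 2 * norm (y - z)"
    unfolding has_derivative_at_alt using e by (meson half_gt_zero)
  have "norm (log_potential E y - log_potential E z - Re (cauchy_transform E z * (y - z))) \<le> e * norm (y - z)"
    if y: "norm (y - z) < min d \<delta>" for y
  proof -
    have sp: "log_potential E w = log_potential ?N w + log_potential ?F w" for w
      using log_potential_Un[OF En(1) bd(1) En(2) bd(2), of w] by (simp add: Int_Diff_Un Int_Diff_disjoint)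
    have "log_potential E y - log_potential E z - Re (cauchy_transform E z * (y - z)) =
      (log_potential ?N y - log_potential ?N z) - Re (cauchy_transform ?N z * (y - z)) +
      (log_potential ?F y - log_potential ?F z - Re (cauchy_transform ?F z * (y - z)))"
      using cauchy_transform_split[OF E(1) Ef, of "ball z \<delta>" z] by (simp add: sp algebra_simps)
    moreover have "\<bar>log_potential ?N y - log_potential ?N z\<bar> \<le> 12 * pi * \<delta> * cmod (y - z)"
      using log_potential_ball_lipschitz[OF En(1) _ \<delta>, of z "y - z"] y by simp
    moreover have "\<bar>Re (cauchy_transform ?N z * (y - z))\<bar> \<le> 4 * pi * \<delta> * cmod (y - z)"
    proof -
      have "\<bar>Re (cauchy_transform ?N z * (y - z))\<bar> \<le> cmod (cauchy_transform ?N z) * cmod (y - z)"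
        by (metis abs_Re_le_cmod norm_mult)
      also have "\<dots> \<le> 4 * pi * \<delta> * cmod (y - z)"
        by (intro mult_right_mono norm_cauchy_transform_ball_le[OF En(1)]) (use \<delta> in auto)
      finally show ?thesis .
    qed
    moreover have "norm (log_potential ?F y - log_potential ?F z - Re (cauchy_transform ?F z * (y - z))) \<le> e / 2 * norm (y - z)"
      using d(2) y by simp
    moreover have "12 * pi * \<delta> * cmod (y - z) + 4 * pi * \<delta> * cmod (y - z) = e / 2 * norm (y - z)"
      by (simp add: \<delta>_def)
    ultimately show ?thesis unfolding real_norm_def by linarith
  qed
  then show "\<exists>d>0. \<forall>y. norm (y - z) < d \<longrightarrow>
      norm (log_potential E y - log_potential E z - Re (cauchy_transform E z * (y - z))) \<le> e * norm (y - z)"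
    using d(1) \<delta> by (intro exI[of _ "min d \<delta>"]) auto
qed

text \<open>Because \<open>(z - a) / (z - \<xi>) - 1 = (\<xi> - a) / (z - \<xi>)\<close> is small at
  infinity. The limit later fixes constants that symmetry or reality leave undetermined.\<close>

lemma cauchy_transform_at_infinity:
  assumes E: "E \<in> sets lborel" "bounded E"
  shows "((\<lambda>z. (z - a) * cauchy_transform E z) \<longlongrightarrow> of_real (measure lborel E)) at_infinity"
proof -
  have Ef: "emeasure lborel E < \<infinity>" using E(2) by (rule emeasure_bounded_finite)
  obtain R where R: "R > 0" "E \<subseteq> ball a R" using E(2) bounded_subset_ballD by blast
  let ?m = "measure lborel E"
  have bd: "norm ((z - a) * cauchy_transform E z - of_real ?m) \<le> 2 * R * ?m / cmod (z - a)"
    if z: "cmod (z - a) \<ge> 2 * R" for z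
  proof -
    have int: "set_integrable lborel E (\<lambda>\<xi>. (z - a) * (1 / (z - \<xi>)))"
      by (intro set_integrable_mult_right set_integrable_cauchy_kernel E Ef)
    have int1: "set_integrable lborel E (\<lambda>\<xi>. 1 :: complex)" using E(1) Ef by (auto simp: set_integrable_def)
    have "(LINT \<xi>:E|lborel. (1 :: complex)) = of_real ?m"
      using E(1) Ef by (simp add: set_lebesgue_integral_def scaleR_conv_of_real)
    then have "(z - a) * cauchy_transform E z - of_real ?m = (LINT \<xi>:E|lborel. (z - a) * (1 / (z - \<xi>)) - 1)"
      unfolding cauchy_transform_def by (simp only: set_integral_diff[OF int int1] set_integral_mult_right)
    also have "norm \<dots> \<le> (2 * R / cmod (z - a)) * ?m"
    proof (rule norm_set_integral_le_const[OF E(1) Ef set_integral_diff(1)[OF int int1]])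
      fix \<xi> assume "\<xi> \<in> E"
      then have \<xi>: "cmod (\<xi> - a) < R" using R by (auto simp: dist_norm norm_minus_commute)
      have n: "cmod (z - \<xi>) \<ge> cmod (z - a) / 2"
        using norm_triangle_ineq2[of "z - a" "\<xi> - a"] \<xi> z by simp
      have nz: "z - \<xi> \<noteq> 0" "z - a \<noteq> 0" using n z R(1) by auto
      have "(z - a) * (1 / (z - \<xi>)) - 1 = (\<xi> - a) / (z - \<xi>)" using nz by (simp add: field_simps)
      then have "norm ((z - a) * (1 / (z - \<xi>)) - 1) = cmod (\<xi> - a) / cmod (z - \<xi>)" by (simp add: norm_divide)
      also have "\<dots> \<le> R / (cmod (z - a) / 2)"
        using \<xi> n nz R(1) by (intro frac_le) auto
      finally show "norm ((z - a) * (1 / (z - \<xi>)) - 1) \<le> 2 * R / cmod (z - a)" by (simp add: mult.commute)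
    qed
    finally show ?thesis by simp
  qed
  show ?thesis
  proof (rule LIM_zero_cancel, rule Lim_null_comparison)
    show "\<forall>\<^sub>F z in at_infinity. norm ((z - a) * cauchy_transform E z - of_real ?m) \<le> 2 * R * ?m / cmod (z - a)"
      unfolding eventually_at_infinity
    proof (intro exI[of _ "2 * R + cmod a"] allI impI bd)
      fix x assume "2 * R + cmod a \<le> cmod x" then show "2 * R \<le> cmod (x - a)"
        using norm_triangle_ineq2[of x a] by linarith
    qed
    have "filterlim (\<lambda>z. z - a) at_infinity at_infinity"
      using filterlim_at_infinity_imp_norm_at_top[of "\<lambda>z::complex. z" at_infinity]
        tendsto_add_filterlim_at_infinity[of "\<lambda>_. - a" "- a" at_infinity "\<lambda>z. z"]
      by (auto simp: filterlim_ident)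
    then show "((\<lambda>z. 2 * R * ?m / cmod (z - a)) \<longlongrightarrow> 0) at_infinity"
      by (intro tendsto_divide_0[OF tendsto_const] filterlim_at_top_imp_at_infinity filterlim_at_infinity_imp_norm_at_top)
  qed
qed

subsection \<open>Cauchy transforms of discs\<close>

lemma integral_motion:
  fixes f :: "complex \<Rightarrow> 'a::{banach, second_countable_topology}"
  assumes "cmod u = 1" "f \<in> borel_measurable borel"
  shows "(LINT z|lborel. f (b + u * z)) = (LINT z|lborel. f z)"
proof -
  have "(LINT z|lborel. f z) = (LINT z|distr lborel borel (\<lambda>z. b + u * z). f z)"
    by (simp only: lborel_distr_motion[OF assms(1)])
  also have "\<dots> = (LINT z|lborel. f (b + u * z))"
    by (rule integral_distr) (use assms(2) in auto)
  finally show ?thesis by simp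
qed

definition rot_invariant :: "complex \<Rightarrow> complex set \<Rightarrow> bool" where
  "rot_invariant a E \<longleftrightarrow> (\<forall>u \<zeta>. cmod u = 1 \<longrightarrow> (a + u * \<zeta> \<in> E \<longleftrightarrow> a + \<zeta> \<in> E))"

lemma rot_invariant_ball: "rot_invariant a (ball a r)"
  by (auto simp: rot_invariant_def dist_norm norm_mult)

lemma rot_invariant_Diff: "rot_invariant a E \<Longrightarrow> rot_invariant a F \<Longrightarrow> rot_invariant a (E - F)"
  by (auto simp: rot_invariant_def)

text \<open>Rotating the integration variable about \<open>a\<close> preserves \<open>E\<close> and
  multiplies the kernel by \<open>1 / u\<close>.\<close>

lemma cauchy_transform_rotation:
  assumes "rot_invariant a E" "cmod u = 1" "E \<in> sets lborel"
  shows "cauchy_transform E (a + u * \<zeta>) = cauchy_transform E (a + \<zeta>) / u"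
proof -
  let ?f = "\<lambda>\<xi>. indicat_real E \<xi> *\<^sub>R (1 / (a + u * \<zeta> - \<xi>))"
  have "cauchy_transform E (a + u * \<zeta>) = (LINT \<xi>|lborel. ?f \<xi>)"
    by (simp add: cauchy_transform_def set_lebesgue_integral_def)
  also have "\<dots> = (LINT \<xi>|lborel. ?f ((a - u * a) + u * \<xi>))"
    by (rule integral_motion[symmetric]) (use assms in \<open>auto\<close>)
  also have "\<dots> = (LINT \<xi>|lborel. (indicat_real E \<xi> *\<^sub>R (1 / (a + \<zeta> - \<xi>))) / u)"
  proof (rule Bochner_Integration.integral_cong)
    fix \<xi>
    have e: "a - u * a + u * \<xi> = a + u * (\<xi> - a)" by (simp add: algebra_simps)
    have "a + u * (\<xi> - a) \<in> E \<longleftrightarrow> a + (\<xi> - a) \<in> E"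
      using assms(1,2) unfolding rot_invariant_def by blast
    then have "a - u * a + u * \<xi> \<in> E \<longleftrightarrow> \<xi> \<in> E" unfolding e by simp
    then have "indicat_real E (a - u * a + u * \<xi>) = indicat_real E \<xi>" by (simp add: indicator_def)
    moreover have "a + u * \<zeta> - (a - u * a + u * \<xi>) = (a + \<zeta> - \<xi>) * u" by (simp add: algebra_simps)
    ultimately show "?f ((a - u * a) + u * \<xi>) = (indicat_real E \<xi> *\<^sub>R (1 / (a + \<zeta> - \<xi>))) / u"
      by (simp only:) (simp add: scaleR_conv_of_real)
  qed simp
  also have "\<dots> = cauchy_transform E (a + \<zeta>) / u"
    by (simp add: cauchy_transform_def set_lebesgue_integral_def)
  finally show ?thesis .
qed

text \<open>Constancy on the circle through \<open>z\<close> about 0 means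
  \<open>\<i> * z * deriv J z = 0\<close>. This says nothing at the origin, but a single exceptional
  point is harmless for a continuous function.\<close>

lemma holomorphic_rotation_invariant_constant:
  assumes S: "open S" "connected S" and J: "J holomorphic_on S"
    and inv: "\<And>u z. cmod u = 1 \<Longrightarrow> z \<in> S \<Longrightarrow> u * z \<in> S \<and> J (u * z) = J z"
  obtains c where "\<And>z. z \<in> S \<Longrightarrow> J z = c"
proof -
  have "(J has_field_derivative 0) (at z)" if z: "z \<in> S - {0}" for z
  proof -
    have d: "(J has_field_derivative deriv J z) (at z)"
      using z holomorphic_derivI[OF J S(1)] by auto
    have e: "((\<lambda>t. exp (\<i> * of_real t) * z) has_vector_derivative \<i> * z) (at 0)"
      by (rule has_vector_derivative_real_field) (auto intro!: derivative_eq_intros)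
    have "((J \<circ> (\<lambda>t. exp (\<i> * of_real t) * z)) has_vector_derivative \<i> * z * deriv J z) (at 0)"
      by (rule field_vector_diff_chain_at[OF e]) (use d in simp)
    moreover have "J \<circ> (\<lambda>t. exp (\<i> * of_real t) * z) = (\<lambda>t. J z)"
    proof
      fix t :: real
      have "cmod (exp (\<i> * of_real t)) = 1" by simp
      then show "(J \<circ> (\<lambda>t. exp (\<i> * of_real t) * z)) t = J z" using inv z by simp
    qed
    ultimately have "((\<lambda>t::real. J z) has_vector_derivative \<i> * z * deriv J z) (at 0)" by simp
    moreover have "((\<lambda>t::real. J z) has_vector_derivative 0) (at 0)" by simp
    ultimately have "\<i> * z * deriv J z = 0" by (rule vector_derivative_unique_at)
    then have "deriv J z = 0" using z by simp
    with d show ?thesis by simp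
  qed
  then show ?thesis
    using DERIV_zero_connected_constant[OF S(2,1), of "{0}" J] J that
    by (meson finite.emptyI finite.insertI holomorphic_on_imp_continuous_on)
qed

text \<open>The factor \<open>\<zeta>\<close> cancels the \<open>1 / u\<close> of
  \<open>cauchy_transform_rotation\<close>, so the product is holomorphic and rotation
  invariant.\<close>

lemma radial_cauchy_transform_constant:
  assumes E: "E \<in> sets lborel" "emeasure lborel E < \<infinity>" "rot_invariant a E"
    and S: "open S" "connected S" "(\<lambda>\<zeta>. a + \<zeta>) ` S \<subseteq> - closure E"
    and inv: "\<And>u \<zeta>. cmod u = 1 \<Longrightarrow> \<zeta> \<in> S \<Longrightarrow> u * \<zeta> \<in> S"
  shows "\<exists>c. \<forall>\<zeta>\<in>S. \<zeta> * cauchy_transform E (a + \<zeta>) = c"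
proof -
  define J where "J = (\<lambda>\<zeta>. \<zeta> * cauchy_transform E (a + \<zeta>))"
  have "(cauchy_transform E \<circ> (\<lambda>\<zeta>. a + \<zeta>)) holomorphic_on S"
    by (intro holomorphic_on_compose_gen[OF _ cauchy_transform_holomorphic_off[OF E(1,2)] S(3)] holomorphic_intros)
  then have J: "J holomorphic_on S"
    unfolding J_def by (auto intro!: holomorphic_intros simp: o_def)
  have "u * \<zeta> \<in> S \<and> J (u * \<zeta>) = J \<zeta>" if "cmod u = 1" "\<zeta> \<in> S" for u \<zeta>
    using that inv cauchy_transform_rotation[OF E(3) that(1) E(1)] by (auto simp: J_def)
  then obtain c where "\<And>\<zeta>. \<zeta> \<in> S \<Longrightarrow> J \<zeta> = c"
    using holomorphic_rotation_invariant_constant[OF S(1,2) J] by metis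
  then show ?thesis unfolding J_def by blast
qed

text \<open>The constant of the radial lemma is read off at infinity.\<close>

lemma cauchy_transform_radial_outside:
  assumes E: "E \<in> sets lborel" "rot_invariant a E" "E \<subseteq> cball a r" and z: "cmod (z - a) > r" "r \<ge> 0"
  shows "cauchy_transform E z = of_real (measure lborel E) / (z - a)"
proof -
  have bE: "bounded E" using E(3) bounded_cball bounded_subset by blast
  have Ef: "emeasure lborel E < \<infinity>" using bE by (rule emeasure_bounded_finite)
  define S where "S = - cball (0::complex) r"
  have "closure E \<subseteq> cball a r" using E(3) by (simp add: closure_minimal)
  then have sub: "(\<lambda>\<zeta>. a + \<zeta>) ` S \<subseteq> - closure E" by (auto simp: S_def dist_norm)
  have con: "connected S" unfolding S_def by (rule connected_complement_bounded_convex) auto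
  have "open S" by (simp add: S_def open_Compl)
  from radial_cauchy_transform_constant[OF E(1) Ef E(2) this con sub]
  obtain c where c: "\<And>\<zeta>. \<zeta> \<in> S \<Longrightarrow> \<zeta> * cauchy_transform E (a + \<zeta>) = c"
    by (auto simp: S_def norm_mult)
  have "((\<lambda>w. (w - a) * cauchy_transform E w) \<longlongrightarrow> c) at_infinity"
  proof (rule tendsto_eventually)
    show "\<forall>\<^sub>F w in at_infinity. (w - a) * cauchy_transform E w = c"
      unfolding eventually_at_infinity
    proof (intro exI[of _ "r + cmod a + 1"] allI impI)
      fix x assume "r + cmod a + 1 \<le> cmod x"
      then have "x - a \<in> S" using norm_triangle_ineq2[of x a] by (auto simp: S_def)
      from c[OF this] show "(x - a) * cauchy_transform E x = c" by simp
    qed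
  qed
  then have ceq: "c = of_real (measure lborel E)"
    using tendsto_unique[OF _ _ cauchy_transform_at_infinity[OF E(1) bE, of a]] by (auto simp: trivial_limit_at_infinity)
  have "z - a \<in> S" "z - a \<noteq> 0" using z by (auto simp: S_def)
  with c[of "z - a"] ceq show ?thesis by (simp add: field_simps)
qed

lemma cauchy_transform_radial_centre:
  assumes E: "E \<in> sets lborel" "rot_invariant a E"
  shows "cauchy_transform E a = 0"
  using cauchy_transform_rotation[OF E(2) _ E(1), of "-1" 0] by auto

text \<open>Here the constant is read off at \<open>\<zeta> = 0\<close>, where the product
  vanishes.\<close>

lemma cauchy_transform_radial_inside:
  assumes E: "E \<in> sets lborel" "emeasure lborel E < \<infinity>" "rot_invariant a E" "E \<inter> ball a s = {}" and z: "cmod (z - a) < s"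
  shows "cauchy_transform E z = 0"
proof (cases "z = a")
  case False
  have "ball a s \<subseteq> - closure E"
    using open_Int_closure_eq_empty[of "ball a s" E] E(4) by auto
  moreover have "(\<lambda>\<zeta>. a + \<zeta>) ` ball 0 s \<subseteq> ball a s" by (auto simp: dist_norm)
  ultimately have "(\<lambda>\<zeta>. a + \<zeta>) ` ball 0 s \<subseteq> - closure E" by blast
  from radial_cauchy_transform_constant[OF E(1-3) open_ball connected_ball this]
  obtain c where c: "\<And>\<zeta>. \<zeta> \<in> ball 0 s \<Longrightarrow> \<zeta> * cauchy_transform E (a + \<zeta>) = c"
    by (auto simp: norm_mult)
  have "0 \<in> ball 0 s" "z - a \<in> ball 0 s" using z by (auto intro: le_less_trans[of 0 "cmod (z - a)" s])
  then have "(z - a) * cauchy_transform E (a + (z - a)) = 0" using c[of 0] c[of "z - a"] by simp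
  then show ?thesis using False by simp
qed (use cauchy_transform_radial_centre E in auto)

text \<open>The radius \<open>\<delta>\<close> is free and can be balanced against a small area;
  this serves for a thin annulus that starts at the circle through \<open>z\<close>.\<close>

lemma norm_cauchy_transform_le_measure:
  assumes E: "E \<in> sets lborel" "emeasure lborel E < \<infinity>" and \<delta>: "\<delta> > 0"
  shows "norm (cauchy_transform E z) \<le> 4 * pi * \<delta> + measure lborel E / \<delta>"
proof -
  let ?N = "E \<inter> ball z \<delta>" and ?F = "E - ball z \<delta>"
  have En: "?N \<in> sets lborel" "?F \<in> sets lborel" using E(1) by auto
  have Ff: "emeasure lborel ?F < \<infinity>"
    using emeasure_mono[of ?F E lborel] E by (auto simp: le_less_trans)
  have "norm (cauchy_transform ?F z) \<le> 1 / \<delta> * measure lborel ?F"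
    unfolding cauchy_transform_def
  proof (rule norm_set_integral_le_const[OF En(2) Ff set_integrable_cauchy_kernel[OF En(2) Ff]])
    fix \<xi> assume "\<xi> \<in> ?F"
    then have "cmod (z - \<xi>) \<ge> \<delta>" by (auto simp: dist_norm)
    then show "norm (1 / (z - \<xi>)) \<le> 1 / \<delta>" using \<delta> by (auto simp: norm_divide intro!: divide_left_mono mult_pos_pos)
  qed
  also have "\<dots> \<le> 1 / \<delta> * measure lborel E"
    using measure_mono_fmeasurable[of ?F E lborel] E En \<delta> by (intro mult_left_mono) (auto simp: fmeasurable_def)
  finally have "norm (cauchy_transform ?F z) \<le> measure lborel E / \<delta>" by simp
  moreover have "norm (cauchy_transform ?N z) \<le> 4 * pi * \<delta>"
    by (rule norm_cauchy_transform_ball_le[OF En(1) _ \<delta>]) auto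
  moreover have "cauchy_transform E z = cauchy_transform ?N z + cauchy_transform ?F z"
    by (rule cauchy_transform_split[OF E]) auto
  ultimately show ?thesis using norm_triangle_ineq[of "cauchy_transform ?N z" "cauchy_transform ?F z"] by simp
qed

text \<open>The radial formula covers the open exterior; continuity adds the circle itself, where
  the boundary conditions are evaluated.\<close>

lemma cauchy_transform_ball_outside:
  assumes "r > 0" "cmod (z - a) \<ge> r"
  shows "cauchy_transform (ball a r) z = of_real (pi * r\<^sup>2) / (z - a)"
proof -
  have "- cball a r \<subseteq> {z. (z - a) * cauchy_transform (ball a r) z = of_real (pi * r\<^sup>2)}"
  proof
    fix w assume "w \<in> - cball a r"
    then have w: "cmod (w - a) > r" by (auto simp: dist_norm norm_minus_commute)
    then have "w - a \<noteq> 0" using assms(1) by auto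
    then show "w \<in> {z. (z - a) * cauchy_transform (ball a r) z = of_real (pi * r\<^sup>2)}"
      using cauchy_transform_radial_outside[of "ball a r" a r w] w assms(1)
      by (simp add: rot_invariant_ball measure_ball_complex)
  qed
  moreover have "continuous_on UNIV (cauchy_transform (ball a r))"
    by (rule cauchy_transform_continuous[OF _ emeasure_bounded_finite[OF bounded_ball]]) simp
  then have "closed {z. (z - a) * cauchy_transform (ball a r) z = of_real (pi * r\<^sup>2)}"
    by (intro closed_Collect_eq continuous_intros)
  ultimately have "closure (- cball a r) \<subseteq> {z. (z - a) * cauchy_transform (ball a r) z = of_real (pi * r\<^sup>2)}"
    by (rule closure_minimal)
  moreover have "closure (- cball a r) = - ball a r" by (simp add: closure_complement)
  moreover have "z \<in> - ball a r" using assms by (auto simp: dist_norm norm_minus_commute)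
  moreover have "z - a \<noteq> 0" using assms by auto
  ultimately show ?thesis by (auto simp: field_simps)
qed

text \<open>The part of the disc outside the circle through \<open>z\<close> does not contribute, and the part inside
  acts like a point mass at the centre.\<close>

lemma cauchy_transform_ball_inside:
  assumes "cmod (z - a) < r"
  shows "cauchy_transform (ball a r) z = of_real pi * cnj (z - a)"
proof (cases "z = a")
  case True
  then show ?thesis using cauchy_transform_radial_centre[of "ball a r" a] rot_invariant_ball by auto
next
  case False
  define s where "s = cmod (z - a)"
  have s: "s > 0" "s < r" using False assms by (auto simp: s_def)
  have fin: "emeasure lborel (ball a t) < \<infinity>" "emeasure lborel (ball a t - B) < \<infinity>" for t B
    by (rule emeasure_bounded_finite, rule bounded_subset[OF bounded_ball[of a t]], blast)+
  have sp: "cauchy_transform (ball a t') z = cauchy_transform (ball a t) z + cauchy_transform (ball a t' - ball a t) z"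
    if "t \<le> t'" for t t'
  proof -
    have "ball a t' \<inter> ball a t = ball a t" using that by auto
    then show ?thesis using cauchy_transform_split[of "ball a t'" "ball a t" z] fin(1)[of t'] by simp
  qed
  have "cauchy_transform (ball a r) z = cauchy_transform (ball a s) z"
  proof (rule ccontr)
    assume ne: "\<not> ?thesis"
    define e where "e = norm (cauchy_transform (ball a r) z - cauchy_transform (ball a s) z)"
    have e: "e > 0" using ne by (simp add: e_def)
    \<comment> \<open>The radius \<open>t\<close> below is such that the annulus between
      \<open>s\<close> and \<open>t\<close> has area \<open>pi * \<delta>\<^sup>2\<close>; its
      transform is then at most \<open>5 * pi * \<delta> < e\<close>. The second entry of the
      minimum ensures \<open>t < r\<close>.\<close>
    define \<delta> where "\<delta> = min (e / (6 * pi)) (sqrt (r\<^sup>2 - s\<^sup>2) / 2)"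
    have rs: "r\<^sup>2 - s\<^sup>2 > 0" using s by (simp add: power_strict_mono)
    have \<delta>: "\<delta> > 0" "6 * pi * \<delta> \<le> e" using e rs by (auto simp: \<delta>_def min_def field_simps)
    have "\<delta>\<^sup>2 \<le> (sqrt (r\<^sup>2 - s\<^sup>2) / 2)\<^sup>2" using \<delta> by (intro power_mono) (auto simp: \<delta>_def)
    then have "\<delta>\<^sup>2 \<le> (r\<^sup>2 - s\<^sup>2) / 4" using rs by (simp add: power_divide)
    then have \<delta>2: "s\<^sup>2 + \<delta>\<^sup>2 < r\<^sup>2" using rs by (auto simp: field_simps)
    define t where "t = sqrt (s\<^sup>2 + \<delta>\<^sup>2)"
    have t2: "t\<^sup>2 = s\<^sup>2 + \<delta>\<^sup>2" by (simp add: t_def)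
    have t: "s < t" "t < r"
      using \<delta> s \<delta>2 t2 by (auto intro: power2_less_imp_less simp: t_def real_less_rsqrt real_sqrt_less_iff)
    have "cauchy_transform (ball a r - ball a t) z = 0"
      by (rule cauchy_transform_radial_inside[where a = a and s = t])
         (use t s fin in \<open>auto simp: rot_invariant_ball rot_invariant_Diff s_def\<close>)
    then have "e = norm (cauchy_transform (ball a t - ball a s) z)"
      using sp[of t r] sp[of s t] t by (simp add: e_def)
    also have "\<dots> \<le> 4 * pi * \<delta> + measure lborel (ball a t - ball a s) / \<delta>"
      by (rule norm_cauchy_transform_le_measure) (use fin \<delta> in auto)
    also have "measure lborel (ball a t - ball a s) = pi * \<delta>\<^sup>2"
    proof -
      have "ball a s \<subseteq> ball a t" using t by (intro subset_ball) auto
      then have "measure lborel (ball a t - ball a s) = measure lborel (ball a t) - measure lborel (ball a s)"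
        using fin(1)[of t] by (intro measure_Diff) auto
      then show ?thesis using s t by (simp add: measure_ball_complex t2 algebra_simps)
    qed
    also have "4 * pi * \<delta> + pi * \<delta>\<^sup>2 / \<delta> = 5 * pi * \<delta>" using \<delta> by (simp add: power2_eq_square)
    finally have "e \<le> 5 * pi * \<delta>" .
    moreover have "5 * pi * \<delta> < 6 * pi * \<delta>" using \<delta> by simp
    ultimately show False using \<delta>(2) by linarith
  qed
  also have "\<dots> = of_real (pi * s\<^sup>2) / (z - a)"
    by (rule cauchy_transform_ball_outside) (use s in \<open>auto simp: s_def\<close>)
  also have "\<dots> = of_real pi * cnj (z - a)"
  proof -
    have "of_real (s\<^sup>2) = (z - a) * cnj (z - a)" unfolding s_def by (rule complex_norm_square)
    then have "of_real (pi * s\<^sup>2) = of_real pi * ((z - a) * cnj (z - a))" by simp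
    then show ?thesis using False by (simp del: complex_cnj_diff of_real_mult)
  qed
  finally show ?thesis .
qed

text \<open>Holomorphy is local: a disc about \<open>z0\<close> inside \<open>E\<close> contributes
  exactly \<open>pi * cnj (z - z0)\<close>, and the rest of \<open>E\<close> stays away from
  \<open>z0\<close>.\<close>

lemma cauchy_transform_dbar:
  assumes "open E" "emeasure lborel E < \<infinity>"
  shows "(\<lambda>z. cauchy_transform E z - of_real pi * cnj z) holomorphic_on E"
proof -
  have "(\<lambda>z. cauchy_transform E z - of_real pi * cnj z) field_differentiable at z0" if "z0 \<in> E" for z0
  proof -
    from openE[OF assms(1) that] obtain d where d: "d > 0" "ball z0 d \<subseteq> E" by blast
    have Ff: "emeasure lborel (E - ball z0 d) < \<infinity>"
      using emeasure_mono[of "E - ball z0 d" E lborel] assms by (auto simp: le_less_trans)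
    have Fs: "E - ball z0 d \<in> sets lborel" using assms(1) by auto
    have "(cauchy_transform (E - ball z0 d) has_field_derivative
         - (LINT \<xi>:E - ball z0 d|lborel. 1 / (z0 - \<xi>)\<^sup>2)) (at z0)"
      by (rule cauchy_transform_has_field_derivative_off[OF Fs Ff d(1)]) auto
    then have fd: "(\<lambda>z. cauchy_transform (E - ball z0 d) z - of_real pi * cnj z0) field_differentiable at z0"
      by (intro derivative_intros) (auto simp: field_differentiable_def)
    show ?thesis
    proof (rule field_differentiable_transform_within[OF d(1) UNIV_I _ fd])
      fix z assume z: "dist z z0 < d"
      have "E \<inter> ball z0 d = ball z0 d" using d by auto
      then have "cauchy_transform E z = cauchy_transform (ball z0 d) z + cauchy_transform (E - ball z0 d) z"
        using cauchy_transform_split[of E "ball z0 d" z] assms by simp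
      also have "cauchy_transform (ball z0 d) z = of_real pi * cnj (z - z0)"
        by (rule cauchy_transform_ball_inside) (use z in \<open>simp add: dist_norm\<close>)
      finally show "cauchy_transform (E - ball z0 d) z - of_real pi * cnj z0 = cauchy_transform E z - of_real pi * cnj z"
        by (simp add: algebra_simps)
    qed
  qed
  then show ?thesis by (simp add: field_differentiable_at_within holomorphic_on_def)
qed

subsection \<open>The Cauchy--Pompeiu formula and Green's theorem\<close>

lemma integrable_continuous_bounded_support:
  fixes f :: "complex \<Rightarrow> 'a::{banach, second_countable_topology}"
  assumes "continuous_on UNIV f" and "\<And>z. cmod z \<ge> R \<Longrightarrow> f z = 0"
  shows "integrable lborel f"
proof -
  have "integrable lborel (\<lambda>z. indicator (cball 0 R) z *\<^sub>R f z)"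
    using assms(1) by (intro borel_integrable_compact) (auto intro: continuous_on_subset)
  moreover have "(\<lambda>z. indicator (cball 0 R) z *\<^sub>R f z) = f"
    using assms(2) by (auto simp: fun_eq_iff indicator_def)
  ultimately show ?thesis by simp
qed

lemma continuous_on_norm_bound:
  fixes f :: "complex \<Rightarrow> 'a::real_normed_vector"
  assumes "continuous_on UNIV f"
  obtains M where "M > 0" "\<And>z. cmod z \<le> R \<Longrightarrow> norm (f z) \<le> M"
proof -
  have "compact (f ` cball 0 R)"
    using assms by (intro compact_continuous_image) (auto intro: continuous_on_subset)
  then have "bounded (f ` cball 0 R)" by (rule compact_imp_bounded)
  then obtain M where "M > 0" "\<And>y. y \<in> f ` cball 0 R \<Longrightarrow> norm y \<le> M"
    by (meson bounded_pos)
  then show ?thesis using that[of M] by auto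
qed

lemma integral_translation:
  fixes f :: "complex \<Rightarrow> 'a::{banach, second_countable_topology}"
  assumes "f \<in> borel_measurable borel"
  shows "(LINT z|lborel. f (z + b)) = (LINT z|lborel. f z)"
proof -
  have "(LINT z|lborel. f (b + 1 * z)) = (LINT z|lborel. f z)"
    by (rule integral_motion) (use assms in auto)
  moreover have "(\<lambda>z. f (b + 1 * z)) = (\<lambda>z. f (z + b))" by (simp add: add.commute[of b])
  ultimately show ?thesis by (simp only:)
qed

text \<open>The difference quotients have vanishing integral by translation invariance.\<close>

lemma integral_directional_derivative_zero:
  fixes f :: "complex \<Rightarrow> complex"
  assumes der: "\<And>z. (f has_derivative f' z) (at z)" and cont: "continuous_on UNIV (\<lambda>z. f' z e)"
    and supp: "\<And>z. cmod z \<ge> R \<Longrightarrow> f z = 0" and e: "cmod e = 1"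
  shows "(LINT z|lborel. f' z e) = 0"
proof -
  have cf: "continuous_on UNIV f"
    by (intro continuous_at_imp_continuous_on ballI has_derivative_continuous[OF der])
  then have [measurable]: "f \<in> borel_measurable borel" by (rule borel_measurable_continuous_onI)
  have [measurable]: "(\<lambda>z. f' z e) \<in> borel_measurable borel" using cont by (rule borel_measurable_continuous_onI)
  obtain M where M: "M > 0" "\<And>z. cmod z \<le> \<bar>R\<bar> + 2 \<Longrightarrow> norm (f' z e) \<le> M"
    using continuous_on_norm_bound[OF cont] by blast
  \<comment> \<open>Difference quotients with steps of length at most 1, so all their supports lie
    in one ball of radius \<open>|R| + 1\<close>.\<close>
  define s where "s = (\<lambda>n z. (f (z + of_real (1 / Suc n) * e) - f z) / of_real (1 / Suc n))"
  have path: "((\<lambda>t. f (z + of_real t * e)) has_vector_derivative f' (z + of_real t * e) e) (at t within T)" for z t T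
  proof -
    have "((\<lambda>t. z + of_real t * e) has_vector_derivative e) (at t within T)"
      by (auto intro!: derivative_eq_intros simp: has_vector_derivative_def scaleR_conv_of_real)
    from vector_derivative_diff_chain_within[OF this has_derivative_at_withinI[OF der]]
    show ?thesis by (simp add: o_def)
  qed
  have bound: "norm (s n z) \<le> M * indicator (cball 0 (\<bar>R\<bar> + 1)) z" for n z
  proof (cases "cmod z \<le> \<bar>R\<bar> + 1")
    case True
    define h where "h = 1 / real (Suc n)"
    have h: "0 < h" "h \<le> 1" by (auto simp: h_def)
    have "norm (f (z + of_real h * e) - f (z + of_real 0 * e)) \<le> M * h - M * 0"
    proof (rule differentiable_bound_general[where f = "\<lambda>t. f (z + of_real t * e)" and \<phi> = "\<lambda>t. M * t"
         and f' = "\<lambda>t. f' (z + of_real t * e) e" and \<phi>' = "\<lambda>t. M"])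
      show "continuous_on {0..h} (\<lambda>t. f (z + of_real t * e))"
        by (rule continuous_on_compose2[OF cf]) (auto intro!: continuous_intros)
      fix t assume t: "0 < t" "t < h"
      have "cmod (z + of_real t * e) \<le> cmod z + t * cmod e"
        using norm_triangle_ineq[of z "of_real t * e"] t by (simp add: norm_mult)
      then show "norm (f' (z + of_real t * e) e) \<le> M" using M(2) t h e True by simp
      show "((\<lambda>t. f (z + of_real t * e)) has_vector_derivative f' (z + of_real t * e) e) (at t)"
        by (rule path)
    qed (use h in \<open>auto intro!: continuous_intros derivative_eq_intros\<close>)
    then have "norm (f (z + of_real h * e) - f z) / h \<le> M" using h by (simp add: divide_le_eq)
    moreover have "norm (s n z) = norm (f (z + of_real h * e) - f z) / h"
      using h by (simp add: s_def h_def norm_divide del: of_real_divide)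
    ultimately show ?thesis using True by simp
  next
    case False
    have "cmod (z + of_real (1 / Suc n) * e) \<ge> cmod z - cmod (of_real (1 / Suc n) * e)"
      using norm_triangle_ineq2[of z "- (of_real (1 / Suc n) * e)"] by simp
    moreover have "cmod (of_real (1 / Suc n) * e) \<le> 1" using e by (simp add: norm_mult norm_divide del: of_nat_Suc)
    ultimately have "f (z + of_real (1 / Suc n) * e) = 0" "f z = 0"
      using False by (auto intro!: supp)
    then show ?thesis using False by (simp add: s_def)
  qed
  have lim: "(\<lambda>n. s n z) \<longlonglongrightarrow> f' z e" for z
  proof -
    define \<phi> where "\<phi> = (\<lambda>t::real. f (z + of_real t * e))"
    have "(\<phi> has_vector_derivative f' z e) (at 0)"
      using path[of z 0 UNIV] by (simp add: \<phi>_def)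
    then have A: "((\<lambda>y. norm (\<phi> y - \<phi> 0 - (y - 0) *\<^sub>R f' z e) / norm (y - 0)) \<longlongrightarrow> 0) (at 0)"
      unfolding has_vector_derivative_def has_derivative_iff_norm by blast
    have B: "filterlim (\<lambda>n. 1 / real (Suc n)) (at 0) sequentially"
      using LIMSEQ_inverse_real_of_nat by (auto simp: filterlim_at inverse_eq_divide simp del: of_nat_Suc)
    have "(\<lambda>n. norm (\<phi> (1 / real (Suc n)) - \<phi> 0 - (1 / real (Suc n) - 0) *\<^sub>R f' z e) / norm (1 / real (Suc n) - 0)) \<longlonglongrightarrow> 0"
      by (rule filterlim_compose[OF A B])
    moreover have "norm (\<phi> (1 / real (Suc n)) - \<phi> 0 - (1 / real (Suc n) - 0) *\<^sub>R f' z e) / norm (1 / real (Suc n) - 0)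
      = norm (s n z - f' z e)" for n
    proof -
      define h where "h = 1 / real (Suc n)"
      have h: "h > 0" by (simp add: h_def)
      have "s n z - f' z e = (\<phi> h - \<phi> 0 - (h - 0) *\<^sub>R f' z e) / of_real h"
        using h unfolding s_def \<phi>_def h_def[symmetric] by (simp add: scaleR_conv_of_real diff_divide_distrib)
      then show ?thesis using h unfolding h_def[symmetric] by (simp add: norm_divide)
    qed
    ultimately have "(\<lambda>n. norm (s n z - f' z e)) \<longlonglongrightarrow> 0" by (simp only:)
    then show ?thesis by (rule LIM_zero_cancel[OF tendsto_norm_zero_cancel])
  qed
  have "(\<lambda>n. LINT z|lborel. s n z) \<longlonglongrightarrow> (LINT z|lborel. f' z e)"
  proof (rule integral_dominated_convergence)
    show "integrable lborel (\<lambda>z. M * indicator (cball (0::complex) (\<bar>R\<bar> + 1)) z)"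
      using emeasure_bounded_finite[OF bounded_cball[of "0::complex" "\<bar>R\<bar> + 1"]] by simp
    show "s n \<in> borel_measurable lborel" for n unfolding s_def by measurable
  qed (use lim bound in auto)
  moreover have "(LINT z|lborel. s n z) = 0" for n
  proof -
    have int: "integrable lborel f" by (rule integrable_continuous_bounded_support[OF cf supp])
    have int2: "integrable lborel (\<lambda>z. f (z + of_real (1 / Suc n) * e))"
    proof (rule integrable_continuous_bounded_support[where R = "R + 1"])
      show "continuous_on UNIV (\<lambda>z. f (z + of_real (1 / Suc n) * e))"
        by (rule continuous_on_compose2[OF cf]) (auto intro!: continuous_intros)
      fix z :: complex assume "cmod z \<ge> R + 1"
      moreover have "cmod (z + of_real (1 / Suc n) * e) \<ge> cmod z - cmod (of_real (1 / Suc n) * e)"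
        using norm_triangle_ineq2[of z "- (of_real (1 / Suc n) * e)"] by simp
      moreover have "cmod (of_real (1 / Suc n) * e) \<le> 1" using e by (simp add: norm_mult norm_divide del: of_nat_Suc)
      ultimately show "f (z + of_real (1 / Suc n) * e) = 0" by (intro supp) linarith
    qed
    have "(LINT z|lborel. f (z + of_real (1 / Suc n) * e) - f z) = 0"
      using integral_translation[of f "of_real (1 / Suc n) * e"]
      by (subst Bochner_Integration.integral_diff[OF int2 int]) simp
    then show ?thesis unfolding s_def by simp
  qed
  ultimately have "(\<lambda>n::nat. 0) \<longlonglongrightarrow> (LINT z|lborel. f' z e)" by (simp only:)
  from LIMSEQ_unique[OF this tendsto_const] show ?thesis by simp
qed

text \<open>\<open>G' z\<close> is the real differential of a complex-valued function; its
  continuity is expressed through the two partial derivatives.\<close>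

definition C1_compact :: "(complex \<Rightarrow> complex) \<Rightarrow> (complex \<Rightarrow> complex \<Rightarrow> complex) \<Rightarrow> bool" where
  "C1_compact G G' \<longleftrightarrow> (\<forall>z. (G has_derivative G' z) (at z)) \<and> continuous_on UNIV (\<lambda>z. G' z 1) \<and>
     continuous_on UNIV (\<lambda>z. G' z \<i>) \<and> bounded {z. G z \<noteq> 0}"

text \<open>Twice the Wirtinger derivative \<open>\<partial>/\<partial>z\<^bold>*\<close>.\<close>

definition dbar2 :: "(complex \<Rightarrow> complex \<Rightarrow> complex) \<Rightarrow> complex \<Rightarrow> complex" where
  "dbar2 G' z = G' z 1 + \<i> * G' z \<i>"

lemma C1_compactE:
  assumes "C1_compact G G'"
  obtains R where "R > 0" "\<And>z. cmod z \<ge> R \<Longrightarrow> G z = 0" "\<And>z. cmod z \<ge> R \<Longrightarrow> dbar2 G' z = 0"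
    "\<And>z. cmod z \<ge> R \<Longrightarrow> G' z = (\<lambda>_. 0)"
proof -
  obtain R where R: "\<And>z. G z \<noteq> 0 \<Longrightarrow> cmod z \<le> R"
    using assms unfolding C1_compact_def bounded_iff by blast
  have G0: "G z = 0" if "cmod z > R" for z using R[of z] that by force
  have G'0: "G' z = (\<lambda>_. 0)" if z: "cmod z > R" for z
  proof -
    have "open (- cball 0 R)" "z \<in> - cball 0 R" using z by auto
    then have "((\<lambda>_. 0) has_derivative G' z) (at z)"
      using assms unfolding C1_compact_def
      by (elim conjE allE[of _ z]) (rule has_derivative_transform_within_open[of G], auto simp: G0)
    then show ?thesis using has_derivative_unique has_derivative_const by blast
  qed
  have "dbar2 G' z = 0" if "cmod z > R" for z using G'0[OF that] by (simp add: dbar2_def)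
  with G0 G'0 show ?thesis by (intro that[of "\<bar>R\<bar> + 1"]) force+
qed

lemma C1_compact_continuous:
  assumes "C1_compact G G'"
  shows "continuous_on UNIV G" "continuous_on UNIV (dbar2 G')"
proof -
  have "(G has_derivative G' z) (at z)" for z using assms by (simp add: C1_compact_def)
  then show "continuous_on UNIV G"
    by (intro continuous_at_imp_continuous_on ballI has_derivative_continuous)
  show "continuous_on UNIV (dbar2 G')"
    using assms unfolding C1_compact_def dbar2_def by (auto intro!: continuous_intros)
qed

lemma integral_dbar2_zero:
  assumes "C1_compact G G'"
  shows "(LINT z|lborel. dbar2 G' z) = 0"
proof -
  obtain R where R: "R > 0" "\<And>z. cmod z \<ge> R \<Longrightarrow> G z = 0" "\<And>z. cmod z \<ge> R \<Longrightarrow> G' z = (\<lambda>_. 0)"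
    by (rule C1_compactE[OF assms]) blast
  have *: "integrable lborel (\<lambda>z. G' z e) \<and> (LINT z|lborel. G' z e) = 0" if e: "e \<in> {1, \<i>}" for e
  proof
    have c: "continuous_on UNIV (\<lambda>z. G' z e)" using assms e by (auto simp: C1_compact_def)
    show "(LINT z|lborel. G' z e) = 0"
    proof (rule integral_directional_derivative_zero[where f = G and f' = G' and R = R])
      show "(G has_derivative G' z) (at z)" for z using assms by (simp add: C1_compact_def)
    qed (use c R(2) e in auto)
    show "integrable lborel (\<lambda>z. G' z e)"
      by (rule integrable_continuous_bounded_support[OF c, of R]) (simp add: R(3))
  qed
  then show ?thesis unfolding dbar2_def using *[of 1] *[of \<i>] by simp
qed

text \<open>The Wirtinger derivative of \<open>cnj \<zeta> / (|\<zeta>|^2 + 1)\<close>: the profile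
  of the approximate identity that stands for the point mass of \<open>1 / \<zeta>\<close>.\<close>

definition bump_kernel :: "complex \<Rightarrow> real" where
  "bump_kernel \<zeta> = 1 / (1 + (cmod \<zeta>)\<^sup>2)\<^sup>2"

lemma bump_kernel_pos: "bump_kernel \<zeta> > 0"
proof -
  have "1 + (cmod \<zeta>)\<^sup>2 > 0" by (simp add: add_pos_nonneg)
  then show ?thesis by (simp add: bump_kernel_def)
qed

lemma bump_kernel_continuous: "continuous_on A bump_kernel"
proof -
  have "1 + (cmod \<zeta>)\<^sup>2 \<noteq> 0" for \<zeta> :: complex by (metis add_pos_nonneg less_irrefl zero_le_power2 zero_less_one)
  then show ?thesis unfolding bump_kernel_def by (intro continuous_intros) auto
qed

lemma borel_measurable_bump_kernel [measurable]: "bump_kernel \<in> borel_measurable borel"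
  by (intro borel_measurable_continuous_onI bump_kernel_continuous)

text \<open>For \<open>2^(N-1) \<le> |\<xi>| < 2^N\<close> the decay of order 4 gives
  \<open>16 * (1/16)^N\<close>, against a ball of area \<open>pi * 4^N\<close>: a geometric series
  of ratio \<open>1/4\<close>.\<close>

lemma integrable_bump_kernel: "integrable lborel bump_kernel"
proof (rule integrableI_bounded)
  have "(\<integral>\<^sup>+\<xi>. ennreal (norm (bump_kernel \<xi>)) \<partial>lborel) \<le> ennreal (16 * pi * (1 / (1 - 1/4)))"
  proof (rule nn_integral_le_balls[where c = "\<lambda>n. 16 * (1/16)^n" and \<rho> = "\<lambda>n. 2^n" and z = 0])
    have "16 * (1/16)^n * (pi * (2^n)\<^sup>2) = 16 * pi * (1/4)^n" for n
    proof -
      have "((2::real)^n)\<^sup>2 = 4^n" by (simp add: power_mult[symmetric] mult.commute[of n]) (simp add: power_mult)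
      moreover have "(1/16)^n * 4^n = (1/4 :: real)^n" by (simp flip: power_mult_distrib)
      ultimately show ?thesis by (simp add: mult_ac)
    qed
    moreover have "(\<lambda>n. 16 * pi * (1/4)^n) sums (16 * pi * (1 / (1 - 1/4)))"
      by (intro sums_mult geometric_sums) simp
    ultimately show "(\<lambda>n. 16 * (1/16)^n * (pi * (2^n)\<^sup>2)) sums (16 * pi * (1 / (1 - 1/4)))" by (simp only:)
    fix \<xi> :: complex
    define d where "d = cmod \<xi>"
    define N where "N = (LEAST n. d < 2^n)"
    obtain m where "d < 2 ^ m" using real_arch_pow[of 2 d] by auto
    then have N: "d < 2^N" unfolding N_def by (rule LeastI)
    have "bump_kernel \<xi> \<le> 16 * (1/16)^N"
    proof (cases N)
      case 0
      have "1 \<le> (1 + (cmod \<xi>)\<^sup>2)\<^sup>2" by (simp add: power_le_one one_le_power)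
      then have "bump_kernel \<xi> \<le> 1" by (simp add: bump_kernel_def divide_le_eq)
      then show ?thesis using 0 by simp
    next
      case (Suc k)
      have "\<not> d < 2^k" using not_less_Least[of k "\<lambda>n. d < 2^n"] Suc by (simp add: N_def)
      then have "2^k \<le> d" by simp
      then have "(2^k)^4 \<le> d^4" by (intro power_mono) auto
      also have "d^4 \<le> (1 + d\<^sup>2)\<^sup>2" by (simp add: power2_eq_square power4_eq_xxxx algebra_simps)
      finally have "16^k \<le> (1 + d\<^sup>2)\<^sup>2" by (simp add: power_mult[symmetric] mult.commute[of k]) (simp add: power_mult)
      then have "bump_kernel \<xi> \<le> 1 / 16^k"
        unfolding bump_kernel_def d_def[symmetric] by (intro divide_left_mono) (auto intro!: mult_pos_pos zero_less_power add_pos_nonneg)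
      then show ?thesis using Suc by (simp add: power_divide)
    qed
    then show "ennreal (norm (bump_kernel \<xi>)) = 0 \<or>
        (\<exists>n. \<xi> \<in> ball 0 (2^n) \<and> ennreal (norm (bump_kernel \<xi>)) \<le> ennreal (16 * (1/16)^n))"
      using N bump_kernel_pos[of \<xi>] by (intro disjI2 exI[of _ N]) (simp add: d_def ennreal_leI)
  qed auto
  then show "(\<integral>\<^sup>+\<xi>. ennreal (norm (bump_kernel \<xi>)) \<partial>lborel) < \<infinity>"
    by (rule order_le_less_trans) simp
qed simp

text \<open>Its value is \<open>pi\<close>. It is left symbolic, since Green's theorem is wanted
  only up to a nonzero factor.\<close>

definition bump_mass :: real where "bump_mass = (LINT \<zeta>|lborel. bump_kernel \<zeta>)"

lemma bump_mass_pos: "bump_mass > 0"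
proof -
  have "bump_mass \<ge> 0"
    unfolding bump_mass_def using bump_kernel_pos by (intro integral_nonneg_AE) (auto intro: less_imp_le)
  moreover have "bump_mass \<noteq> 0"
  proof
    assume "bump_mass = 0"
    then have "AE \<zeta> in lborel. bump_kernel \<zeta> = 0"
      unfolding bump_mass_def using integral_nonneg_eq_0_iff_AE[OF integrable_bump_kernel] bump_kernel_pos
      by (auto intro: less_imp_le)
    then have "AE \<zeta> in (lborel :: complex measure). False"
      by (rule eventually_mono) (use bump_kernel_pos in \<open>metis less_irrefl\<close>)
    then show False by (simp add: AE_iff_null null_sets_def)
  qed
  ultimately show ?thesis by simp
qed

lemma integral_scaling:
  fixes f :: "complex \<Rightarrow> complex"
  assumes "f \<in> borel_measurable borel" "\<epsilon> > 0"
  shows "(LINT z|lborel. f z) = of_real (\<epsilon>\<^sup>2) * (LINT z|lborel. f (w + of_real \<epsilon> * z))"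
proof -
  have "(LINT z|lborel. f z) = (LINT z|density (distr lborel borel (\<lambda>x. w + \<epsilon> *\<^sub>R x)) (\<lambda>_. ennreal (\<bar>\<epsilon>\<bar> ^ DIM(complex))). f z)"
    using assms(2) by (subst lborel_affine[of \<epsilon> w]) (auto simp: ennreal_power)
  also have "\<dots> = (LINT z|distr lborel borel (\<lambda>x. w + \<epsilon> *\<^sub>R x). (\<bar>\<epsilon>\<bar> ^ DIM(complex)) *\<^sub>R f z)"
    using assms by (intro integral_density) auto
  also have "\<dots> = (LINT z|lborel. (\<bar>\<epsilon>\<bar> ^ DIM(complex)) *\<^sub>R f (w + \<epsilon> *\<^sub>R z))"
    using assms by (intro integral_distr) auto
  finally show ?thesis using assms(2) by (simp add: scaleR_conv_of_real)
qed

text \<open>The kernel \<open>1/\<zeta>\<close> is regularised to \<open>\<zeta>\<^bold>* / (|\<zeta>|\<^sup>2 + \<epsilon>\<^sup>2)\<close>, for which integration by parts is legitimate.\<close>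

theorem cauchy_pompeiu:
  assumes G: "C1_compact G G'"
  shows "(LINT z|lborel. dbar2 G' z / (w - z)) = of_real (2 * bump_mass) * G w"
proof -
  obtain R where R: "R > 0" "\<And>z. cmod z \<ge> R \<Longrightarrow> G z = 0" "\<And>z. cmod z \<ge> R \<Longrightarrow> dbar2 G' z = 0"
    using C1_compactE[OF G] by metis
  have cG: "continuous_on UNIV G" and cD: "continuous_on UNIV (dbar2 G')"
    using C1_compact_continuous[OF G] by auto
  have [measurable]: "G \<in> borel_measurable borel" "dbar2 G' \<in> borel_measurable borel"
    using cG cD by (auto intro: borel_measurable_continuous_onI)
  obtain M where M: "M > 0" "\<And>z. cmod z \<le> R \<Longrightarrow> norm (dbar2 G' z) \<le> M"
    using continuous_on_norm_bound[OF cD] by blast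
  obtain A where A0: "A > 0" "\<And>z. cmod z \<le> R \<Longrightarrow> norm (G z) \<le> A"
    using continuous_on_norm_bound[OF cG] by blast
  have A: "norm (G z) \<le> A" for z using A0 R(2)[of z] by (cases "cmod z \<le> R") auto
  \<comment> \<open>The regularised kernel \<open>k\<close> is bounded by \<open>1 / |z - w|\<close>
    for every \<open>\<epsilon>\<close>, which yields the dominating function of the limit.\<close>
  define D where "D = (\<lambda>\<epsilon> z. of_real ((cmod (z - w))\<^sup>2 + \<epsilon>\<^sup>2) :: complex)"
  define k where "k = (\<lambda>\<epsilon> z. cnj (z - w) / D \<epsilon> z)"
  have D_eq: "D \<epsilon> z = (z - w) * cnj (z - w) + of_real (\<epsilon>\<^sup>2)" for \<epsilon> z
    unfolding D_def using complex_norm_square[of "z - w"] by simp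
  have Dnz: "D \<epsilon> z \<noteq> 0" if "\<epsilon> > 0" for \<epsilon> z
  proof -
    have "(cmod (z - w))\<^sup>2 + \<epsilon>\<^sup>2 > 0" using that by (intro add_nonneg_pos) auto
    then show ?thesis unfolding D_def by (metis less_irrefl of_real_eq_0_iff)
  qed
  have parts: "(LINT z|lborel. dbar2 G' z * k \<epsilon> z) = - 2 * (LINT z|lborel. G z * (of_real (\<epsilon>\<^sup>2) / (D \<epsilon> z)\<^sup>2))"
    if \<epsilon>: "\<epsilon> > 0" for \<epsilon>
  proof -
    define k' where "k' = (\<lambda>z h. (cnj h * D \<epsilon> z - cnj (z - w) * (h * cnj (z - w) + (z - w) * cnj h)) / (D \<epsilon> z * D \<epsilon> z))"
    have kd: "(k \<epsilon> has_derivative k' z) (at z)" for z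
      unfolding k_def k'_def D_eq using Dnz[OF \<epsilon>, of z] unfolding D_eq
      by (auto intro!: derivative_eq_intros simp: fun_eq_iff field_simps)
    define P' where "P' = (\<lambda>z h. G z * k' z h + G' z h * k \<epsilon> z)"
    have cD': "continuous_on UNIV (D \<epsilon>)" unfolding D_def by (intro continuous_intros)
    have ck: "continuous_on UNIV (k \<epsilon>)" unfolding k_def using Dnz[OF \<epsilon>]
      by (intro continuous_intros cD') auto
    have ck': "continuous_on UNIV (\<lambda>z. k' z h)" for h unfolding k'_def using Dnz[OF \<epsilon>]
      by (intro continuous_intros cD') auto
    have P: "C1_compact (\<lambda>z. G z * k \<epsilon> z) P'"
      unfolding C1_compact_def
    proof (intro conjI allI)
      show "((\<lambda>z. G z * k \<epsilon> z) has_derivative P' z) (at z)" for z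
        unfolding P'_def using G kd by (intro has_derivative_mult) (auto simp: C1_compact_def)
      show "continuous_on UNIV (\<lambda>z. P' z 1)" "continuous_on UNIV (\<lambda>z. P' z \<i>)"
        unfolding P'_def using G by (auto intro!: continuous_intros cG ck ck' simp: C1_compact_def)
      show "bounded {z. G z * k \<epsilon> z \<noteq> 0}"
        using G by (rule_tac bounded_subset[of "{z. G z \<noteq> 0}"]) (auto simp: C1_compact_def)
    qed
    \<comment> \<open>In the numerator \<open>D \<epsilon> z - |z - w|^2\<close> only
      \<open>\<epsilon>^2\<close> survives, so the derivative concentrates at
      \<open>w\<close>.\<close>
    have dk: "dbar2 k' z = 2 * (of_real (\<epsilon>\<^sup>2) / (D \<epsilon> z)\<^sup>2)" for z
    proof -
      have "dbar2 k' z = 2 * (D \<epsilon> z - (z - w) * cnj (z - w)) / (D \<epsilon> z * D \<epsilon> z)"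
        unfolding dbar2_def k'_def by (simp add: field_simps) (simp add: algebra_simps add_divide_distrib diff_divide_distrib)
      then show ?thesis by (simp add: D_eq power2_eq_square)
    qed
    have dP: "dbar2 P' z = G z * (2 * (of_real (\<epsilon>\<^sup>2) / (D \<epsilon> z)\<^sup>2)) + dbar2 G' z * k \<epsilon> z" for z
      unfolding dk[symmetric] by (simp add: dbar2_def P'_def algebra_simps)
    have i1: "integrable lborel (\<lambda>z. G z * (2 * (of_real (\<epsilon>\<^sup>2) / (D \<epsilon> z)\<^sup>2)))"
      using Dnz[OF \<epsilon>] R by (intro integrable_continuous_bounded_support[of _ R] continuous_intros cG cD') auto
    have i2: "integrable lborel (\<lambda>z. dbar2 G' z * k \<epsilon> z)"
      using R by (intro integrable_continuous_bounded_support[of _ R] continuous_intros cD ck) auto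
    have "0 = (LINT z|lborel. dbar2 P' z)" using integral_dbar2_zero[OF P] by simp
    also have "\<dots> = (LINT z|lborel. G z * (2 * (of_real (\<epsilon>\<^sup>2) / (D \<epsilon> z)\<^sup>2))) + (LINT z|lborel. dbar2 G' z * k \<epsilon> z)"
      unfolding dP by (rule Bochner_Integration.integral_add[OF i1 i2])
    also have "(LINT z|lborel. G z * (2 * (of_real (\<epsilon>\<^sup>2) / (D \<epsilon> z)\<^sup>2))) = 2 * (LINT z|lborel. G z * (of_real (\<epsilon>\<^sup>2) / (D \<epsilon> z)\<^sup>2))"
      by (simp only: mult.left_commute[of _ 2] integral_mult_right_zero)
    finally show ?thesis by (simp add: eq_neg_iff_add_eq_0 add.commute)
  qed
  \<comment> \<open>Rescaling about \<open>w\<close> cancels all powers of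
    \<open>\<epsilon>\<close>: one \<open>\<epsilon>^2\<close> from the area and one from the
    numerator against \<open>\<epsilon>^4\<close> from the squared denominator.\<close>
  have scaled: "(LINT z|lborel. G z * (of_real (\<epsilon>\<^sup>2) / (D \<epsilon> z)\<^sup>2)) = (LINT z|lborel. G (w + of_real \<epsilon> * z) * of_real (bump_kernel z))"
    if \<epsilon>: "\<epsilon> > 0" for \<epsilon>
  proof -
    have [measurable]: "D \<epsilon> \<in> borel_measurable borel"
      unfolding D_def by (intro borel_measurable_continuous_onI continuous_intros)
    have "(LINT z|lborel. G z * (of_real (\<epsilon>\<^sup>2) / (D \<epsilon> z)\<^sup>2)) = of_real (\<epsilon>\<^sup>2) *
        (LINT z|lborel. G (w + of_real \<epsilon> * z) * (of_real (\<epsilon>\<^sup>2) / (D \<epsilon> (w + of_real \<epsilon> * z))\<^sup>2))"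
      by (rule integral_scaling[OF _ \<epsilon>]) measurable
    also have "\<dots> = (LINT z|lborel. of_real (\<epsilon>\<^sup>2) * (G (w + of_real \<epsilon> * z) * (of_real (\<epsilon>\<^sup>2) / (D \<epsilon> (w + of_real \<epsilon> * z))\<^sup>2)))"
      by (rule integral_mult_right_zero[symmetric])
    also have "\<dots> = (LINT z|lborel. G (w + of_real \<epsilon> * z) * of_real (bump_kernel z))"
    proof (rule Bochner_Integration.integral_cong)
      fix z
      have "(cmod (of_real \<epsilon> * z))\<^sup>2 + \<epsilon>\<^sup>2 = \<epsilon>\<^sup>2 * (1 + (cmod z)\<^sup>2)"
        by (simp add: norm_mult power_mult_distrib algebra_simps)
      then have De: "D \<epsilon> (w + of_real \<epsilon> * z) = of_real (\<epsilon>\<^sup>2 * (1 + (cmod z)\<^sup>2))" by (simp only: D_def add_diff_cancel_left')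
      have "\<epsilon>\<^sup>2 * (\<epsilon>\<^sup>2 / (\<epsilon>\<^sup>2 * (1 + (cmod z)\<^sup>2))\<^sup>2) = bump_kernel z"
        using \<epsilon> by (simp add: bump_kernel_def power_mult_distrib power2_eq_square)
      then have "of_real (\<epsilon>\<^sup>2) * (of_real (\<epsilon>\<^sup>2) / (D \<epsilon> (w + of_real \<epsilon> * z))\<^sup>2) = (of_real (bump_kernel z) :: complex)"
        unfolding De by (simp only: of_real_mult[symmetric] of_real_divide[symmetric] of_real_power[symmetric])
      then show "of_real (\<epsilon>\<^sup>2) * (G (w + of_real \<epsilon> * z) * (of_real (\<epsilon>\<^sup>2) / (D \<epsilon> (w + of_real \<epsilon> * z))\<^sup>2)) = G (w + of_real \<epsilon> * z) * of_real (bump_kernel z)"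
        by (metis mult.left_commute)
    qed simp
    finally show ?thesis .
  qed
  define \<epsilon> where "\<epsilon> = (\<lambda>n. 1 / real (Suc n))"
  have \<epsilon>: "\<epsilon> n > 0" for n by (simp add: \<epsilon>_def)
  have \<epsilon>0: "\<epsilon> \<longlonglongrightarrow> 0" unfolding \<epsilon>_def using LIMSEQ_inverse_real_of_nat by (simp add: inverse_eq_divide)
  have "(\<lambda>n. LINT z|lborel. dbar2 G' z * k (\<epsilon> n) z) \<longlonglongrightarrow> (LINT z|lborel. dbar2 G' z / (z - w))"
  proof (rule integral_dominated_convergence[where w = "\<lambda>z. M * (indicat_real (cball 0 R) z *\<^sub>R (1 / cmod (w - z)))"])
    show "integrable lborel (\<lambda>z. M * (indicat_real (cball 0 R) z *\<^sub>R (1 / cmod (w - z))))"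
      using set_integrable_inverse_dist[of "cball 0 R" w] emeasure_bounded_finite[OF bounded_cball[of "0::complex" R]]
      unfolding set_integrable_def by (intro integrable_mult_right) auto
    show "(\<lambda>z. dbar2 G' z * k (\<epsilon> n) z) \<in> borel_measurable lborel" for n
    proof -
      have "continuous_on UNIV (k (\<epsilon> n))"
        unfolding k_def D_def using Dnz[OF \<epsilon>[of n]] unfolding D_def by (intro continuous_intros) auto
      then have [measurable]: "k (\<epsilon> n) \<in> borel_measurable borel" by (rule borel_measurable_continuous_onI)
      show ?thesis by measurable
    qed
    show "AE z in lborel. (\<lambda>n. dbar2 G' z * k (\<epsilon> n) z) \<longlonglongrightarrow> dbar2 G' z / (z - w)"
    proof (rule AE_I2)
      fix z
      show "(\<lambda>n. dbar2 G' z * k (\<epsilon> n) z) \<longlonglongrightarrow> dbar2 G' z / (z - w)"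
      \<comment> \<open>At \<open>z = w\<close> the kernel vanishes, and so does the quotient in the
        limit, by division by zero.\<close>
      proof (cases "z = w")
        case False
        then have "(cmod (z - w))\<^sup>2 + 0\<^sup>2 \<noteq> 0" by simp
        then have "of_real ((cmod (z - w))\<^sup>2 + 0\<^sup>2) \<noteq> (0 :: complex)" by (metis of_real_eq_0_iff)
        then have "(\<lambda>n. dbar2 G' z * k (\<epsilon> n) z) \<longlonglongrightarrow> dbar2 G' z * (cnj (z - w) / of_real ((cmod (z - w))\<^sup>2 + 0\<^sup>2))"
          unfolding k_def D_def by (intro tendsto_intros \<epsilon>0)
        moreover have "cnj (z - w) / of_real ((cmod (z - w))\<^sup>2 + 0\<^sup>2) = 1 / (z - w)"
          using False complex_norm_square[of "z - w"] by (simp del: complex_cnj_diff)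
        ultimately show ?thesis by (simp only: times_divide_eq_right mult_1_right)
      qed (simp add: k_def)
    qed
    show "AE z in lborel. norm (dbar2 G' z * k (\<epsilon> n) z) \<le> M * (indicat_real (cball 0 R) z *\<^sub>R (1 / cmod (w - z)))" for n
    proof (rule AE_I2)
      fix z
      show "norm (dbar2 G' z * k (\<epsilon> n) z) \<le> M * (indicat_real (cball 0 R) z *\<^sub>R (1 / cmod (w - z)))"
      proof (cases "cmod z \<le> R \<and> z \<noteq> w")
        case True
        have p: "cmod (z - w) > 0" using True by simp
        have "norm (k (\<epsilon> n) z) = cmod (z - w) / ((cmod (z - w))\<^sup>2 + (\<epsilon> n)\<^sup>2)"
        proof -
          have "norm (D (\<epsilon> n) z) = (cmod (z - w))\<^sup>2 + (\<epsilon> n)\<^sup>2" unfolding D_def by (simp only: norm_of_real) simp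
          moreover have "norm (cnj (z - w)) = cmod (z - w)" by (rule complex_mod_cnj)
          ultimately show ?thesis unfolding k_def by (simp only: norm_divide)
        qed
        also have "\<dots> \<le> cmod (z - w) / (cmod (z - w))\<^sup>2"
          using p by (intro divide_left_mono) (auto intro!: mult_pos_pos add_pos_nonneg)
        also have "\<dots> = 1 / cmod (w - z)" using p by (simp add: power2_eq_square norm_minus_commute)
        finally have "norm (dbar2 G' z) * norm (k (\<epsilon> n) z) \<le> M * (1 / cmod (w - z))"
          using M True by (intro mult_mono) auto
        then show ?thesis using True by (simp add: norm_mult)
      next
        case False
        then show ?thesis using R(3)[of z] M(1) by (auto simp: k_def)
      qed
    qed
  qed measurable
  moreover have "(\<lambda>n. LINT z|lborel. dbar2 G' z * k (\<epsilon> n) z) \<longlonglongrightarrow> - 2 * (LINT z|lborel. G w * of_real (bump_kernel z))"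
  proof -
    have "(\<lambda>n. LINT z|lborel. G (w + of_real (\<epsilon> n) * z) * of_real (bump_kernel z)) \<longlonglongrightarrow> (LINT z|lborel. G w * of_real (bump_kernel z))"
    proof (rule integral_dominated_convergence[where w = "\<lambda>z. A * bump_kernel z"])
      show "integrable lborel (\<lambda>z. A * bump_kernel z)" by (intro integrable_mult_right integrable_bump_kernel)
      show "AE z in lborel. (\<lambda>n. G (w + of_real (\<epsilon> n) * z) * of_real (bump_kernel z)) \<longlonglongrightarrow> G w * of_real (bump_kernel z)"
      proof (rule AE_I2)
        fix z
        have "(\<lambda>n. w + of_real (\<epsilon> n) * z) \<longlonglongrightarrow> w + of_real 0 * z" by (intro tendsto_intros \<epsilon>0)
        then have "(\<lambda>n. w + of_real (\<epsilon> n) * z) \<longlonglongrightarrow> w" by simp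
        moreover have "isCont G w" using cG by (simp add: continuous_on_eq_continuous_at)
        ultimately have "(\<lambda>n. G (w + of_real (\<epsilon> n) * z)) \<longlonglongrightarrow> G w"
          by (rule isCont_tendsto_compose[rotated])
        then show "(\<lambda>n. G (w + of_real (\<epsilon> n) * z) * of_real (bump_kernel z)) \<longlonglongrightarrow> G w * of_real (bump_kernel z)"
          by (intro tendsto_intros)
      qed
      show "AE z in lborel. norm (G (w + of_real (\<epsilon> n) * z) * of_real (bump_kernel z)) \<le> A * bump_kernel z" for n
        using A bump_kernel_pos by (auto simp: norm_mult abs_of_pos intro!: mult_right_mono less_imp_le)
    qed measurable
    then have "(\<lambda>n. - 2 * (LINT z|lborel. G (w + of_real (\<epsilon> n) * z) * of_real (bump_kernel z))) \<longlonglongrightarrow> - 2 * (LINT z|lborel. G w * of_real (bump_kernel z))"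
      by (intro tendsto_mult tendsto_const)
    then show ?thesis by (simp only: parts[OF \<epsilon>] scaled[OF \<epsilon>])
  qed
  ultimately have "(LINT z|lborel. dbar2 G' z / (z - w)) = - 2 * (LINT z|lborel. G w * of_real (bump_kernel z))"
    by (rule LIMSEQ_unique)
  also have "(LINT z|lborel. G w * of_real (bump_kernel z)) = G w * of_real bump_mass"
    unfolding bump_mass_def by (simp only: integral_mult_right_zero integral_complex_of_real)
  finally have "(LINT z|lborel. dbar2 G' z / (z - w)) = - (of_real (2 * bump_mass) * G w)" by simp
  moreover have "(\<lambda>z. dbar2 G' z / (w - z)) = (\<lambda>z. - (dbar2 G' z / (z - w)))"
    by (rule ext) (metis minus_diff_eq minus_divide_right)
  ultimately show ?thesis by simp
qed

text \<open>Uniform in \<open>z\<close>, so that integrating it along a curve proves absolute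
  convergence of the double integral in \<open>fubini\<close>.\<close>

lemma set_integral_inverse_dist_le:
  fixes z :: complex
  assumes E: "E \<in> sets lborel" "emeasure lborel E < \<infinity>"
  shows "(LINT \<xi>:E|lborel. 1 / cmod (z - \<xi>)) \<le> 4 * pi + measure lborel E"
proof -
  let ?N = "E \<inter> ball z 1" and ?F = "E - ball z 1"
  have En: "?N \<in> sets lborel" "?F \<in> sets lborel" using E(1) by auto
  have f: "emeasure lborel ?F < \<infinity>" "emeasure lborel ?N < \<infinity>"
    using emeasure_mono[of ?F E lborel] emeasure_mono[of ?N E lborel] E by (auto simp: le_less_trans)
  have "(LINT \<xi>:?N \<union> ?F|lborel. 1 / cmod (z - \<xi>)) = (LINT \<xi>:?N|lborel. 1 / cmod (z - \<xi>)) + (LINT \<xi>:?F|lborel. 1 / cmod (z - \<xi>))"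
    by (rule set_integral_Un) (use set_integrable_inverse_dist[OF En(1) f(2)] set_integrable_inverse_dist[OF En(2) f(1)] in auto)
  moreover have "?N \<union> ?F = E" by auto
  moreover have "(LINT \<xi>:?N|lborel. 1 / cmod (z - \<xi>)) \<le> 4 * pi * 1"
    by (rule set_integral_inverse_dist_ball[OF En(1)]) auto
  moreover have le: "norm (LINT \<xi>:?F|lborel. 1 / cmod (z - \<xi>)) \<le> 1 * measure lborel ?F"
  proof (rule norm_set_integral_le_const[OF En(2) f(1) set_integrable_inverse_dist[OF En(2) f(1)]])
    fix \<xi> assume "\<xi> \<in> ?F"
    then have "cmod (z - \<xi>) \<ge> 1" by (auto simp: dist_norm)
    then show "norm (1 / cmod (z - \<xi>)) \<le> 1" by (simp add: divide_le_eq)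
  qed
  moreover have "measure lborel ?F \<le> measure lborel E"
    using E En by (intro measure_mono_fmeasurable) (auto simp: fmeasurable_def)
  moreover have "(LINT \<xi>:?F|lborel. 1 / cmod (z - \<xi>)) \<le> measure lborel ?F"
    using le unfolding real_norm_def by linarith
  ultimately show ?thesis by simp
qed

section \<open>Green's theorem for simple closed curves of class C1\<close>

locale C1_loop =
  fixes \<gamma> \<gamma>' :: "real \<Rightarrow> complex"
  assumes simple: "simple_path \<gamma>" and closed: "pathfinish \<gamma> = pathstart \<gamma>"
    and deriv: "s \<in> {0..1} \<Longrightarrow> (\<gamma> has_vector_derivative \<gamma>' s) (at s within {0..1})"
    and cont_deriv: "continuous_on {0..1} \<gamma>'"
begin

lemma path: "path \<gamma>" using simple by (rule simple_path_imp_path)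

lemma cont: "continuous_on {0..1} \<gamma>" using path by (simp add: path_def)

lemma valid: "valid_path \<gamma>"
  unfolding valid_path_def piecewise_C1_differentiable_on_def
\<comment> \<open>The end points are excepted because the derivative there is one-sided.\<close>
proof (intro conjI exI[of _ "{0,1}"] cont)
  have "(\<gamma> has_vector_derivative \<gamma>' s) (at s)" if "s \<in> {0..1} - {0, 1}" for s
    using deriv[of s] that by (simp add: at_within_Icc_at)
  moreover have "continuous_on ({0..1} - {0, 1}) \<gamma>'" using cont_deriv by (rule continuous_on_subset) auto
  ultimately show "\<gamma> C1_differentiable_on {0..1} - {0, 1}"
    unfolding C1_differentiable_on_def by blast
qed simp

lemma negligible_image: "negligible (path_image \<gamma>)"
  unfolding path_image_def
proof (rule negligible_differentiable_image_lowdim)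
  show "\<gamma> differentiable_on {0..1}"
    using deriv unfolding differentiable_on_def has_vector_derivative_def differentiable_def by blast
qed simp

lemma AE_notin_image: "AE z in lborel. z \<notin> path_image \<gamma>"
proof -
  have "path_image \<gamma> \<in> sets lborel"
    using closed_path_image[OF path] by simp
  then have "path_image \<gamma> \<in> null_sets lborel"
    using negligible_image by (simp add: negligible_iff_null_sets null_sets_def)
  then show ?thesis by (rule AE_not_in)
qed

lemma winding_number_eq:
  assumes "z \<notin> path_image \<gamma>"
  shows "(LINT s:{0..1}|lborel. \<gamma>' s / (\<gamma> s - z)) = 2 * pi * \<i> * winding_number \<gamma> z"
proof -
  have nz: "\<gamma> s - z \<noteq> 0" if "s \<in> {0..1}" for s using assms that by (auto simp: path_image_def)
  have c: "continuous_on {0..1} (\<lambda>s. \<gamma>' s / (\<gamma> s - z))"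
    by (intro continuous_on_divide continuous_on_diff cont cont_deriv continuous_on_const) (use nz in blast)
  then have "set_integrable lborel {0..1} (\<lambda>s. \<gamma>' s / (\<gamma> s - z))"
    by (rule borel_integrable_atLeastAtMost')
  then have e: "(LINT s:{0..1}|lborel. \<gamma>' s / (\<gamma> s - z)) = integral {0..1} (\<lambda>s. \<gamma>' s / (\<gamma> s - z))"
    by (rule set_borel_integral_eq_integral)
  have "((\<lambda>w. 1 / (w - z)) has_contour_integral integral {0..1} (\<lambda>s. \<gamma>' s / (\<gamma> s - z))) \<gamma>"
    unfolding has_contour_integral_def
  proof (rule has_integral_eq)
    show "((\<lambda>s. \<gamma>' s / (\<gamma> s - z)) has_integral integral {0..1} (\<lambda>s. \<gamma>' s / (\<gamma> s - z))) {0..1}"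
      using integrable_continuous_real[OF c] by (rule integrable_integral)
    fix s :: real assume s: "s \<in> {0..1}"
    then have "vector_derivative \<gamma> (at s within {0..1}) = \<gamma>' s"
      using deriv[OF s] vector_derivative_within_cbox[of 0 1 s \<gamma>] by simp
    then show "\<gamma>' s / (\<gamma> s - z) = 1 / (\<gamma> s - z) * vector_derivative \<gamma> (at s within {0..1})" by simp
  qed
  then have "contour_integral \<gamma> (\<lambda>w. 1 / (w - z)) = integral {0..1} (\<lambda>s. \<gamma>' s / (\<gamma> s - z))"
    by (rule contour_integral_unique)
  then show ?thesis unfolding e using winding_number_valid_path[OF valid assms] by simp
qed

text \<open>\<open>c\<close> is 1 or -1 according to the orientation, which is never
  decided.\<close>

lemma winding_number_indicator:
  "\<exists>c::real. c \<noteq> 0 \<and> (\<forall>z. z \<notin> path_image \<gamma> \<longrightarrow>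
     winding_number \<gamma> z = of_real (c * indicator (inside (path_image \<gamma>)) z))"
proof -
  have out: "winding_number \<gamma> z = 0" if "z \<notin> path_image \<gamma>" "z \<notin> inside (path_image \<gamma>)" for z
    using that winding_number_zero_in_outside[OF path closed] inside_Un_outside[of "path_image \<gamma>"] by blast
  show ?thesis
  proof (rule simple_closed_path_winding_number_inside[OF simple])
    assume "\<And>z. z \<in> inside (path_image \<gamma>) \<Longrightarrow> winding_number \<gamma> z = 1"
    with out show ?thesis by (intro exI[of _ 1]) (auto simp: indicator_def)
  next
    assume "\<And>z. z \<in> inside (path_image \<gamma>) \<Longrightarrow> winding_number \<gamma> z = -1"
    with out show ?thesis by (intro exI[of _ "-1"]) (auto simp: indicator_def)
  qed
qed

lemma open_inside: "open (inside (path_image \<gamma>))"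
  using Jordan_inside_outside[OF simple closed] by blast

text \<open>The kernel is unbounded, but for each \<open>s\<close> its modulus integrates over the
  support of \<open>N\<close> to a bound independent of \<open>s\<close>.\<close>

lemma fubini:
  assumes N: "continuous_on UNIV N" "\<And>z. cmod z \<ge> R \<Longrightarrow> N z = 0"
  shows "(LINT z|lborel. N z * (LINT s:{0..1}|lborel. \<gamma>' s / (\<gamma> s - z))) =
         (LINT s:{0..1}|lborel. \<gamma>' s * (LINT z|lborel. N z / (\<gamma> s - z)))"
proof -
  have [measurable]: "N \<in> borel_measurable borel" using N(1) by (rule borel_measurable_continuous_onI)
  obtain M where M: "M > 0" "\<And>z. cmod z \<le> R \<Longrightarrow> norm (N z) \<le> M"
    using continuous_on_norm_bound[OF N(1)] by blast
  \<comment> \<open>Extension by zero makes the curve data Borel on the whole line;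
    \<open>dg = 0\<close> removes the integrand outside the interval.\<close>
  define g where "g = (\<lambda>s. indicator {0..1} s *\<^sub>R \<gamma> s)"
  define dg where "dg = (\<lambda>s. indicator {0..1} s *\<^sub>R \<gamma>' s)"
  have [measurable]: "g \<in> borel_measurable borel" "dg \<in> borel_measurable borel"
    unfolding g_def dg_def using cont cont_deriv by (auto intro!: borel_measurable_continuous_on_indicator)
  have bdg: "bounded (\<gamma>' ` {0..1})" using cont_deriv by (intro compact_imp_bounded compact_continuous_image) auto
  then obtain L where L: "L > 0" "\<And>y. y \<in> \<gamma>' ` {0..1} \<Longrightarrow> norm y \<le> L" unfolding bounded_pos by blast
  have dgL: "norm (dg s) \<le> L * indicator {0..1} s" for s using L by (auto simp: dg_def indicator_def)
  define H where "H = (\<lambda>s z. N z * (dg s / (g s - z)))"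
  let ?B = "cball (0::complex) R"
  have fB: "emeasure lborel ?B < \<infinity>" "?B \<in> sets lborel" by (rule emeasure_bounded_finite, auto)
  have Hb: "norm (H s z) \<le> norm (dg s) * (M * (indicat_real ?B z *\<^sub>R (1 / cmod (g s - z))))" for s z
  proof (cases "cmod z \<le> R")
    case True
    then have "norm (N z) * (norm (dg s) / cmod (g s - z)) \<le> M * (norm (dg s) / cmod (g s - z))"
      using M by (intro mult_right_mono) auto
    then show ?thesis using True by (simp add: H_def norm_mult norm_divide mult_ac)
  next
    case False
    then show ?thesis using N(2)[of z] by (simp add: H_def)
  qed
  have iB: "integrable lborel (\<lambda>z. norm (dg s) * (M * (indicat_real ?B z *\<^sub>R (1 / cmod (g s - z)))))" for s
    using set_integrable_inverse_dist[OF fB(2,1), of "g s"] unfolding set_integrable_def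
    by (intro integrable_mult_right)
  have iH: "integrable lborel (\<lambda>z. H s z)" for s
  proof (rule Bochner_Integration.integrable_bound[OF iB[of s]])
    show "H s \<in> borel_measurable lborel" unfolding H_def by measurable
    show "AE z in lborel. norm (H s z) \<le> norm (norm (dg s) * (M * (indicat_real ?B z *\<^sub>R (1 / cmod (g s - z)))))"
      by (rule AE_I2) (rule order_trans[OF Hb], simp only: real_norm_def abs_ge_self)
  qed
  have Hm: "case_prod H \<in> borel_measurable (lborel \<Otimes>\<^sub>M lborel)"
    unfolding H_def by measurable
  have int: "integrable (lborel \<Otimes>\<^sub>M lborel) (case_prod H)"
  proof (rule lborel_pair.Fubini_integrable[OF Hm])
    show "AE s in lborel. integrable lborel (\<lambda>z. case_prod H (s, z))" using iH by simp
    define C where "C = M * (4 * pi + measure lborel ?B)"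
    have le: "(LINT z|lborel. norm (H s z)) \<le> L * C * indicator {0..1} s" for s
    proof -
      have "(LINT z|lborel. norm (H s z)) \<le> (LINT z|lborel. norm (dg s) * (M * (indicat_real ?B z *\<^sub>R (1 / cmod (g s - z)))))"
        by (rule integral_mono[OF integrable_norm[OF iH] iB]) (rule Hb)
      also have "\<dots> = norm (dg s) * (M * (LINT z:?B|lborel. 1 / cmod (g s - z)))"
        by (simp only: integral_mult_right_zero set_lebesgue_integral_def)
      also have "\<dots> \<le> norm (dg s) * C"
        unfolding C_def using set_integral_inverse_dist_le[OF fB(2,1), of "g s"] M(1) by (intro mult_left_mono) auto
      also have "\<dots> \<le> (L * indicator {0..1} s) * C"
        using dgL[of s] M(1) by (intro mult_right_mono) (auto simp: C_def)
      finally show ?thesis by (simp add: mult_ac)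
    qed
    have "integrable lborel (\<lambda>s. L * C * indicat_real {0..1::real} s)" by simp
    then show "integrable lborel (\<lambda>s. LINT z|lborel. norm (case_prod H (s, z)))"
    proof (rule Bochner_Integration.integrable_bound)
      show "(\<lambda>s. LINT z|lborel. norm (case_prod H (s, z))) \<in> borel_measurable lborel"
        using Hm by measurable
      have "0 \<le> (LINT z|lborel. norm (H s z))" for s by (rule integral_nonneg_AE) simp
      then have "norm (LINT z|lborel. norm (H s z)) \<le> norm (L * C * indicat_real {0..1} s)" for s
        using le[of s] by (metis abs_ge_self abs_of_nonneg order_trans real_norm_def)
      then show "AE s in lborel. norm (LINT z|lborel. norm (case_prod H (s, z))) \<le> norm (L * C * indicat_real {0..1} s)"
        by simp
    qed
  qed
  have s_in: "dg s / (g s - z) = indicator {0..1} s *\<^sub>R (\<gamma>' s / (\<gamma> s - z))" for s z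
    by (auto simp: dg_def g_def indicator_def)
  have "(LINT z|lborel. N z * (LINT s:{0..1}|lborel. \<gamma>' s / (\<gamma> s - z))) = (LINT z|lborel. (LINT s|lborel. H s z))"
    unfolding H_def s_in set_lebesgue_integral_def by (simp only: integral_mult_right_zero)
  also have "\<dots> = (LINT s|lborel. (LINT z|lborel. H s z))"
    by (rule lborel_pair.Fubini_integral[OF int])
  also have "\<dots> = (LINT s:{0..1}|lborel. \<gamma>' s * (LINT z|lborel. N z / (\<gamma> s - z)))"
    unfolding set_lebesgue_integral_def
  proof (rule Bochner_Integration.integral_cong)
    fix s
    have "(LINT z|lborel. H s z) = (LINT z|lborel. (dg s) * (N z / (g s - z)))"
      unfolding H_def by (simp add: mult_ac)
    also have "\<dots> = dg s * (LINT z|lborel. N z / (g s - z))" by (rule integral_mult_right_zero)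
    finally show "(LINT z|lborel. H s z) = indicat_real {0..1} s *\<^sub>R (\<gamma>' s * (LINT z|lborel. N z / (\<gamma> s - z)))"
      by (auto simp: dg_def g_def indicator_def)
  qed simp
  finally show ?thesis .
qed

text \<open>Away from \<open>\<gamma>\<close> the winding number is a multiple of the indicator of the inside, so
  Fubini's theorem reduces the claim to the Cauchy--Pompeiu formula.\<close>

theorem green:
  obtains c :: real where "c \<noteq> 0"
    "\<And>G G'. C1_compact G G' \<Longrightarrow> \<i> * (LINT z:inside (path_image \<gamma>)|lborel. dbar2 G' z)
        = of_real c * (LINT s:{0..1}|lborel. G (\<gamma> s) * \<gamma>' s)"
proof -
  obtain c where c: "c \<noteq> 0"
    "\<And>z. z \<notin> path_image \<gamma> \<Longrightarrow> winding_number \<gamma> z = of_real (c * indicator (inside (path_image \<gamma>)) z)"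
    using winding_number_indicator by blast
  let ?I = "inside (path_image \<gamma>)"
  \<comment> \<open>The area side carries \<open>2 * pi * \<i> * c\<close> from the winding number,
    the curve side \<open>2 * bump_mass\<close> from Cauchy-Pompeiu; the constant is their quotient
    up to \<open>\<i>\<close>.\<close>
  have "\<i> * (LINT z:?I|lborel. dbar2 G' z) = of_real (bump_mass / (pi * c)) * (LINT s:{0..1}|lborel. G (\<gamma> s) * \<gamma>' s)"
    if G: "C1_compact G G'" for G G'
  proof -
    obtain R where R: "R > 0" "\<And>z. cmod z \<ge> R \<Longrightarrow> dbar2 G' z = 0"
      using C1_compactE[OF G] by metis
    have cD: "continuous_on UNIV (dbar2 G')" using C1_compact_continuous[OF G] by auto
    have [measurable]: "dbar2 G' \<in> borel_measurable borel" using cD by (rule borel_measurable_continuous_onI)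
    have [measurable]: "?I \<in> sets borel" using open_inside by simp
    have "(LINT z|lborel. dbar2 G' z * (LINT s:{0..1}|lborel. \<gamma>' s / (\<gamma> s - z)))
      = (LINT z|lborel. (2 * pi * \<i> * c) * (indicat_real ?I z *\<^sub>R dbar2 G' z))"
    proof (rule integral_cong_AE)
      have e: "AE z in lborel. dbar2 G' z * (LINT s:{0..1}|lborel. \<gamma>' s / (\<gamma> s - z)) = (2 * pi * \<i> * c) * (indicat_real ?I z *\<^sub>R dbar2 G' z)"
        using AE_notin_image
      proof eventually_elim
        case (elim z)
        show ?case unfolding winding_number_eq[OF elim] c(2)[OF elim] by (simp add: scaleR_conv_of_real)
      qed
      then show "AE z in lborel. dbar2 G' z * (LINT s:{0..1}|lborel. \<gamma>' s / (\<gamma> s - z)) = (2 * pi * \<i> * c) * (indicat_real ?I z *\<^sub>R dbar2 G' z)" .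
      show "(\<lambda>z. (2 * pi * \<i> * c) * (indicat_real ?I z *\<^sub>R dbar2 G' z)) \<in> borel_measurable lborel" by measurable
      define g where "g = (\<lambda>s. indicator {0..1} s *\<^sub>R \<gamma> s)"
      define dg where "dg = (\<lambda>s. indicator {0..1} s *\<^sub>R \<gamma>' s)"
      have [measurable]: "g \<in> borel_measurable borel" "dg \<in> borel_measurable borel"
        unfolding g_def dg_def using cont cont_deriv by (auto intro!: borel_measurable_continuous_on_indicator)
      have "(LINT s:{0..1}|lborel. \<gamma>' s / (\<gamma> s - z)) = (LINT s|lborel. dg s / (g s - z))" for z
        unfolding set_lebesgue_integral_def by (rule Bochner_Integration.integral_cong) (auto simp: dg_def g_def indicator_def)
      then show "(\<lambda>z. dbar2 G' z * (LINT s:{0..1}|lborel. \<gamma>' s / (\<gamma> s - z))) \<in> borel_measurable lborel"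
        by simp
    qed
    also have "\<dots> = (2 * pi * \<i> * c) * (LINT z:?I|lborel. dbar2 G' z)"
      unfolding set_lebesgue_integral_def by (rule integral_mult_right_zero)
    finally have "(2 * pi * \<i> * c) * (LINT z:?I|lborel. dbar2 G' z)
      = (LINT s:{0..1}|lborel. \<gamma>' s * (LINT z|lborel. dbar2 G' z / (\<gamma> s - z)))"
      using fubini[OF cD R(2)] by simp
    also have "\<dots> = (LINT s:{0..1}|lborel. of_real (2 * bump_mass) * (G (\<gamma> s) * \<gamma>' s))"
      unfolding cauchy_pompeiu[OF G] by (simp only: mult_ac)
    also have "\<dots> = of_real (2 * bump_mass) * (LINT s:{0..1}|lborel. G (\<gamma> s) * \<gamma>' s)"
      by (rule set_integral_mult_right)
    finally show ?thesis using c(1) by (simp add: field_simps)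
  qed
  moreover have "bump_mass / (pi * c) \<noteq> 0" using bump_mass_pos c(1) by simp
  ultimately show ?thesis using that by blast
qed

end

subsection \<open>Boundary conditions of rotating patches\<close>

text \<open>From exponent 2 on the kink at 0 disappears, because the power is then at most
  \<open>h^2\<close> for small \<open>h\<close>.\<close>

lemma DERIV_max_power:
  "((\<lambda>x::real. (max 0 x) ^ Suc (Suc n)) has_real_derivative real (Suc (Suc n)) * (max 0 x) ^ Suc n) (at x)"
proof (cases x "0::real" rule: linorder_cases)
  case less
  have "((\<lambda>x::real. 0) has_real_derivative 0) (at x)" by simp
  then have "((\<lambda>x::real. (max 0 x) ^ Suc (Suc n)) has_real_derivative 0) (at x)"
    by (rule has_field_derivative_transform_within_open[of _ _ _ "{..<0}"]) (use less in auto)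
  then show ?thesis using less by simp
next
  case greater
  have "((\<lambda>x::real. x ^ Suc (Suc n)) has_real_derivative real (Suc (Suc n)) * x ^ Suc n) (at x)"
    using DERIV_pow[of "Suc (Suc n)" x] by simp
  then have "((\<lambda>x::real. (max 0 x) ^ Suc (Suc n)) has_real_derivative real (Suc (Suc n)) * x ^ Suc n) (at x)"
    by (rule has_field_derivative_transform_within_open[of _ _ _ "{0<..}"]) (use greater in auto)
  then show ?thesis using greater by simp
next
  case equal
  have "((\<lambda>x::real. (max 0 x) ^ Suc (Suc n)) has_derivative (\<lambda>h. 0)) (at 0)"
  proof (rule has_derivative_quadratic[where d = 1 and K = 1])
    fix h :: real assume h: "norm h < 1"
    have "(max 0 h) ^ Suc (Suc n) \<le> (max 0 h)\<^sup>2"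
      using h power_decreasing[of 2 "Suc (Suc n)" "max 0 h"] by simp
    also have "\<dots> \<le> h\<^sup>2" by (simp add: max_def)
    finally show "norm ((max 0 (0 + h)) ^ Suc (Suc n) - (max 0 0) ^ Suc (Suc n) - 0) \<le> 1 * (norm h)\<^sup>2"
      by (simp add: abs_mult)
  qed auto
  then show ?thesis using equal by (simp add: has_field_derivative_def lambda_zero)
qed

section \<open>Radial bumps and the localised boundary condition\<close>

definition cap :: "complex \<Rightarrow> real \<Rightarrow> complex \<Rightarrow> real" where
  "cap p \<eta> z = max 0 (\<eta>\<^sup>2 - (z - p) \<bullet> (z - p))"

text \<open>The third power leaves \<open>bump_grad\<close> itself continuously differentiable, so
  that Green's theorem applies to a field containing it.\<close>

definition bump :: "complex \<Rightarrow> real \<Rightarrow> complex \<Rightarrow> real" where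
  "bump p \<eta> z = cap p \<eta> z ^ 3"

definition bump_grad :: "complex \<Rightarrow> real \<Rightarrow> complex \<Rightarrow> complex" where
  "bump_grad p \<eta> z = of_real (- 6 * cap p \<eta> z ^ 2) * (z - p)"

lemma cap_continuous: "continuous_on A (cap p \<eta>)"
  unfolding cap_def by (intro continuous_intros)

lemma cap_eq_0: "\<eta> > 0 \<Longrightarrow> z \<notin> ball p \<eta> \<Longrightarrow> cap p \<eta> z = 0"
proof -
  assume a: "\<eta> > 0" "z \<notin> ball p \<eta>"
  then have "\<eta> \<le> cmod (z - p)" by (simp add: dist_norm norm_minus_commute)
  then have "\<eta>\<^sup>2 \<le> (cmod (z - p))\<^sup>2" using a by (intro power_mono) auto
  then show ?thesis by (simp add: cap_def power2_norm_eq_inner)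
qed

lemma cap_nonneg: "cap p \<eta> z \<ge> 0"
  by (simp add: cap_def)

lemma cap_power_has_derivative:
  "((\<lambda>z. cap p \<eta> z ^ Suc (Suc n)) has_derivative
     (\<lambda>h. real (Suc (Suc n)) * cap p \<eta> z ^ Suc n * (- 2 * ((z - p) \<bullet> h)))) (at z)"
proof -
  have "((\<lambda>z. \<eta>\<^sup>2 - (z - p) \<bullet> (z - p)) has_derivative (\<lambda>h. - 2 * ((z - p) \<bullet> h))) (at z)"
    by (auto intro!: derivative_eq_intros simp: inner_commute)
  moreover have "((\<lambda>x::real. (max 0 x) ^ Suc (Suc n)) has_derivative
     (\<lambda>h. real (Suc (Suc n)) * (max 0 (\<eta>\<^sup>2 - (z - p) \<bullet> (z - p))) ^ Suc n * h)) (at (\<eta>\<^sup>2 - (z - p) \<bullet> (z - p)))"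
    using DERIV_max_power[of n] unfolding has_field_derivative_def .
  ultimately show ?thesis
    unfolding cap_def by (rule has_derivative_compose)
qed

lemma bump_has_derivative: "(bump p \<eta> has_derivative (\<lambda>h. h \<bullet> bump_grad p \<eta> z)) (at z)"
proof -
  have "(bump p \<eta> has_derivative (\<lambda>h. real (Suc (Suc 1)) * cap p \<eta> z ^ Suc 1 * (- 2 * ((z - p) \<bullet> h)))) (at z)"
    using cap_power_has_derivative[of p \<eta> 1 z] unfolding bump_def by (simp add: numeral_3_eq_3)
  moreover have "real (Suc (Suc 1)) * cap p \<eta> z ^ Suc 1 * (- 2 * ((z - p) \<bullet> h)) = h \<bullet> bump_grad p \<eta> z" for h
    by (simp add: bump_grad_def inner_complex_def power2_eq_square algebra_simps)
  ultimately show ?thesis by (simp only:)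
qed

lemma bump_grad_continuous: "continuous_on A (bump_grad p \<eta>)"
  unfolding bump_grad_def by (intro continuous_intros cap_continuous)

lemma bump_continuous: "continuous_on A (bump p \<eta>)"
  unfolding bump_def by (intro continuous_intros cap_continuous)

lemma bump_grad_eq_0: "\<eta> > 0 \<Longrightarrow> z \<notin> ball p \<eta> \<Longrightarrow> bump_grad p \<eta> z = 0"
  by (simp add: bump_grad_def cap_eq_0)

lemma bump_eq_0: "\<eta> > 0 \<Longrightarrow> z \<notin> ball p \<eta> \<Longrightarrow> bump p \<eta> z = 0"
  by (simp add: bump_def cap_eq_0)

text \<open>For \<open>df(h) = Re (q h)\<close> the field \<open>f cnj (\<nabla>\<phi>)\<close> has \<open>Re (\<i> 2 \<partial>/\<partial>z\<^bold>*) = Im (q \<nabla>\<phi>)\<close>, because the contribution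
  of the second derivatives of \<open>\<phi>\<close> is a real multiple of \<open>f \<Delta>\<phi>\<close>.\<close>

lemma C1_compact_bump_field:
  assumes f: "\<And>z. (f has_derivative (\<lambda>h. Re (q z * h))) (at z)" and q: "continuous_on UNIV q" and \<eta>: "\<eta> > 0"
  obtains G' where "C1_compact (\<lambda>z. of_real (f z) * cnj (bump_grad p \<eta> z)) G'"
    "\<And>z. Re (\<i> * dbar2 G' z) = Im (q z * bump_grad p \<eta> z)"
proof -
  define k' where "k' = (\<lambda>z h. of_real (- 6 * (2 * cap p \<eta> z * (- 2 * ((z - p) \<bullet> h)))) * cnj (z - p)
      + of_real (- 6 * cap p \<eta> z ^ 2) * cnj h)"
  have kd: "((\<lambda>z. cnj (bump_grad p \<eta> z)) has_derivative k' z) (at z)" for z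
  proof -
    have c: "((\<lambda>z. - 6 * cap p \<eta> z ^ 2) has_derivative (\<lambda>h. - 6 * (2 * cap p \<eta> z * (- 2 * ((z - p) \<bullet> h))))) (at z)"
      using has_derivative_mult_right[OF cap_power_has_derivative[of p \<eta> 0 z], of "- 6"] by (simp add: numeral_2_eq_2)
    have "((\<lambda>z. of_real (- 6 * cap p \<eta> z ^ 2) * cnj (z - p)) has_derivative
       (\<lambda>h. of_real (- 6 * cap p \<eta> z ^ 2) * cnj h + of_real (- 6 * (2 * cap p \<eta> z * (- 2 * ((z - p) \<bullet> h)))) * cnj (z - p))) (at z)"
      by (intro has_derivative_mult has_derivative_of_real c) (auto intro!: derivative_eq_intros)
    then show ?thesis unfolding bump_grad_def k'_def by (simp add: add.commute)
  qed
  define G' where "G' = (\<lambda>z h. of_real (f z) * k' z h + of_real (Re (q z * h)) * cnj (bump_grad p \<eta> z))"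
  have cf: "continuous_on UNIV f"
    by (intro continuous_at_imp_continuous_on ballI has_derivative_continuous[OF f])
  have ck: "continuous_on UNIV (\<lambda>z. k' z h)" for h
    unfolding k'_def by (intro continuous_intros cap_continuous)
  have "C1_compact (\<lambda>z. of_real (f z) * cnj (bump_grad p \<eta> z)) G'"
    unfolding C1_compact_def
  proof (intro conjI allI)
    show "((\<lambda>z. of_real (f z) * cnj (bump_grad p \<eta> z)) has_derivative G' z) (at z)" for z
      unfolding G'_def by (intro has_derivative_mult has_derivative_of_real f kd)
    show "continuous_on UNIV (\<lambda>z. G' z 1)" "continuous_on UNIV (\<lambda>z. G' z \<i>)"
      unfolding G'_def by (intro continuous_intros cf ck q bump_grad_continuous)+
    have "{z. of_real (f z) * cnj (bump_grad p \<eta> z) \<noteq> 0} \<subseteq> ball p \<eta>"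
      using bump_grad_eq_0[OF \<eta>] by (auto simp del: mem_ball)
    then show "bounded {z. of_real (f z) * cnj (bump_grad p \<eta> z) \<noteq> 0}"
      by (rule bounded_subset[OF bounded_ball])
  qed
  moreover have "Re (\<i> * dbar2 G' z) = Im (q z * bump_grad p \<eta> z)" for z
  proof -
    \<comment> \<open>The right side is the Laplacian of the bump; being real, it drops out
      below.\<close>
    have "dbar2 k' z = of_real (24 * cap p \<eta> z * ((z - p) \<bullet> (z - p)) - 12 * cap p \<eta> z ^ 2)"
      by (simp add: complex_eq_iff dbar2_def k'_def inner_complex_def cmod_power2 power2_eq_square algebra_simps)
    then have "Im (dbar2 k' z) = 0" by simp
    moreover have "dbar2 G' z = of_real (f z) * dbar2 k' z + cnj (q z) * cnj (bump_grad p \<eta> z)"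
      by (simp add: complex_eq_iff dbar2_def G'_def algebra_simps)
    ultimately show ?thesis by (simp add: algebra_simps)
  qed
  ultimately show ?thesis using that by blast
qed

text \<open>Green's theorem turns the vanishing area integrals into a vanishing integral of
  \<open>f d(bump)\<close> along the loop, and integration by parts moves the derivative to
  \<open>f\<close>. If its tangential derivative \<open>F\<close> were nonzero at \<open>s0\<close>,
  the nonnegative weight \<open>bump\<close>, concentrated near \<open>\<gamma> s0\<close>, would
  make the integral nonzero.\<close>

lemma (in C1_loop) tangential_derivative_zero:
  assumes per: "\<gamma>' 0 = \<gamma>' 1"
    and f: "\<And>z. (f has_derivative (\<lambda>h. Re (q z * h))) (at z)" and q: "continuous_on UNIV q"
    and z: "\<And>p. p \<in> path_image \<gamma> \<Longrightarrow> \<exists>\<eta>1>0. \<forall>\<eta>. 0 < \<eta> \<and> \<eta> < \<eta>1 \<longrightarrow>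
        (LINT z:inside (path_image \<gamma>)|lborel. Im (q z * bump_grad p \<eta> z)) = 0"
    and s0: "s0 \<in> {0..1}"
  shows "Re (q (\<gamma> s0) * \<gamma>' s0) = 0"
proof (rule ccontr)
  define F where "F = (\<lambda>s. Re (q (\<gamma> s) * \<gamma>' s))"
  assume "Re (q (\<gamma> s0) * \<gamma>' s0) \<noteq> 0"
  then have F0: "F s0 \<noteq> 0" by (simp add: F_def)
  have cq: "continuous_on {0..1} (\<lambda>s. q (\<gamma> s))"
    by (rule continuous_on_compose2[OF q cont]) auto
  have cF: "continuous_on {0..1} F" unfolding F_def by (intro continuous_intros cq cont_deriv)
  \<comment> \<open>Parameters at which \<open>F\<close> lacks the sign of \<open>F s0\<close>. The
    bump localises in the plane, not in the parameter, so the image of \<open>A\<close> must avoid a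
    neighbourhood of \<open>\<gamma> s0\<close>. This follows from simplicity of the loop and, at
    its base point, from \<open>\<gamma>' 0 = \<gamma>' 1\<close>.\<close>
  define A where "A = {s \<in> {0..1}. F s * F s0 \<le> 0}"
  have "closed A" unfolding A_def
    by (intro continuous_closed_preimage_constant continuous_on_closed_Collect_le continuous_intros cF)
  then have "compact A" unfolding compact_eq_bounded_closed
    by (auto intro: bounded_subset[of "{0..1}"] simp: A_def)
  then have cA: "compact (\<gamma> ` A)"
    by (intro compact_continuous_image continuous_on_subset[OF cont]) (auto simp: A_def)
  let ?p = "\<gamma> s0"
  have "?p \<notin> \<gamma> ` A"
  proof
    assume "?p \<in> \<gamma> ` A"
    then obtain s where s: "s \<in> A" "\<gamma> s = ?p" by auto
    then have "s = s0 \<or> s = 0 \<and> s0 = 1 \<or> s = 1 \<and> s0 = 0"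
      using simple s0 by (auto simp: simple_path_def loop_free_def A_def)
    then have "F s = F s0" using per s(2) by (auto simp: F_def)
    then show False using s(1) F0 by (auto simp: A_def mult_le_0_iff)
  qed
  then obtain e where e: "e > 0" "ball ?p e \<inter> \<gamma> ` A = {}"
    using compact_imp_closed[OF cA] openE[of "- \<gamma> ` A" ?p] by (metis ComplI disjoint_eq_subset_Compl open_Compl)
  obtain \<eta>1 where \<eta>1: "\<eta>1 > 0" "\<And>\<eta>. 0 < \<eta> \<Longrightarrow> \<eta> < \<eta>1 \<Longrightarrow> (LINT z:inside (path_image \<gamma>)|lborel. Im (q z * bump_grad ?p \<eta> z)) = 0"
    using z[of ?p] s0 by (auto simp: path_image_def)
  define \<eta> where "\<eta> = min e \<eta>1 / 2"
  have \<eta>: "\<eta> > 0" "\<eta> < e" "\<eta> < \<eta>1" using e \<eta>1 by (auto simp: \<eta>_def)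
  obtain G' where G': "C1_compact (\<lambda>z. of_real (f z) * cnj (bump_grad ?p \<eta> z)) G'"
    "\<And>z. Re (\<i> * dbar2 G' z) = Im (q z * bump_grad ?p \<eta> z)"
    using C1_compact_bump_field[OF f q \<eta>(1)] by metis
  obtain c :: real where c: "c \<noteq> 0"
    "\<And>G G'. C1_compact G G' \<Longrightarrow> \<i> * (LINT z:inside (path_image \<gamma>)|lborel. dbar2 G' z)
        = of_real c * (LINT s:{0..1}|lborel. G (\<gamma> s) * \<gamma>' s)"
    using green by metis
  have cf: "continuous_on UNIV f"
    by (intro continuous_at_imp_continuous_on ballI has_derivative_continuous[OF f])
  have cf\<gamma>: "continuous_on {0..1} (\<lambda>s. f (\<gamma> s))" by (rule continuous_on_compose2[OF cf cont]) auto
  have cg\<gamma>: "continuous_on {0..1} (\<lambda>s. bump_grad ?p \<eta> (\<gamma> s))"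
    by (rule continuous_on_compose2[OF bump_grad_continuous cont]) auto
  have cb\<gamma>: "continuous_on {0..1} (\<lambda>s. bump ?p \<eta> (\<gamma> s))"
    by (rule continuous_on_compose2[OF bump_continuous cont]) auto
  define h1 where "h1 = (\<lambda>s. f (\<gamma> s) * Re (cnj (bump_grad ?p \<eta> (\<gamma> s)) * \<gamma>' s))"
  define h2 where "h2 = (\<lambda>s. bump ?p \<eta> (\<gamma> s) * F s)"
  have ch1: "continuous_on {0..1} h1" unfolding h1_def by (intro continuous_intros cf\<gamma> cg\<gamma> cont_deriv)
  have ch2: "continuous_on {0..1} h2" unfolding h2_def by (intro continuous_intros cb\<gamma> cF)
  have "integral {0..1} h1 = 0"
  proof -
    have iD: "set_integrable lborel (inside (path_image \<gamma>)) (\<lambda>z. \<i> * dbar2 G' z)"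
    proof -
      obtain R where R: "R > 0" "\<And>z. cmod z \<ge> R \<Longrightarrow> dbar2 G' z = 0" using C1_compactE[OF G'(1)] by metis
      have "integrable lborel (\<lambda>z. \<i> * dbar2 G' z)"
        using C1_compact_continuous(2)[OF G'(1)] R
        by (intro integrable_continuous_bounded_support[of _ R] continuous_intros) auto
      then show ?thesis unfolding set_integrable_def
        using open_inside by (intro integrable_mult_indicator) auto
    qed
    have "Re (\<i> * (LINT z:inside (path_image \<gamma>)|lborel. dbar2 G' z)) = Re (LINT z:inside (path_image \<gamma>)|lborel. \<i> * dbar2 G' z)"
      by (simp only: set_integral_mult_right)
    also have "\<dots> = (LINT z:inside (path_image \<gamma>)|lborel. Im (q z * bump_grad ?p \<eta> z))"
      by (subst set_integral_Re[OF iD, symmetric]) (simp only: G'(2))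
    also have "\<dots> = 0" by (rule \<eta>1(2)) (use \<eta> in auto)
    finally have "Re (of_real c * (LINT s:{0..1}|lborel. of_real (f (\<gamma> s)) * cnj (bump_grad ?p \<eta> (\<gamma> s)) * \<gamma>' s)) = 0"
      using c(2)[OF G'(1)] by (simp only:)
    then have "Re (LINT s:{0..1}|lborel. of_real (f (\<gamma> s)) * cnj (bump_grad ?p \<eta> (\<gamma> s)) * \<gamma>' s) = 0"
      using c(1) by simp
    moreover have i2: "set_integrable lborel {0..1} (\<lambda>s. of_real (f (\<gamma> s)) * cnj (bump_grad ?p \<eta> (\<gamma> s)) * \<gamma>' s)"
      by (intro borel_integrable_atLeastAtMost' continuous_intros cf\<gamma> cg\<gamma> cont_deriv)
    ultimately have "(LINT s:{0..1}|lborel. Re (of_real (f (\<gamma> s)) * cnj (bump_grad ?p \<eta> (\<gamma> s)) * \<gamma>' s)) = 0"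
      using set_integral_Re[OF i2] by simp
    moreover have "(\<lambda>s. Re (of_real (f (\<gamma> s)) * cnj (bump_grad ?p \<eta> (\<gamma> s)) * \<gamma>' s)) = h1"
      by (simp add: h1_def fun_eq_iff mult.assoc Re_complex_of_real algebra_simps)
    ultimately show ?thesis
      using set_borel_integral_eq_integral(2)[OF borel_integrable_atLeastAtMost'[OF ch1]] by simp
  qed
  \<comment> \<open>Derivative of \<open>f * bump\<close> along the loop. The loop closes, so the
    end point terms cancel and the integrals of \<open>h1\<close> and \<open>h2\<close> are
    opposite.\<close>
  moreover have "((\<lambda>s. h1 s + h2 s) has_integral (f (\<gamma> 1) * bump ?p \<eta> (\<gamma> 1) - f (\<gamma> 0) * bump ?p \<eta> (\<gamma> 0))) {0..1}"
  proof (rule fundamental_theorem_of_calculus)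
    fix s :: real assume s: "s \<in> {0..1}"
    have "((f \<circ> \<gamma>) has_vector_derivative Re (q (\<gamma> s) * \<gamma>' s)) (at s within {0..1})"
      by (rule vector_derivative_diff_chain_within[OF deriv[OF s] has_derivative_at_withinI[OF f]])
    moreover have "((bump ?p \<eta> \<circ> \<gamma>) has_vector_derivative \<gamma>' s \<bullet> bump_grad ?p \<eta> (\<gamma> s)) (at s within {0..1})"
      by (rule vector_derivative_diff_chain_within[OF deriv[OF s] has_derivative_at_withinI[OF bump_has_derivative]])
    ultimately have "((\<lambda>s. (f \<circ> \<gamma>) s * (bump ?p \<eta> \<circ> \<gamma>) s) has_vector_derivative
        (f \<circ> \<gamma>) s * (\<gamma>' s \<bullet> bump_grad ?p \<eta> (\<gamma> s)) + Re (q (\<gamma> s) * \<gamma>' s) * (bump ?p \<eta> \<circ> \<gamma>) s) (at s within {0..1})"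
      by (rule has_vector_derivative_mult)
    moreover have "(f \<circ> \<gamma>) s * (\<gamma>' s \<bullet> bump_grad ?p \<eta> (\<gamma> s)) + Re (q (\<gamma> s) * \<gamma>' s) * (bump ?p \<eta> \<circ> \<gamma>) s = h1 s + h2 s"
      by (simp add: h1_def h2_def F_def inner_complex_def algebra_simps)
    ultimately show "((\<lambda>s. f (\<gamma> s) * bump ?p \<eta> (\<gamma> s)) has_vector_derivative h1 s + h2 s) (at s within {0..1})"
      by (simp only: o_def)
  qed simp
  then have "integral {0..1} (\<lambda>s. h1 s + h2 s) = 0"
    using closed by (auto simp: integral_unique pathfinish_def pathstart_def)
  then have "integral {0..1} h1 + integral {0..1} h2 = 0"
    using integrable_continuous_real[OF ch1] integrable_continuous_real[OF ch2] by (simp add: Henstock_Kurzweil_Integration.integral_add)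
  ultimately have "integral {0..1} h2 = 0" by simp
  then have i0: "integral {0..1} (\<lambda>s. h2 s * F s0) = 0" by simp
  have nn: "h2 s * F s0 \<ge> 0" if "s \<in> {0..1}" for s
  proof (cases "\<gamma> s \<in> ball ?p \<eta>")
    case True
    then have "\<gamma> s \<in> ball ?p e" using \<eta> by auto
    then have "s \<notin> A" using e by auto
    then have "F s * F s0 > 0" using that by (auto simp: A_def)
    moreover have "bump ?p \<eta> (\<gamma> s) \<ge> 0" by (simp add: bump_def cap_nonneg)
    ultimately show ?thesis unfolding h2_def by (metis less_imp_le mult.assoc mult_nonneg_nonneg)
  next
    case False
    then show ?thesis using bump_eq_0[OF \<eta>(1)] by (simp add: h2_def)
  qed
  have "continuous_on (cbox 0 1) (\<lambda>s. h2 s * F s0)" using ch2 by (auto intro: continuous_intros)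
  then have "\<forall>s\<in>cbox 0 1. h2 s * F s0 = 0"
    using integral_cbox_eq_0_iff[of 0 1 "\<lambda>s. h2 s * F s0"] i0 nn by auto
  then have "h2 s0 * F s0 = 0" using s0 by auto
  moreover have "bump ?p \<eta> ?p > 0" using \<eta> by (simp add: bump_def cap_def)
  ultimately show False using F0 by (simp add: h2_def)
qed

section \<open>The weak formulation in a rotating frame\<close>

lemma AE_lebesgue_translation:
  fixes c :: complex
  assumes "AE z in lebesgue. P (c + z)"
  shows "AE z in lebesgue. P z"
proof -
  obtain N where N: "negligible N" "{z. \<not> P (c + z)} \<subseteq> N"
    using assms unfolding eventually_ae_filter_negligible by blast
  have "{z. \<not> P z} \<subseteq> (+) c ` N"
  proof
    fix z assume "z \<in> {z. \<not> P z}"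
    then have "z - c \<in> N" using N(2) by auto
    then show "z \<in> (+) c ` N" by (rule rev_image_eqI) simp
  qed
  then show ?thesis
    unfolding eventually_ae_filter_negligible using negligible_translation[OF N(1)] by blast
qed

text \<open>The vorticity at time \<open>t\<close> is only Lebesgue measurable and known almost
  everywhere, while the rigid motion acts on Borel functions; hence the passage from the completed
  measure to \<open>lborel\<close>.\<close>

lemma integral_rotated:
  fixes u c :: complex and K :: "complex \<Rightarrow> real"
  assumes u: "cmod u = 1" and m: "w \<in> borel_measurable lebesgue" "w0 \<in> borel_measurable borel" "K \<in> borel_measurable borel"
    and ae: "AE z in lebesgue. w z = w0 (c + u * (z - c))"
  shows "(LINT z|lebesgue. w z * K (c + u * (z - c))) = (LINT z|lborel. w0 z * K z)"
proof -
  note [measurable] = m(2,3)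
  have meq: "c + u * (z - c) = (c - u * c) + u * z" for z by (simp add: algebra_simps)
  have Bm: "(\<lambda>z. w0 ((c - u * c) + u * z) * K ((c - u * c) + u * z)) \<in> borel_measurable lborel" by measurable
  have KB: "(\<lambda>z. K (c + u * (z - c))) \<in> borel_measurable lborel" by measurable
  have "(LINT z|lebesgue. w z * K (c + u * (z - c))) = (LINT z|lebesgue. w0 ((c - u * c) + u * z) * K ((c - u * c) + u * z))"
  proof (rule integral_cong_AE)
    show "(\<lambda>z. w z * K (c + u * (z - c))) \<in> borel_measurable lebesgue"
      using m(1) measurable_completion[OF KB] by (rule borel_measurable_times)
    show "(\<lambda>z. w0 ((c - u * c) + u * z) * K ((c - u * c) + u * z)) \<in> borel_measurable lebesgue"
      by (rule measurable_completion[OF Bm])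
    show "AE z in lebesgue. w z * K (c + u * (z - c)) = w0 ((c - u * c) + u * z) * K ((c - u * c) + u * z)"
      using ae by eventually_elim (simp add: meq)
  qed
  also have "\<dots> = (LINT z|lborel. w0 ((c - u * c) + u * z) * K ((c - u * c) + u * z))"
    by (rule integral_completion[OF Bm])
  also have "\<dots> = (LINT z|lborel. w0 z * K z)"
    by (rule integral_motion[OF u, of "\<lambda>z. w0 z * K z"]) measurable
  finally show ?thesis .
qed

text \<open>The support turns about \<open>c\<close> and stays in one disc about \<open>c\<close>,
  which gives the common compact set. The factor \<open>exp (\<i> * of_real (t * \<Omega>))\<close>
  in the gradient is the adjoint of the rotation.\<close>

lemma rotated_bump_test_function:
  fixes p c :: complex and \<eta> \<Omega> :: real
  assumes \<eta>: "\<eta> > 0"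
  defines "r \<equiv> \<lambda>(t::real) z. c + exp (- \<i> * of_real (t * \<Omega>)) * (z - c)"
  shows "test_function (\<lambda>t z. bump p \<eta> (r t z))
     (\<lambda>t z. (- \<i> * of_real \<Omega> * (r t z - c)) \<bullet> bump_grad p \<eta> (r t z))
     (\<lambda>t z. exp (\<i> * of_real (t * \<Omega>)) * bump_grad p \<eta> (r t z))"
  unfolding test_function_def
proof (intro conjI allI)
  fix t z
  have rd: "((\<lambda>x. r (fst x) (snd x)) has_derivative
      (\<lambda>h. exp (- \<i> * of_real (t * \<Omega>)) * snd h + of_real (fst h) * (- \<i> * of_real \<Omega> * (r t z - c)))) (at (t, z))"
  proof -
    have e: "((\<lambda>s. exp (- \<i> * of_real (s * \<Omega>))) has_derivative (\<lambda>h. of_real h * (- \<i> * of_real \<Omega> * exp (- \<i> * of_real (t * \<Omega>))))) (at t)"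
    proof -
      have "((\<lambda>w. exp (- \<i> * of_real \<Omega> * w)) has_field_derivative (- \<i> * of_real \<Omega> * exp (- \<i> * of_real \<Omega> * of_real t))) (at (of_real t))"
        by (auto intro!: derivative_eq_intros)
      from has_vector_derivative_real_field[OF this]
      show ?thesis by (simp add: has_vector_derivative_def scaleR_conv_of_real mult_ac)
    qed
    have e2: "((\<lambda>x. exp (- \<i> * of_real (fst x * \<Omega>))) has_derivative (\<lambda>h. of_real (fst h) * (- \<i> * of_real \<Omega> * exp (- \<i> * of_real (t * \<Omega>))))) (at (t, z :: complex))"
    proof -
      have f: "(fst has_derivative fst) (at (t, z :: complex))"
        by (rule bounded_linear_imp_has_derivative[OF bounded_linear_fst])
      have "((\<lambda>s. exp (- \<i> * of_real (s * \<Omega>))) has_derivative (\<lambda>h. of_real h * (- \<i> * of_real \<Omega> * exp (- \<i> * of_real (t * \<Omega>)))))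
          (at (fst (t, z :: complex)))"
        using e by simp
      from has_derivative_compose[OF f this] show ?thesis .
    qed
    show ?thesis
      unfolding r_def
      by (rule derivative_eq_intros e2 refl | simp add: algebra_simps)+
  qed
  have "((\<lambda>x. bump p \<eta> (r (fst x) (snd x))) has_derivative
      (\<lambda>h. (exp (- \<i> * of_real (t * \<Omega>)) * snd h + of_real (fst h) * (- \<i> * of_real \<Omega> * (r t z - c))) \<bullet> bump_grad p \<eta> (r t z))) (at (t, z))"
    by (rule has_derivative_compose[OF rd, of "bump p \<eta>"]) (use bump_has_derivative in auto)
  moreover have "(exp (- \<i> * of_real (t * \<Omega>)) * w + of_real s * (- \<i> * of_real \<Omega> * (r t z - c))) \<bullet> bump_grad p \<eta> (r t z)
     = s * ((- \<i> * of_real \<Omega> * (r t z - c)) \<bullet> bump_grad p \<eta> (r t z)) + w \<bullet> (exp (\<i> * of_real (t * \<Omega>)) * bump_grad p \<eta> (r t z))" for s w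
  proof -
    have "(exp (- \<i> * of_real (t * \<Omega>)) * w) \<bullet> g = w \<bullet> (exp (\<i> * of_real (t * \<Omega>)) * g)" for g
      by (simp add: inner_complex_def exp_eq_polar cis.ctr algebra_simps)
    moreover have "(of_real s * a) \<bullet> g = s * (a \<bullet> g)" for a g :: complex by (simp add: inner_complex_def algebra_simps)
    ultimately show ?thesis by (simp only: inner_add_left)
  qed
  ultimately show "((\<lambda>(t, z). bump p \<eta> (r t z)) has_derivative
       (\<lambda>(s, w). s * ((- \<i> * of_real \<Omega> * (r t z - c)) \<bullet> bump_grad p \<eta> (r t z)) + w \<bullet> (exp (\<i> * of_real (t * \<Omega>)) * bump_grad p \<eta> (r t z)))) (at (t, z))"
    by (simp only: case_prod_unfold)
next
  have cr: "continuous_on UNIV (\<lambda>x. r (fst x) (snd x))" unfolding r_def by (intro continuous_intros)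
  have cg: "continuous_on UNIV (\<lambda>x. bump_grad p \<eta> (r (fst x) (snd x)))"
    by (rule continuous_on_compose2[OF bump_grad_continuous[of UNIV] cr]) auto
  show "continuous_on UNIV (\<lambda>(t, z). (- \<i> * of_real \<Omega> * (r t z - c)) \<bullet> bump_grad p \<eta> (r t z))"
    unfolding case_prod_unfold by (intro continuous_intros cr cg)
  show "continuous_on UNIV (\<lambda>(t, z). exp (\<i> * of_real (t * \<Omega>)) * bump_grad p \<eta> (r t z))"
    unfolding case_prod_unfold by (intro continuous_intros cr cg)
  have "bump p \<eta> (r t z) = 0" if "z \<notin> cball c (cmod (p - c) + \<eta>)" for t z
  proof (rule bump_eq_0[OF \<eta>])
    have "cmod (exp (- \<i> * of_real (t * \<Omega>))) = 1" by simp
    then have "cmod (r t z - c) = cmod (z - c)" by (simp add: r_def norm_mult)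
    then have "cmod (r t z - c) > cmod (p - c) + \<eta>" using that by (simp add: dist_norm norm_minus_commute)
    then show "r t z \<notin> ball p \<eta>"
      using norm_triangle_ineq[of "r t z - p" "p - c"] by (simp add: dist_norm norm_minus_commute)
  qed
  then show "\<exists>K. compact K \<and> (\<forall>t z. z \<notin> K \<longrightarrow> bump p \<eta> (r t z) = 0)"
    by (intro exI[of _ "cball c (cmod (p - c) + \<eta>)"]) auto
qed

locale two_patches =
  fixes D1 D2 :: "complex set" and \<alpha> :: real
  assumes open1: "open D1" and bounded1: "bounded D1" and open2: "open D2" and bounded2: "bounded D2"
begin

definition vort :: "complex \<Rightarrow> real" where
  "vort = (\<lambda>z. indicator D1 z + (\<alpha> - 1) * indicator D2 z)"

definition total_transform :: "complex \<Rightarrow> complex" where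
  "total_transform z = cauchy_transform D1 z + of_real (\<alpha> - 1) * cauchy_transform D2 z"

lemma sets12 [measurable]: "D1 \<in> sets borel" "D2 \<in> sets borel"
  using open1 open2 by auto

lemma finite12: "emeasure lborel D1 < \<infinity>" "emeasure lborel D2 < \<infinity>"
  using bounded1 bounded2 by (auto intro: emeasure_bounded_finite simp del: infinity_ennreal_def)

lemma vort_measurable [measurable]: "vort \<in> borel_measurable borel"
  unfolding vort_def by measurable

lemma total_transform_continuous: "continuous_on UNIV total_transform"
  unfolding total_transform_def using finite12 sets12 by (intro continuous_intros cauchy_transform_continuous) auto

lemma stream_function_vort: "stream_function vort z = 1 / (2 * pi) * (log_potential D1 z + (\<alpha> - 1) * log_potential D2 z)"
proof -
  have "(LINT \<xi>|lebesgue. vort \<xi> * ln (cmod (z - \<xi>))) = (LINT \<xi>|lborel. vort \<xi> * ln (cmod (z - \<xi>)))"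
    by (rule integral_completion) measurable
  also have "\<dots> = (LINT \<xi>|lborel. indicat_real D1 \<xi> *\<^sub>R ln (cmod (z - \<xi>)) + (\<alpha> - 1) * (indicat_real D2 \<xi> *\<^sub>R ln (cmod (z - \<xi>))))"
    by (simp add: vort_def algebra_simps)
  also have "\<dots> = (LINT \<xi>|lborel. indicat_real D1 \<xi> *\<^sub>R ln (cmod (z - \<xi>))) + (LINT \<xi>|lborel. (\<alpha> - 1) * (indicat_real D2 \<xi> *\<^sub>R ln (cmod (z - \<xi>))))"
    using set_integrable_ln_dist[of D1 z] set_integrable_ln_dist[of D2 z] bounded1 bounded2
    unfolding set_integrable_def by (intro Bochner_Integration.integral_add integrable_mult_right) auto
  also have "\<dots> = log_potential D1 z + (\<alpha> - 1) * log_potential D2 z"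
    unfolding log_potential_def set_lebesgue_integral_def by (simp only: integral_mult_right_zero)
  finally show ?thesis by (simp add: stream_function_def)
qed

lemma stream_function_vort_derivative:
  "(stream_function vort has_derivative (\<lambda>h. Re (total_transform z * h) / (2 * pi))) (at z)"
proof -
  have "((\<lambda>z. 1 / (2 * pi) * (log_potential D1 z + (\<alpha> - 1) * log_potential D2 z)) has_derivative
     (\<lambda>h. 1 / (2 * pi) * (Re (cauchy_transform D1 z * h) + (\<alpha> - 1) * Re (cauchy_transform D2 z * h)))) (at z)"
    using sets12 bounded1 bounded2
    by (intro has_derivative_mult_right has_derivative_add log_potential_has_derivative) auto
  moreover have "stream_function vort = (\<lambda>z. 1 / (2 * pi) * (log_potential D1 z + (\<alpha> - 1) * log_potential D2 z))"
    by (rule ext) (rule stream_function_vort)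
  moreover have "1 / (2 * pi) * (Re (cauchy_transform D1 z * h) + (\<alpha> - 1) * Re (cauchy_transform D2 z * h)) = Re (total_transform z * h) / (2 * pi)" for h
    by (simp add: total_transform_def algebra_simps add_divide_distrib diff_divide_distrib)
  ultimately show ?thesis by (simp only:)
qed

definition rel_field :: "real \<Rightarrow> complex \<Rightarrow> complex \<Rightarrow> complex" where
  "rel_field \<Omega> c z = total_transform z / of_real (2 * pi) - of_real \<Omega> * cnj (z - c)"

lemma rel_field_continuous: "continuous_on UNIV (rel_field \<Omega> c)"
  unfolding rel_field_def by (intro continuous_intros total_transform_continuous) auto

text \<open>The test function that rotates with the vorticity makes both sides of the weak formulation
  constant in time.\<close>

lemma rotating_solution_stationary:
  assumes sol: "euler_weak_solution vort \<omega>"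
    and rot: "\<And>t. t \<ge> 0 \<Longrightarrow> AE \<zeta> in lebesgue. \<omega> t (c + \<zeta>) = vort (c + exp (- \<i> * of_real (t * \<Omega>)) * \<zeta>)"
    and \<eta>: "\<eta> > 0"
  shows "(LINT z|lborel. vort z * Im (rel_field \<Omega> c z * bump_grad p \<eta> z)) = 0"
proof -
  define u where "u = (\<lambda>t::real. exp (- \<i> * of_real (t * \<Omega>)))"
  define r where "r = (\<lambda>t z. c + u t * (z - c))"
  have u1: "cmod (u t) = 1" for t by (simp add: u_def)
  have ucnj: "exp (\<i> * of_real (t * \<Omega>)) = cnj (u t)" for t by (simp add: u_def exp_cnj)
  have ae: "AE z in lebesgue. \<omega> t z = vort (c + u t * (z - c))" if "t \<ge> 0" for t
    by (rule AE_lebesgue_translation[where c = c]) (use rot[OF that] in \<open>simp add: u_def\<close>)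
  have meas: "\<omega> t \<in> borel_measurable lebesgue" if "t \<ge> 0" for t
    using sol that unfolding euler_weak_solution_def by (meson atLeastAtMost_iff borel_measurable_integrable order_refl)
  obtain v where v: "\<And>t. t \<ge> 0 \<Longrightarrow> biot_savart (\<omega> t) (v t)"
    and weak: "\<And>\<phi> \<phi>\<^sub>t g T. test_function \<phi> \<phi>\<^sub>t g \<Longrightarrow> T \<ge> 0 \<Longrightarrow>
        ((\<lambda>t. LINT z|lebesgue. \<omega> t z * (\<phi>\<^sub>t t z + v t z \<bullet> g t z)) has_integral
             ((LINT z|lebesgue. \<phi> T z * \<omega> T z) - (LINT z|lebesgue. \<phi> 0 z * vort z))) {0..T}"
    using sol unfolding euler_weak_solution_def by blast
  have stream: "stream_function (\<omega> t) z = stream_function vort (r t z)" if t: "t \<ge> 0" for t z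
  proof -
    have "(LINT \<xi>|lebesgue. \<omega> t \<xi> * ln (cmod (r t z - (c + u t * (\<xi> - c))))) = (LINT \<xi>|lborel. vort \<xi> * ln (cmod (r t z - \<xi>)))"
      by (rule integral_rotated[OF u1 meas[OF t] _ _ ae[OF t]]) measurable
    moreover have "cmod (r t z - (c + u t * (\<xi> - c))) = cmod (z - \<xi>)" for \<xi>
    proof -
      have "r t z - (c + u t * (\<xi> - c)) = u t * (z - \<xi>)" by (simp add: r_def algebra_simps)
      then show ?thesis by (simp add: norm_mult u1)
    qed
    moreover have "(LINT \<xi>|lebesgue. vort \<xi> * ln (cmod (r t z - \<xi>))) = (LINT \<xi>|lborel. vort \<xi> * ln (cmod (r t z - \<xi>)))"
      by (rule integral_completion) measurable
    ultimately show ?thesis by (simp add: stream_function_def)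
  qed
  \<comment> \<open>The Biot-Savart predicate fixes \<open>v\<close> through uniqueness of the
    differential: \<open>h1 v2 - h2 v1 = Re (X * h)\<close> for all \<open>h\<close> means
    \<open>v = \<i> * cnj X\<close>.\<close>
  have vel: "v t z = \<i> * cnj (total_transform (r t z) * u t / of_real (2 * pi))" if t: "t \<ge> 0" for t z
  proof -
    have rd: "(r t has_derivative (\<lambda>h. u t * h)) (at z)"
      unfolding r_def by (auto intro!: derivative_eq_intros)
    have "((\<lambda>z. stream_function vort (r t z)) has_derivative (\<lambda>h. Re (total_transform (r t z) * (u t * h)) / (2 * pi))) (at z)"
      by (rule has_derivative_compose[OF rd, of "stream_function vort"]) (use stream_function_vort_derivative in auto)
    moreover have "stream_function (\<omega> t) = (\<lambda>z. stream_function vort (r t z))"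
      by (rule ext) (rule stream[OF t])
    ultimately have "(stream_function (\<omega> t) has_derivative (\<lambda>h. Re (total_transform (r t z) * (u t * h)) / (2 * pi))) (at z)" by simp
    moreover have "(stream_function (\<omega> t) has_derivative (\<lambda>h. Re h * Im (v t z) - Im h * Re (v t z))) (at z)"
      using v[OF t] unfolding biot_savart_def by blast
    ultimately have e: "(\<lambda>h. Re (total_transform (r t z) * (u t * h)) / (2 * pi)) = (\<lambda>h. Re h * Im (v t z) - Im h * Re (v t z))"
      by (rule has_derivative_unique)
    define X where "X = total_transform (r t z) * u t / of_real (2 * pi)"
    have X: "Re (total_transform (r t z) * (u t * h)) / (2 * pi) = Re (X * h)" for h
    proof -
      have "X * h = total_transform (r t z) * (u t * h) / of_real (2 * pi)" by (simp add: X_def)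
      then show ?thesis by (simp only: Re_divide_of_real)
    qed
    have "Im (v t z) = Re X" using fun_cong[OF e, of 1] unfolding X by simp
    moreover have "Re (v t z) = Im X" using fun_cong[OF e, of \<i>] unfolding X by simp
    ultimately show ?thesis unfolding X_def[symmetric] by (simp add: complex_eq_iff)
  qed
  define K where "K = (\<lambda>z. Im (rel_field \<Omega> c z * bump_grad p \<eta> z))"
  have [measurable]: "K \<in> borel_measurable borel"
    unfolding K_def by (intro borel_measurable_continuous_onI continuous_intros rel_field_continuous bump_grad_continuous)
  have [measurable]: "bump p \<eta> \<in> borel_measurable borel"
    by (intro borel_measurable_continuous_onI bump_continuous)
  \<comment> \<open>The time derivative of the test function subtracts the rigid rotation from the
    velocity; the remaining relative velocity depends on \<open>t\<close> only through the rotated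
    point.\<close>
  have kin: "(- \<i> * of_real \<Omega> * (r t z - c)) \<bullet> bump_grad p \<eta> (r t z)
      + v t z \<bullet> (exp (\<i> * of_real (t * \<Omega>)) * bump_grad p \<eta> (r t z)) = K (r t z)" if t: "t \<ge> 0" for t z
  proof -
    define g where "g = bump_grad p \<eta> (r t z)"
    define Y where "Y = total_transform (r t z) / of_real (2 * pi)"
    have inn: "a \<bullet> b = Re (cnj a * b)" for a b :: complex by (simp add: inner_complex_def)
    have uu: "u t * cnj (u t) = 1" using u1[of t] complex_norm_square[of "u t"] by simp
    have vY: "v t z = \<i> * cnj (Y * u t)" by (simp add: vel[OF t] Y_def)
    have "cnj (v t z) * (cnj (u t) * g) = - \<i> * Y * g * (u t * cnj (u t))" by (simp add: vY)
    then have "v t z \<bullet> (cnj (u t) * g) = Re (- \<i> * Y * g)" unfolding inn uu by simp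
    then have "(- \<i> * of_real \<Omega> * (r t z - c)) \<bullet> g + v t z \<bullet> (cnj (u t) * g) = Im ((Y - of_real \<Omega> * cnj (r t z - c)) * g)"
      unfolding inn by (simp add: algebra_simps)
    then show ?thesis unfolding K_def rel_field_def Y_def[symmetric] g_def[symmetric] ucnj .
  qed
  have tf: "test_function (\<lambda>t z. bump p \<eta> (r t z))
     (\<lambda>t z. (- \<i> * of_real \<Omega> * (r t z - c)) \<bullet> bump_grad p \<eta> (r t z))
     (\<lambda>t z. exp (\<i> * of_real (t * \<Omega>)) * bump_grad p \<eta> (r t z))"
    using rotated_bump_test_function[OF \<eta>, of p c \<Omega>] by (simp only: r_def u_def)
  have lhs: "(LINT z|lebesgue. \<omega> t z * ((- \<i> * of_real \<Omega> * (r t z - c)) \<bullet> bump_grad p \<eta> (r t z)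
      + v t z \<bullet> (exp (\<i> * of_real (t * \<Omega>)) * bump_grad p \<eta> (r t z)))) = (LINT z|lborel. vort z * K z)" if t: "t \<ge> 0" for t
    unfolding kin[OF t] unfolding r_def by (rule integral_rotated[OF u1 meas[OF t] _ _ ae[OF t]]) measurable
  have rhs: "(LINT z|lebesgue. bump p \<eta> (r t z) * \<omega> t z) = (LINT z|lborel. vort z * bump p \<eta> z)" if t: "t \<ge> 0" for t
    unfolding r_def mult.commute[of "bump p \<eta> _"] by (rule integral_rotated[OF u1 meas[OF t] _ _ ae[OF t]]) measurable
  have rhs0: "(LINT z|lebesgue. bump p \<eta> (r 0 z) * vort z) = (LINT z|lborel. vort z * bump p \<eta> z)"
  proof -
    have "r 0 z = z" for z by (simp add: r_def u_def)
    then show ?thesis by (simp add: mult.commute integral_completion)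
  qed
  \<comment> \<open>On an interval of length 1 the constant integrand equals its own integral, which
    is 0 because both terms of the right side agree.\<close>
  have "((\<lambda>t::real. LINT z|lborel. vort z * K z) has_integral 0) {0..1}"
  proof (rule has_integral_eq)
    show "((\<lambda>t. LINT z|lebesgue. \<omega> t z * ((- \<i> * of_real \<Omega> * (r t z - c)) \<bullet> bump_grad p \<eta> (r t z)
      + v t z \<bullet> (exp (\<i> * of_real (t * \<Omega>)) * bump_grad p \<eta> (r t z)))) has_integral 0) {0..1}"
      using weak[OF tf, of 1] by (simp only: rhs rhs0 zero_le_one order_refl diff_self)
  qed (simp only: atLeastAtMost_iff lhs)
  moreover have "((\<lambda>t::real. LINT z|lborel. vort z * K z) has_integral (LINT z|lborel. vort z * K z)) {0..1}"
    using has_integral_const_real[of "LINT z|lborel. vort z * K z" 0 1] by simp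
  ultimately show ?thesis unfolding K_def by (rule has_integral_unique[symmetric])
qed

end

subsection \<open>Circular boundaries\<close>

text \<open>Over the whole plane there is no boundary term. This disposes of the constant part of
  the vorticity near a boundary point.\<close>

lemma integral_Im_bump_field_zero:
  assumes f: "\<And>z. (f has_derivative (\<lambda>h. Re (q z * h))) (at z)" and q: "continuous_on UNIV q" and \<eta>: "\<eta> > 0"
  shows "(LINT z|lborel. Im (q z * bump_grad p \<eta> z)) = 0"
proof -
  obtain G' where G': "C1_compact (\<lambda>z. of_real (f z) * cnj (bump_grad p \<eta> z)) G'"
    "\<And>z. Re (\<i> * dbar2 G' z) = Im (q z * bump_grad p \<eta> z)"
    using C1_compact_bump_field[OF f q \<eta>] by metis
  obtain R where R: "R > 0" "\<And>z. cmod z \<ge> R \<Longrightarrow> dbar2 G' z = 0" using C1_compactE[OF G'(1)] by metis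
  have i: "integrable lborel (\<lambda>z. \<i> * dbar2 G' z)"
    using C1_compact_continuous(2)[OF G'(1)] R
    by (intro integrable_continuous_bounded_support[of _ R] continuous_intros) auto
  have "(LINT z|lborel. Im (q z * bump_grad p \<eta> z)) = (LINT z|lborel. Re (\<i> * dbar2 G' z))"
    by (simp only: G'(2))
  also have "\<dots> = Re (LINT z|lborel. \<i> * dbar2 G' z)" using i by (rule integral_Re)
  also have "\<dots> = 0" by (simp only: integral_mult_right_zero integral_dbar2_zero[OF G'(1)]) simp
  finally show ?thesis .
qed

text \<open>A connected set missing \<open>frontier D\<close> lies in \<open>D\<close> or misses it.
  The unbounded outside must miss the bounded \<open>D\<close>, so \<open>D\<close> lies inside; the
  inside then meets \<open>D\<close> and lies in it.\<close>

lemma inside_frontier_eq: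
  fixes D :: "complex set"
  assumes "open D" "connected D" "bounded D" "D \<noteq> {}" and \<gamma>: "simple_path \<gamma>" "pathfinish \<gamma> = pathstart \<gamma>" "path_image \<gamma> = frontier D"
  shows "inside (path_image \<gamma>) = D"
proof -
  note J = Jordan_inside_outside[OF \<gamma>(1,2)]
  have disj: "D \<inter> frontier D = {}" using assms(1) by (simp add: frontier_def interior_open)
  have part: "X \<subseteq> D" if "connected X" "X \<inter> D \<noteq> {}" "X \<inter> frontier D = {}" for X
    using connected_Int_frontier[OF that(1,2)] that(3) by blast
  have "outside (path_image \<gamma>) \<inter> D = {}"
  proof (rule ccontr)
    assume "outside (path_image \<gamma>) \<inter> D \<noteq> {}"
    moreover have "outside (path_image \<gamma>) \<inter> frontier D = {}" using \<gamma>(3) outside_no_overlap by blast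
    moreover have "connected (outside (path_image \<gamma>))" "\<not> bounded (outside (path_image \<gamma>))" using J by simp_all
    ultimately show False using part bounded_subset[OF assms(3)] by metis
  qed
  moreover have "D \<inter> path_image \<gamma> = {}" using disj \<gamma>(3) by simp
  ultimately have DI: "D \<subseteq> inside (path_image \<gamma>)"
    using inside_Un_outside[of "path_image \<gamma>"] by blast
  have "inside (path_image \<gamma>) \<subseteq> D"
  proof (rule part)
    show "connected (inside (path_image \<gamma>))" using J by simp
    show "inside (path_image \<gamma>) \<inter> D \<noteq> {}" using DI assms(4) by blast
    show "inside (path_image \<gamma>) \<inter> frontier D = {}" using inside_no_overlap[of "path_image \<gamma>"] \<gamma>(3) by simp
  qed
  with DI show ?thesis by (rule subset_antisym[rotated])
qed

text \<open>The same dichotomy for the exterior and interior of the circle. Inclusion is the form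
  supplied later, when the distance to \<open>a\<close> is found constant on the curve.\<close>

lemma frontier_subset_sphere:
  fixes D :: "complex set"
  assumes "open D" "bounded D" "D \<noteq> {}" "frontier D \<subseteq> sphere a \<rho>" "\<rho> > 0"
  shows "D = ball a \<rho>"
proof -
  have disj: "D \<inter> frontier D = {}" using assms(1) by (simp add: frontier_def interior_open)
  have part: "X \<subseteq> D" if "connected X" "X \<inter> D \<noteq> {}" "X \<inter> frontier D = {}" for X
    using connected_Int_frontier[OF that(1,2)] that(3) by blast
  have out: "- cball a \<rho> \<inter> D = {}"
  proof (rule ccontr)
    assume "- cball a \<rho> \<inter> D \<noteq> {}"
    moreover have "connected (- cball a \<rho>)" by (rule connected_complement_bounded_convex) auto
    moreover have "- cball a \<rho> \<inter> frontier D = {}" using assms(4) by auto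
    ultimately have "- cball a \<rho> \<subseteq> D" using part by blast
    then have "bounded (- cball a \<rho>)" using assms(2) bounded_subset by blast
    then show False using cobounded_imp_unbounded[of "cball a \<rho>"] by auto
  qed
  have "D \<subseteq> interior (cball a \<rho>)" using out assms(1) by (intro interior_maximal) auto
  then have Db: "D \<subseteq> ball a \<rho>" by simp
  moreover have "ball a \<rho> \<subseteq> D" using Db assms(3,4) by (intro part) auto
  ultimately show ?thesis by blast
qed

lemma Re_of_real_mult: "Re (of_real x * w) = x * Re w"
  by simp

context C1_loop
begin

lemma norm_square_derivative:
  assumes "s \<in> {0..1}"
  shows "((\<lambda>s. (cmod (\<gamma> s - a))\<^sup>2) has_vector_derivative 2 * Re (cnj (\<gamma> s - a) * \<gamma>' s)) (at s within {0..1})"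
proof -
  have "((\<lambda>s. \<gamma> s - a) has_derivative (\<lambda>h. h *\<^sub>R \<gamma>' s)) (at s within {0..1})"
    using deriv[OF assms] unfolding has_vector_derivative_def by (auto intro!: derivative_eq_intros)
  then have "((\<lambda>s. (\<gamma> s - a) \<bullet> (\<gamma> s - a)) has_derivative (\<lambda>h. (\<gamma> s - a) \<bullet> (h *\<^sub>R \<gamma>' s) + (h *\<^sub>R \<gamma>' s) \<bullet> (\<gamma> s - a))) (at s within {0..1})"
    by (rule has_derivative_inner) fact
  moreover have "(\<gamma> s - a) \<bullet> (h *\<^sub>R \<gamma>' s) + (h *\<^sub>R \<gamma>' s) \<bullet> (\<gamma> s - a) = h *\<^sub>R (2 * Re (cnj (\<gamma> s - a) * \<gamma>' s))" for h
    by (simp add: inner_complex_def algebra_simps)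
  ultimately show ?thesis
    unfolding has_vector_derivative_def by (simp only: power2_norm_eq_inner)
qed

text \<open>With \<open>N = |\<gamma> - a|\<^sup>2\<close> the hypothesis says \<open>(l1 N + l2) N' = 0\<close>, so \<open>(l1 N + l2)\<^sup>2\<close> is constant.\<close>

lemma radial_tangential:
  assumes a: "a \<notin> path_image \<gamma>" and l2: "l2 \<noteq> 0"
    and cond: "\<And>s. s \<in> {0..1} \<Longrightarrow> Re ((of_real l1 * cnj (\<gamma> s - a) + of_real l2 / (\<gamma> s - a)) * \<gamma>' s) = 0"
  shows "\<exists>\<rho>>0. path_image \<gamma> \<subseteq> sphere a \<rho>"
proof -
  define N where "N = (\<lambda>s. (cmod (\<gamma> s - a))\<^sup>2)"
  define N' where "N' = (\<lambda>s. 2 * Re (cnj (\<gamma> s - a) * \<gamma>' s))"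
  have nz: "\<gamma> s - a \<noteq> 0" if "s \<in> {0..1}" for s using a that by (auto simp: path_image_def)
  have Nd: "(N has_vector_derivative N' s) (at s within {0..1})" if "s \<in> {0..1}" for s
    unfolding N_def N'_def by (rule norm_square_derivative[OF that])
  have zero: "(l1 * N s + l2) * N' s = 0" if s: "s \<in> {0..1}" for s
  proof -
    define w where "w = \<gamma> s - a"
    have w: "w \<noteq> 0" "N s \<noteq> 0" using nz[OF s] by (auto simp: w_def N_def)
    have Nw: "of_real (N s) = w * cnj w" unfolding N_def w_def by (rule complex_norm_square)
    have "of_real l2 / w = of_real (l2 / N s) * cnj w"
      using w by (simp add: Nw)
    then have "(of_real l1 * cnj w + of_real l2 / w) * \<gamma>' s = of_real (l1 + l2 / N s) * (cnj w * \<gamma>' s)"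
      by (simp add: algebra_simps)
    then have "Re (of_real (l1 + l2 / N s) * (cnj w * \<gamma>' s)) = 0"
      using cond[OF s] unfolding w_def by (simp only:)
    then have "(l1 + l2 / N s) * Re (cnj w * \<gamma>' s) = 0" by (simp only: Re_of_real_mult)
    then have "(l1 + l2 / N s) * N' s = 0" by (simp add: N'_def w_def)
    then show ?thesis using w(2) by (simp add: field_simps)
  qed
  have const: "\<exists>k. \<forall>s\<in>{0..1}. g s = k" if "\<And>s. s \<in> {0..1} \<Longrightarrow> (g has_vector_derivative 0) (at s within {0..1})" for g :: "real \<Rightarrow> real"
    by (rule has_field_derivative_zero_constant) (use that in \<open>auto simp: has_real_derivative_iff_has_vector_derivative\<close>)
  have "((\<lambda>s. (l1 * N s + l2)\<^sup>2) has_vector_derivative 0) (at s within {0..1})" if s: "s \<in> {0..1}" for s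
  proof -
    have "((\<lambda>s. (l1 * N s + l2)\<^sup>2) has_real_derivative 2 * (l1 * N s + l2) * (l1 * N' s)) (at s within {0..1})"
      using Nd[OF s] unfolding has_real_derivative_iff_has_vector_derivative[symmetric]
      by (auto intro!: derivative_eq_intros)
    moreover have "2 * (l1 * N s + l2) * (l1 * N' s) = 0" using zero[OF s] by auto
    ultimately have "((\<lambda>s. (l1 * N s + l2)\<^sup>2) has_real_derivative 0) (at s within {0..1})" by (simp only:)
    then show ?thesis by (simp only: has_real_derivative_iff_has_vector_derivative)
  qed
  then obtain k where k: "\<And>s. s \<in> {0..1} \<Longrightarrow> (l1 * N s + l2)\<^sup>2 = k"
    using const[of "\<lambda>s. (l1 * N s + l2)\<^sup>2"] by blast
  \<comment> \<open>If \<open>k = 0\<close> then \<open>l1 * N = - l2\<close> with \<open>l2\<close>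
    nonzero fixes \<open>N\<close>; otherwise \<open>N' = 0\<close> throughout.\<close>
  have "\<exists>n. \<forall>s\<in>{0..1}. N s = n"
  proof (cases "k = 0")
    case True
    then have e: "l1 * N s = - l2" if "s \<in> {0..1}" for s using k[OF that] by simp
    have "l1 * N 0 = - l2" using e[of 0] by simp
    then have "l1 \<noteq> 0" using l2 by auto
    then have "N s = - l2 / l1" if "s \<in> {0..1}" for s using e[OF that] by (simp add: field_simps)
    then show ?thesis by blast
  next
    case False
    then have "N' s = 0" if "s \<in> {0..1}" for s using zero[OF that] k[OF that] by auto
    then show ?thesis using const[of N] Nd by simp
  qed
  then obtain n where n: "\<And>s. s \<in> {0..1} \<Longrightarrow> N s = n" by blast
  have "n > 0" using n[of 0] nz[of 0] by (auto simp: N_def)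
  moreover have "cmod (\<gamma> s - a) = sqrt n" if "s \<in> {0..1}" for s
    using n[OF that] by (simp add: N_def real_sqrt_unique)
  ultimately show ?thesis
    by (intro exI[of _ "sqrt n"]) (auto simp: path_image_def dist_norm norm_minus_commute)
qed

text \<open>The tangent of a circle is a nonzero real multiple of \<open>\<i> * (z - a)\<close>, so
  the condition on \<open>\<gamma>'\<close> becomes one on the position alone.\<close>

lemma circle_tangential:
  assumes sph: "path_image \<gamma> = sphere a r" "r > 0" and nz: "\<And>s. s \<in> {0..1} \<Longrightarrow> \<gamma>' s \<noteq> 0"
    and cond: "\<And>s. s \<in> {0..1} \<Longrightarrow> Re (q (\<gamma> s) * \<gamma>' s) = 0" and z: "z \<in> sphere a r"
  shows "Im ((z - a) * q z) = 0"
proof -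
  obtain s where s: "s \<in> {0..1}" "z = \<gamma> s" using z sph(1) by (metis imageE path_image_def)
  have "cmod (\<gamma> t - a) = r" if "t \<in> {0..1}" for t
    using that sph(1) by (metis dist_commute dist_norm imageI mem_sphere path_image_def)
  then have c: "(\<lambda>s. r\<^sup>2) t = (cmod (\<gamma> t - a))\<^sup>2" if "t \<in> {0..1}" for t using that by simp
  have A: "((\<lambda>s. r\<^sup>2) has_vector_derivative 2 * Re (cnj (\<gamma> s - a) * \<gamma>' s)) (at s within {0..1})"
    by (rule has_vector_derivative_transform[OF s(1) c norm_square_derivative[OF s(1)]])
  have B: "((\<lambda>s. r\<^sup>2) has_vector_derivative 0) (at s within {0..1})" by simp
  have "2 * Re (cnj (\<gamma> s - a) * \<gamma>' s) = 0"
    by (rule vector_derivative_unique_within_closed_interval[of 0 1 s, OF _ _ A[folded box_real(2)] B[folded box_real(2)]])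
      (use s(1) in auto)
  then have R: "Re (cnj (z - a) * \<gamma>' s) = 0" unfolding s(2) by linarith
  define w where "w = z - a"
  have w: "w \<noteq> 0" "cnj w * w \<noteq> 0" using z sph(2) by (auto simp: w_def)
  define \<mu> where "\<mu> = Im (cnj w * \<gamma>' s)"
  have e: "cnj w * \<gamma>' s = \<i> * of_real \<mu>" using R by (simp add: complex_eq_iff \<mu>_def w_def)
  then have "\<mu> \<noteq> 0" using w nz[OF s(1)] by auto
  have "0 = (cmod w)\<^sup>2 * Re (q z * \<gamma>' s)" using cond[OF s(1)] s(2) by simp
  also have "\<dots> = Re (of_real ((cmod w)\<^sup>2) * (q z * \<gamma>' s))" by (simp only: Re_of_real_mult)
  also have "of_real ((cmod w)\<^sup>2) * (q z * \<gamma>' s) = w * q z * (cnj w * \<gamma>' s)"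
    using complex_norm_square[of w] by (simp add: mult_ac)
  also have "Re \<dots> = - \<mu> * Im (w * q z)" unfolding e by simp
  finally show ?thesis using \<open>\<mu> \<noteq> 0\<close> by (simp add: w_def)
qed

end

text \<open>\<open>exp (\<i> * Y)\<close> and \<open>exp (- \<i> * Y)\<close> have modulus 1 on the
  circle, so the maximum principle forces \<open>Im Y = 0\<close> inside; a real image is not open,
  hence \<open>Y\<close> is constant.\<close>

lemma holomorphic_real_on_sphere_constant:
  assumes Y: "Y holomorphic_on ball a r" "continuous_on (cball a r) Y" and r: "r > 0"
    and real: "\<And>z. z \<in> sphere a r \<Longrightarrow> Im (Y z) = 0" and z: "z \<in> ball a r"
  shows "Y z = Y a" "Im (Y z) = 0"
proof -
  have bd: "norm (exp (c * Y w)) \<le> 1" if c: "c = \<i> \<or> c = - \<i>" and w: "w \<in> ball a r" for c w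
  proof (rule maximum_modulus_frontier[of "\<lambda>w. exp (c * Y w)" "ball a r"])
    show "(\<lambda>w. exp (c * Y w)) holomorphic_on interior (ball a r)"
      using Y(1) by (auto intro!: holomorphic_intros)
    show "continuous_on (closure (ball a r)) (\<lambda>w. exp (c * Y w))"
      using Y(2) r by (auto intro!: continuous_intros)
    fix v assume "v \<in> frontier (ball a r)"
    then have "Im (Y v) = 0" using r real by simp
    then show "norm (exp (c * Y v)) \<le> 1" using c by auto
  qed (use w in auto)
  have im: "Im (Y w) = 0" if "w \<in> ball a r" for w
    using bd[of \<i> w] bd[of "- \<i>" w] that by simp
  then show "Im (Y z) = 0" using z .
  have "Y constant_on ball a r"
  proof (rule ccontr)
    assume "\<not> Y constant_on ball a r"
    then have "open (Y ` ball a r)" using open_mapping_thm[OF Y(1) _ _ _ order_refl] by auto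
    moreover have "Y a \<in> Y ` ball a r" using r by auto
    ultimately obtain e where e: "e > 0" "ball (Y a) e \<subseteq> Y ` ball a r" using openE by blast
    have "Y a + of_real (e/2) * \<i> \<in> ball (Y a) e" using e by (simp add: dist_norm norm_mult)
    then obtain w where "w \<in> ball a r" "Y w = Y a + of_real (e/2) * \<i>" using e by (metis imageE subsetD)
    then have "e / 2 = Im (Y w) - Im (Y a)" by simp
    then show False using im[OF \<open>w \<in> ball a r\<close>] im[of a] r e by simp
  qed
  then show "Y z = Y a" using z r unfolding constant_on_def by auto
qed

section \<open>Boundary conditions of both patches, and a circular inner curve\<close>

locale rotating_patches = two_patches +
  fixes \<Omega> :: real and c :: complex
  assumes connected1: "connected D1" and connected2: "connected D2"
    and nonempty1: "D1 \<noteq> {}" and nonempty2: "D2 \<noteq> {}"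
    and nested: "closure D2 \<subseteq> D1" and alpha: "\<alpha> \<noteq> 1"
    and stationary: "\<And>p \<eta>. \<eta> > 0 \<Longrightarrow> (LINT z|lborel. vort z * Im (rel_field \<Omega> c z * bump_grad p \<eta> z)) = 0"
begin

lemma stream_derivative:
  "((\<lambda>z. stream_function vort z - \<Omega> / 2 * ((z - c) \<bullet> (z - c))) has_derivative (\<lambda>h. Re (rel_field \<Omega> c z * h))) (at z)"
proof -
  have "((\<lambda>z. stream_function vort z - \<Omega> / 2 * ((z - c) \<bullet> (z - c))) has_derivative
      (\<lambda>h. Re (total_transform z * h) / (2 * pi) - \<Omega> * ((z - c) \<bullet> h))) (at z)"
  proof -
    have "((\<lambda>z. (z - c) \<bullet> (z - c)) has_derivative (\<lambda>h. 2 * ((z - c) \<bullet> h))) (at z)"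
      by (auto intro!: derivative_eq_intros simp: inner_commute)
    from has_derivative_diff[OF stream_function_vort_derivative[of z] has_derivative_mult_right[OF this, of "\<Omega> / 2"]]
    show ?thesis by simp
  qed
  moreover have "Re (total_transform z * h) / (2 * pi) - \<Omega> * ((z - c) \<bullet> h) = Re (rel_field \<Omega> c z * h)" for h
  proof -
    have "rel_field \<Omega> c z * h = total_transform z * h / of_real (2 * pi) - of_real \<Omega> * (cnj (z - c) * h)"
      by (simp add: rel_field_def algebra_simps)
    moreover have "Re (cnj (z - c) * h) = (z - c) \<bullet> h" by (simp add: inner_complex_def algebra_simps)
    ultimately show ?thesis by (simp only: minus_complex.sel Re_divide_of_real) simp
  qed
  ultimately show ?thesis by (simp only:)
qed

text \<open>The dynamics enters only through \<open>stationary\<close>. Nesting keeps the curves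
  apart, so near a boundary point the vorticity is a constant plus a jump times the indicator of one
  patch; the constant integrates to 0, leaving the area condition for that patch.\<close>

lemma tangential:
  assumes "D = D1 \<or> D = D2" "C1_jordan_curve (frontier D)"
  obtains \<gamma> \<gamma>' where "C1_loop \<gamma> \<gamma>'" "path_image \<gamma> = frontier D" "inside (frontier D) = D"
    "\<And>s. s \<in> {0..1} \<Longrightarrow> \<gamma>' s \<noteq> 0" "\<And>s. s \<in> {0..1} \<Longrightarrow> Re (rel_field \<Omega> c (\<gamma> s) * \<gamma>' s) = 0"
proof -
  obtain \<gamma> \<gamma>' where g: "simple_path \<gamma>" "pathfinish \<gamma> = pathstart \<gamma>" "path_image \<gamma> = frontier D"
    "\<And>s. s \<in> {0..1} \<Longrightarrow> (\<gamma> has_vector_derivative \<gamma>' s) (at s within {0..1})" "\<And>s. s \<in> {0..1} \<Longrightarrow> \<gamma>' s \<noteq> 0"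
    "continuous_on {0..1} \<gamma>'" "\<gamma>' 0 = \<gamma>' 1"
    using assms(2) unfolding C1_jordan_curve_def by blast
  interpret C1_loop \<gamma> \<gamma>' by (intro C1_loop.intro g)
  have ins: "inside (frontier D) = D"
    using inside_frontier_eq[of D \<gamma>] g(1-3) assms(1) open1 open2 bounded1 bounded2 connected1 connected2 nonempty1 nonempty2 by auto
  let ?K = "\<lambda>p \<eta> z. Im (rel_field \<Omega> c z * bump_grad p \<eta> z)"
  have K0: "?K p \<eta> z = 0" if "\<eta> > 0" "z \<notin> ball p \<eta>" for p \<eta> z using bump_grad_eq_0[OF that] by simp
  have Ki: "integrable lborel (?K p \<eta>)" if \<eta>: "\<eta> > 0" for p \<eta>
  proof (rule integrable_continuous_bounded_support[where R = "cmod p + \<eta>"])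
    show "continuous_on UNIV (?K p \<eta>)"
      by (intro continuous_intros rel_field_continuous bump_grad_continuous)
    fix z assume "cmod p + \<eta> \<le> cmod z"
    then show "?K p \<eta> z = 0"
      using norm_triangle_ineq2[of z p] by (intro K0 \<eta>) (simp add: dist_norm norm_minus_commute)
  qed
  have "\<exists>\<eta>1>0. \<forall>\<eta>. 0 < \<eta> \<and> \<eta> < \<eta>1 \<longrightarrow> (LINT z:D|lborel. ?K p \<eta> z) = 0" if p: "p \<in> path_image \<gamma>" for p
  proof -
    \<comment> \<open>\<open>k2\<close> is the jump, 1 across the outer and
      \<open>\<alpha> - 1\<close> across the inner curve; \<open>k1\<close> is the vorticity just
      outside \<open>D\<close>.\<close>
    obtain e k1 k2 where e: "e > 0" "k2 \<noteq> 0" "\<And>z. z \<in> ball p e \<Longrightarrow> vort z = k1 + k2 * indicat_real D z"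
    proof (cases "D = D1")
      case True
      then have "p \<in> - closure D2" using p g(3) nested open1 by (auto simp: frontier_def interior_open)
      then obtain e where e: "e > 0" "ball p e \<subseteq> - closure D2" using openE[of "- closure D2" p] by auto
      then have "vort z = 0 + 1 * indicat_real D z" if "z \<in> ball p e" for z
        using that True closure_subset[of D2] by (auto simp: vort_def indicator_def simp del: mem_ball)
      then show ?thesis using that[OF e(1), of 1 0] by simp
    next
      case False
      then have D: "D = D2" using assms(1) by simp
      then have "p \<in> D1" using p g(3) nested by (auto simp: frontier_def)
      then obtain e where e: "e > 0" "ball p e \<subseteq> D1" using openE[OF open1] by blast
      then have "vort z = 1 + (\<alpha> - 1) * indicat_real D z" if "z \<in> ball p e" for z
        using that D by (auto simp: vort_def indicator_def simp del: mem_ball)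
      then show ?thesis using that[OF e(1), of "\<alpha> - 1" 1] alpha by simp
    qed
    have "(LINT z:D|lborel. ?K p \<eta> z) = 0" if \<eta>: "0 < \<eta>" "\<eta> < e" for \<eta>
    proof -
      have iD: "integrable lborel (\<lambda>z. indicat_real D z *\<^sub>R ?K p \<eta> z)"
        using Ki[OF \<eta>(1)] sets12 assms(1) by (intro integrable_mult_indicator) auto
      have "vort z * ?K p \<eta> z = k1 * ?K p \<eta> z + k2 * (indicat_real D z *\<^sub>R ?K p \<eta> z)" for z
      proof (cases "z \<in> ball p \<eta>")
        case True
        then have "z \<in> ball p e" using \<eta> by simp
        then show ?thesis by (simp add: e(3) distrib_right)
      next
        case False
        then show ?thesis by (simp only: K0[OF \<eta>(1) False] mult_zero_right scaleR_zero_right add_0)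
      qed
      then have "0 = (LINT z|lborel. k1 * ?K p \<eta> z + k2 * (indicat_real D z *\<^sub>R ?K p \<eta> z))"
        using stationary[OF \<eta>(1), of p] by (simp only:)
      also have "\<dots> = (LINT z|lborel. k1 * ?K p \<eta> z) + (LINT z|lborel. k2 * (indicat_real D z *\<^sub>R ?K p \<eta> z))"
        by (rule Bochner_Integration.integral_add[OF integrable_mult_right[OF Ki[OF \<eta>(1)]] integrable_mult_right[OF iD]])
      also have "\<dots> = k2 * (LINT z:D|lborel. ?K p \<eta> z)"
        unfolding set_lebesgue_integral_def integral_mult_right_zero
        using integral_Im_bump_field_zero[OF stream_derivative rel_field_continuous \<eta>(1), of p] by simp
      finally show ?thesis using e(2) by simp
    qed
    then show ?thesis using e(1) by blast
  qed
  then have loc: "\<And>p. p \<in> path_image \<gamma> \<Longrightarrow> \<exists>\<eta>1>0. \<forall>\<eta>. 0 < \<eta> \<and> \<eta> < \<eta>1 \<longrightarrow>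
        (LINT z:inside (path_image \<gamma>)|lborel. ?K p \<eta> z) = 0"
    unfolding g(3) ins by simp
  have "Re (rel_field \<Omega> c (\<gamma> s) * \<gamma>' s) = 0" if "s \<in> {0..1}" for s
    by (rule tangential_derivative_zero[OF g(7) stream_derivative rel_field_continuous loc that])
  then show ?thesis using that[OF C1_loop_axioms g(3) ins g(5)] by blast
qed

text \<open>On the inner circle \<open>(z - a) * cnj (z - a)\<close> is constant. Multiplying the
  field by \<open>z - a\<close> therefore turns its antiholomorphic part into a real constant, and
  the remainder \<open>Y\<close> is holomorphic in all of \<open>D1\<close> and real on the
  circle.\<close>

lemma outer_circle:
  assumes C: "C1_jordan_curve (frontier D1)" "C1_jordan_curve (frontier D2)" and sph: "frontier D2 = sphere a r" and r: "r > 0"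
  shows "\<exists>s>0. frontier D1 = sphere a s"
proof -
  have D2: "D2 = ball a r" using frontier_subset_sphere[OF open2 bounded2 nonempty2 _ r] sph by simp
  have cb: "cball a r \<subseteq> D1" using nested D2 r by simp
  define H where "H = (\<lambda>z. cauchy_transform D1 z - of_real pi * cnj z)"
  have H: "H holomorphic_on D1" unfolding H_def by (rule cauchy_transform_dbar[OF open1 finite12(1)])
  \<comment> \<open>What is left of \<open>cnj z / 2 - \<Omega> * cnj (z - c)\<close> after taking
    out \<open>(1/2 - \<Omega>) * cnj (z - a)\<close>.\<close>
  define \<kappa> where "\<kappa> = cnj a / 2 + of_real \<Omega> * cnj (c - a)"
  define Y where "Y = (\<lambda>z. (z - a) * (H z / of_real (2 * pi) + \<kappa>))"
  have Yh: "Y holomorphic_on D1" unfolding Y_def by (intro holomorphic_intros H) auto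
  have C1H: "cauchy_transform D1 z = H z + of_real pi * cnj z" for z by (simp add: H_def)
  obtain \<gamma>2 \<gamma>2' where g2: "C1_loop \<gamma>2 \<gamma>2'" "path_image \<gamma>2 = frontier D2" "inside (frontier D2) = D2"
    "\<And>s. s \<in> {0..1} \<Longrightarrow> \<gamma>2' s \<noteq> 0" "\<And>s. s \<in> {0..1} \<Longrightarrow> Re (rel_field \<Omega> c (\<gamma>2 s) * \<gamma>2' s) = 0"
    using tangential[of D2] C by metis
  have im: "Im (Y z) = 0" if z: "z \<in> sphere a r" for z
  proof -
    have "Im ((z - a) * rel_field \<Omega> c z) = 0"
      by (rule C1_loop.circle_tangential[OF g2(1) _ r g2(4,5) z]) (use g2(2) sph in auto)
    have nz: "z - a \<noteq> 0" "cmod (z - a) = r" using z r by (auto simp: dist_norm norm_minus_commute)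
    have rr: "of_real (r\<^sup>2) = (z - a) * cnj (z - a)" unfolding nz(2)[symmetric] by (rule complex_norm_square)
    have C2: "cauchy_transform D2 z = of_real pi * cnj (z - a)"
      unfolding D2 using cauchy_transform_ball_outside[OF r, of z a] nz rr by simp
    have "rel_field \<Omega> c z = H z / of_real (2 * pi) + \<kappa> + of_real (\<alpha> / 2 - \<Omega>) * cnj (z - a)"
      unfolding rel_field_def total_transform_def C1H C2 \<kappa>_def by (simp add: field_simps)
    then have "(z - a) * rel_field \<Omega> c z = Y z + of_real (\<alpha> / 2 - \<Omega>) * of_real (r\<^sup>2)"
    proof -
      have "x * (h + k + y * w) = x * (h + k) + y * (x * w)" for x h k y w :: complex
        by (simp add: algebra_simps)
      then show ?thesis unfolding rr Y_def \<open>rel_field \<Omega> c z = _\<close> by (simp only:)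
    qed
    then show ?thesis using \<open>Im ((z - a) * rel_field \<Omega> c z) = 0\<close> by (simp flip: of_real_mult of_real_power)
  qed
  have Yball: "Y holomorphic_on ball a r" "continuous_on (cball a r) Y"
    using Yh cb holomorphic_on_subset[of Y D1 "ball a r"] holomorphic_on_imp_continuous_on[OF Yh] continuous_on_subset ball_subset_cball by blast+
  \<comment> \<open>The constant value of \<open>Y\<close> is 0 because of its factor
    \<open>z - a\<close>.\<close>
  have "Y z = 0" if "z \<in> ball a r" for z
    using holomorphic_real_on_sphere_constant(1)[OF Yball r im that] by (simp add: Y_def)
  note Yb = this
  have Y0: "Y z = 0" if "z \<in> D1" for z
  proof (rule analytic_continuation_open[of "ball a r" D1 Y "\<lambda>_. 0" z])
    show "ball a r \<subseteq> D1" using cb ball_subset_cball by blast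
  qed (use open1 connected1 r that Yh Yb in auto)
  \<comment> \<open>The factor \<open>z - a\<close> is kept since \<open>Y a = 0\<close> says
    nothing about the bracket at \<open>a\<close>. As a closed condition the identity reaches the
    outer curve.\<close>
  have key: "(z - a) * (cauchy_transform D1 z - of_real pi * cnj z + of_real (2 * pi) * \<kappa>) = 0" if "z \<in> closure D1" for z
  proof -
    have "D1 \<subseteq> {z. (z - a) * (cauchy_transform D1 z - of_real pi * cnj z + of_real (2 * pi) * \<kappa>) = 0}"
    proof
      fix z assume "z \<in> D1"
      then have "(z - a) * (H z / of_real (2 * pi) + \<kappa>) = 0" using Y0 by (simp add: Y_def)
      then show "z \<in> {z. (z - a) * (cauchy_transform D1 z - of_real pi * cnj z + of_real (2 * pi) * \<kappa>) = 0}"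
        unfolding H_def by (auto simp: field_simps)
    qed
    moreover have "closed {z. (z - a) * (cauchy_transform D1 z - of_real pi * cnj z + of_real (2 * pi) * \<kappa>) = 0}"
      using cauchy_transform_continuous[OF _ finite12(1)] by (intro closed_Collect_eq continuous_intros) auto
    ultimately show ?thesis using closure_minimal that by blast
  qed
  obtain \<gamma>1 \<gamma>1' where g1: "C1_loop \<gamma>1 \<gamma>1'" "path_image \<gamma>1 = frontier D1" "inside (frontier D1) = D1"
    "\<And>s. s \<in> {0..1} \<Longrightarrow> \<gamma>1' s \<noteq> 0" "\<And>s. s \<in> {0..1} \<Longrightarrow> Re (rel_field \<Omega> c (\<gamma>1 s) * \<gamma>1' s) = 0"
    using tangential[of D1] C by metis
  have out: "cmod (z - a) > r" if "z \<in> frontier D1" for z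
    using that cb open1 by (auto simp: frontier_def interior_open dist_norm norm_minus_commute subset_eq not_le)
  have "\<exists>\<rho>>0. path_image \<gamma>1 \<subseteq> sphere a \<rho>"
  \<comment> \<open>\<open>l2\<close> comes from \<open>D2\<close> acting as a point mass
    \<open>pi * r\<^sup>2\<close> at \<open>a\<close>, \<open>l1\<close> from the transform of
    \<open>D1\<close> together with the rotation; \<open>\<kappa>\<close> cancels.\<close>
  proof (rule C1_loop.radial_tangential[OF g1(1), where ?l1.0 = "1/2 - \<Omega>" and ?l2.0 = "(\<alpha> - 1) * r\<^sup>2 / 2"])
    show "a \<notin> path_image \<gamma>1" using out[of a] g1(2) r by auto
    show "(\<alpha> - 1) * r\<^sup>2 / 2 \<noteq> 0" using alpha r by simp
    fix s :: real assume s: "s \<in> {0..1}"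
    define z where "z = \<gamma>1 s"
    have z: "z \<in> frontier D1" using s g1(2) by (auto simp: z_def path_image_def)
    have nz: "z - a \<noteq> 0" "cmod (z - a) \<ge> r" using out[OF z] r by auto
    have C1: "cauchy_transform D1 z = of_real pi * cnj z - of_real (2 * pi) * \<kappa>"
    proof -
      have "z \<in> closure D1" using z by (simp add: frontier_def)
      from key[OF this] have "cauchy_transform D1 z - of_real pi * cnj z + of_real (2 * pi) * \<kappa> = 0"
        using nz(1) unfolding mult_eq_0_iff by blast
      then show ?thesis by algebra
    qed
    have C2: "cauchy_transform D2 z = of_real (pi * r\<^sup>2) / (z - a)"
      unfolding D2 by (rule cauchy_transform_ball_outside[OF r nz(2)])
    have "rel_field \<Omega> c z = of_real (1/2 - \<Omega>) * cnj (z - a) + of_real ((\<alpha> - 1) * r\<^sup>2 / 2) / (z - a)"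
      unfolding rel_field_def total_transform_def C1 C2 \<kappa>_def using nz(1) by (simp add: field_simps)
    then show "Re ((of_real (1/2 - \<Omega>) * cnj (\<gamma>1 s - a) + of_real ((\<alpha> - 1) * r\<^sup>2 / 2) / (\<gamma>1 s - a)) * \<gamma>1' s) = 0"
      using g1(5)[OF s] by (simp only: z_def)
  qed
  then obtain \<rho> where \<rho>: "\<rho> > 0" "frontier D1 \<subseteq> sphere a \<rho>" using g1(2) by auto
  then have "D1 = ball a \<rho>" using frontier_subset_sphere[OF open1 bounded1 nonempty1] by blast
  then show ?thesis using \<rho>(1) by auto
qed

end

text \<open>The factor \<open>(z - q) ^ k\<close> with \<open>q\<close> outside \<open>D\<close> close to \<open>p\<close> beats the bound
  on \<open>g\<close> in the maximum principle.\<close>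

lemma boundary_uniqueness:
  fixes g :: "complex \<Rightarrow> complex"
  assumes D: "open D" and \<delta>: "\<delta> > 0" and hol: "g holomorphic_on D \<inter> ball p \<delta>"
    and cont: "continuous_on (closure D \<inter> cball p \<delta>) g"
    and zero: "\<And>z. z \<in> frontier D \<Longrightarrow> z \<in> cball p \<delta> \<Longrightarrow> g z = 0"
    and p: "p \<in> frontier D" "p \<in> closure (- closure D)"
  obtains e z where "e > 0" "ball z e \<subseteq> D \<inter> ball p \<delta>" "\<And>w. w \<in> ball z e \<Longrightarrow> g w = 0"
proof -
  obtain q where q: "q \<in> - closure D" "dist q p < \<delta> / 4"
    using p(2) \<delta> unfolding closure_approachable by (meson divide_pos_pos zero_less_numeral)
  \<comment> \<open>Points at distance \<open>\<delta>\<close> from \<open>p\<close> are at least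
    \<open>\<rho>\<close> away from \<open>q\<close>, whereas points of \<open>D\<close> within
    \<open>\<delta> / 4\<close> of \<open>p\<close> are closer to \<open>q\<close> than
    \<open>\<rho>\<close>; there the powers of the quotient tend to 0.\<close>
  define \<rho> where "\<rho> = \<delta> - dist q p"
  have \<rho>: "\<rho> > \<delta> / 2" using q(2) \<delta> by (simp add: \<rho>_def)
  have "compact (closure D \<inter> cball p \<delta>)" by (intro closed_Int_compact) auto
  then have "bounded (g ` (closure D \<inter> cball p \<delta>))"
    using cont by (intro compact_imp_bounded compact_continuous_image)
  then obtain M where M: "M > 0" "\<And>z. z \<in> closure D \<inter> cball p \<delta> \<Longrightarrow> norm (g z) \<le> M"
    unfolding bounded_pos by blast
  let ?S = "D \<inter> ball p \<delta>"
  have oS: "open ?S" using D by auto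
  have clS: "closure ?S \<subseteq> closure D \<inter> cball p \<delta>"
    by (rule closure_minimal) (use closure_subset[of D] in \<open>auto intro!: closed_Int\<close>)
  have small: "norm (g z) \<le> M * (cmod (z - q) / \<rho>) ^ k" if z: "z \<in> ?S" for z k
  proof -
    have "norm (g z / (z - q) ^ k) \<le> M / \<rho> ^ k"
    proof (rule maximum_modulus_frontier[of "\<lambda>z. g z / (z - q) ^ k" ?S])
      have nq: "z - q \<noteq> 0" if "z \<in> closure D" for z using that q(1) by auto
      show "(\<lambda>z. g z / (z - q) ^ k) holomorphic_on interior ?S"
        unfolding interior_open[OF oS] by (intro holomorphic_intros hol) (use nq closure_subset[of D] in auto)
      show "continuous_on (closure ?S) (\<lambda>z. g z / (z - q) ^ k)"
        using continuous_on_subset[OF cont clS] nq clS by (auto intro!: continuous_intros)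
      show "bounded ?S" by auto
      fix v assume v: "v \<in> frontier ?S"
      then have vc: "v \<in> closure D \<inter> cball p \<delta>" using clS by (auto simp: frontier_def)
      show "norm (g v / (v - q) ^ k) \<le> M / \<rho> ^ k"
      proof (cases "v \<in> frontier D")
        case True
        then have "g v = 0" using zero vc by auto
        then show ?thesis using M(1) \<rho> \<delta> by simp
      next
        case False
        then have "v \<in> D" using vc by (simp add: frontier_def interior_open[OF D])
        then have "v \<notin> ball p \<delta>" using v unfolding frontier_def interior_open[OF oS] by blast
        then have "dist p v = \<delta>" using vc by auto
        then have "\<rho> \<le> cmod (v - q)"
          using dist_triangle[of p v q] by (simp add: \<rho>_def dist_norm norm_minus_commute)
        then have "\<rho> ^ k \<le> cmod (v - q) ^ k" using \<rho> \<delta> by (intro power_mono) auto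
        then show ?thesis using M vc \<rho> \<delta> by (auto simp: norm_divide norm_power intro!: frac_le)
      qed
    qed (use z in auto)
    moreover have "z - q \<noteq> 0" using z q(1) closure_subset[of D] by auto
    ultimately show ?thesis by (simp add: norm_divide norm_power power_divide divide_le_eq mult.commute)
  qed
  have g0: "g z = 0" if z: "z \<in> ?S" and zq: "cmod (z - q) < \<rho>" for z
  proof -
    have "(\<lambda>k. M * (cmod (z - q) / \<rho>) ^ k) \<longlonglongrightarrow> M * 0"
      using zq \<rho> \<delta> by (intro tendsto_mult tendsto_const LIMSEQ_power_zero) auto
    then have "norm (g z) \<le> M * 0" using small[OF z] by (intro LIMSEQ_le_const) auto
    then show ?thesis by simp
  qed
  have "p \<in> closure D" using p(1) by (simp add: frontier_def)
  then obtain z where z: "z \<in> D" "dist z p < \<delta> / 4"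
    using \<delta> unfolding closure_approachable by (meson divide_pos_pos zero_less_numeral)
  have "open (D \<inter> ball p (\<delta> / 4))" "z \<in> D \<inter> ball p (\<delta> / 4)" using D z by (auto simp: dist_commute)
  then obtain e where e: "e > 0" "ball z e \<subseteq> D \<inter> ball p (\<delta> / 4)" using openE by blast
  show ?thesis
  proof (rule that[OF e(1)])
    show "ball z e \<subseteq> ?S" using e(2) \<delta> by force
    fix w assume "w \<in> ball z e"
    then have w: "w \<in> D" "dist p w < \<delta> / 4" using e(2) by auto
    then have "cmod (w - q) < \<rho>"
      using dist_triangle[of w q p] q(2) \<rho> by (simp add: dist_norm norm_minus_commute)
    then show "g w = 0" using w \<delta> by (intro g0) auto
  qed
qed

section \<open>Logarithms, first integrals and the exclusion of a dipole\<close>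

lemma open_imp_fsigma:
  fixes S :: "'a::metric_space set"
  assumes "open S"
  shows "fsigma S"
proof -
  define F where "F = (\<lambda>n::nat. - (\<Union>y\<in>- S. ball y (1 / Suc n)))"
  have "S = (\<Union>n. F n)"
  proof (intro equalityI subsetI)
    fix x assume "x \<in> S"
    then obtain e where e: "e > 0" "ball x e \<subseteq> S" using assms openE by blast
    then obtain n where "1 / Suc n < e" using nat_approx_posE by metis
    then have "x \<in> F n" using e(2) by (auto simp: F_def dist_commute subset_iff)
    then show "x \<in> (\<Union>n. F n)" by blast
  next
    fix x assume "x \<in> (\<Union>n. F n)"
    then obtain n where "x \<in> F n" by blast
    moreover have "x \<in> ball x (1 / Suc n)" by simp
    ultimately show "x \<in> S" unfolding F_def by blast
  qed
  moreover have "closed (F n)" for n unfolding F_def by auto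
  ultimately show ?thesis using fsigma.intros[of F] by simp
qed

text \<open>Differentiating the exponential gives \<open>deriv H z = 1 / (z - a)\<close>, a function
  without primitive around \<open>a\<close>: its integral over a circle is not 0.\<close>

lemma no_holomorphic_log_at_zero:
  assumes "\<epsilon> > 0" "H holomorphic_on ball a \<epsilon> - {a}" "\<And>z. z \<in> ball a \<epsilon> - {a} \<Longrightarrow> exp (H z) = k * (z - a)" "k \<noteq> 0"
  shows False
proof -
  have op: "open (ball a \<epsilon> - {a})" by auto
  have "(H has_field_derivative 1 / (z - a)) (at z within ball a \<epsilon> - {a})" if z: "z \<in> ball a \<epsilon> - {a}" for z
  proof -
    have Hd: "(H has_field_derivative deriv H z) (at z)" by (rule holomorphic_derivI[OF assms(2) op z])
    then have "((\<lambda>z. exp (H z)) has_field_derivative exp (H z) * deriv H z) (at z)"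
      by (auto intro!: derivative_eq_intros)
    moreover have "((\<lambda>z. k * (z - a)) has_field_derivative k) (at z)" by (auto intro!: derivative_eq_intros)
    then have "((\<lambda>z. exp (H z)) has_field_derivative k) (at z)"
      by (rule has_field_derivative_transform_within_open[OF _ op z]) (use assms(3) in auto)
    ultimately have "exp (H z) * deriv H z = k" by (rule DERIV_unique)
    then have "k * ((z - a) * deriv H z) = k * 1" unfolding assms(3)[OF z] by (simp only: mult.assoc mult_1_right)
    then have "(z - a) * deriv H z = 1" using assms(4) by (simp only: mult_left_cancel[OF assms(4)])
    then have "deriv H z = 1 / (z - a)" using z by (simp add: eq_divide_eq mult.commute)
    then show ?thesis using Hd by (simp add: has_field_derivative_at_within)
  qed
  then have "((\<lambda>z. 1 / (z - a)) has_contour_integral 0) (circlepath a (\<epsilon> / 2))"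
    by (rule Cauchy_theorem_primitive) (use assms(1) in \<open>auto simp: dist_norm norm_minus_commute\<close>)
  then have "contour_integral (circlepath a (\<epsilon> / 2)) (\<lambda>z. 1 / (z - a)) = 0" by (rule contour_integral_unique)
  then show False using contour_integral_circlepath[of "\<epsilon> / 2" a] assms(1) by simp
qed

text \<open>With \<open>w = z - a\<close>, the terms \<open>cnj w\<close> and \<open>1 / w\<close>
  integrate to \<open>|w|^2 / 2\<close> and \<open>ln |w|\<close>, the others to their holomorphic
  primitive. Doubling everything makes \<open>|w|^2\<close> the only radial quantity, and its
  derivative is at hand.\<close>

lemma (in C1_loop) multipole_first_integral:
  assumes a: "a \<notin> path_image \<gamma>"
    and cond: "\<And>s. s \<in> {0..1} \<Longrightarrow> Re ((of_real l1 * cnj (\<gamma> s - a) + of_real l2 / (\<gamma> s - a)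
        + of_real rr * \<beta> / (\<gamma> s - a)\<^sup>2 + cnj \<beta>) * \<gamma>' s) = 0"
  shows "\<exists>k. \<forall>z\<in>path_image \<gamma>. l1 * (cmod (z - a))\<^sup>2 + 2 * Re (cnj \<beta> * (z - a) - of_real rr * \<beta> / (z - a))
      + l2 * ln ((cmod (z - a))\<^sup>2) = k"
proof -
  define \<Phi> where "\<Phi> = (\<lambda>z. l1 * (cmod (z - a))\<^sup>2 + 2 * Re (cnj \<beta> * (z - a) - of_real rr * \<beta> / (z - a))
      + l2 * ln ((cmod (z - a))\<^sup>2))"
  have "((\<lambda>s. \<Phi> (\<gamma> s)) has_real_derivative 0) (at s within {0..1})" if s: "s \<in> {0..1}" for s
  proof -
    define w where "w = \<gamma> s - a"
    have w: "w \<noteq> 0" using a s by (auto simp: w_def path_image_def)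
    define N where "N = (cmod w)\<^sup>2"
    have N: "N > 0" using w by (simp add: N_def)
    have Nw: "of_real N = w * cnj w" unfolding N_def by (rule complex_norm_square)
    define n' where "n' = 2 * Re (cnj w * \<gamma>' s)"
    have dN: "((\<lambda>s. (cmod (\<gamma> s - a))\<^sup>2) has_real_derivative n') (at s within {0..1})"
      unfolding has_real_derivative_iff_has_vector_derivative n'_def w_def by (rule norm_square_derivative[OF s])
    have dln: "((\<lambda>s. ln ((cmod (\<gamma> s - a))\<^sup>2)) has_real_derivative n' / N) (at s within {0..1})"
    proof -
      have "(ln has_real_derivative 1 / N) (at ((cmod (\<gamma> s - a))\<^sup>2))"
        using DERIV_ln_divide[OF N] by (simp add: N_def w_def)
      from DERIV_chain2[OF this dN] show ?thesis by simp
    qed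
    have "((\<lambda>z. cnj \<beta> * (z - a) - of_real rr * \<beta> / (z - a)) has_field_derivative (cnj \<beta> + of_real rr * \<beta> / w\<^sup>2)) (at (\<gamma> s))"
      using w by (auto intro!: derivative_eq_intros simp: w_def power2_eq_square)
    from field_vector_diff_chain_within[OF deriv[OF s] has_field_derivative_at_within[OF this]]
    have "((\<lambda>s. cnj \<beta> * (\<gamma> s - a) - of_real rr * \<beta> / (\<gamma> s - a)) has_vector_derivative \<gamma>' s * (cnj \<beta> + of_real rr * \<beta> / w\<^sup>2)) (at s within {0..1})"
      by (simp add: o_def)
    from bounded_linear.has_vector_derivative[OF bounded_linear_Re this]
    have dF: "((\<lambda>s. Re (cnj \<beta> * (\<gamma> s - a) - of_real rr * \<beta> / (\<gamma> s - a))) has_real_derivative Re (\<gamma>' s * (cnj \<beta> + of_real rr * \<beta> / w\<^sup>2))) (at s within {0..1})"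
      unfolding has_real_derivative_iff_has_vector_derivative .
    have "((\<lambda>s. \<Phi> (\<gamma> s)) has_real_derivative l1 * n' + 2 * Re (\<gamma>' s * (cnj \<beta> + of_real rr * \<beta> / w\<^sup>2)) + l2 * (n' / N)) (at s within {0..1})"
      unfolding \<Phi>_def by (intro DERIV_add DERIV_cmult dN dF dln)
    moreover have "l1 * n' + 2 * Re (\<gamma>' s * (cnj \<beta> + of_real rr * \<beta> / w\<^sup>2)) + l2 * (n' / N) = 0"
    proof -
      have "of_real l2 / w = of_real (l2 / N) * cnj w" using w Nw N by (simp add: Nw)
      then have "(of_real l1 * cnj w + of_real l2 / w + of_real rr * \<beta> / w\<^sup>2 + cnj \<beta>) * \<gamma>' s
         = of_real l1 * (cnj w * \<gamma>' s) + of_real (l2 / N) * (cnj w * \<gamma>' s) + \<gamma>' s * (cnj \<beta> + of_real rr * \<beta> / w\<^sup>2)"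
        by (simp add: algebra_simps)
      then have "Re (of_real l1 * (cnj w * \<gamma>' s) + of_real (l2 / N) * (cnj w * \<gamma>' s) + \<gamma>' s * (cnj \<beta> + of_real rr * \<beta> / w\<^sup>2)) = 0"
        using cond[OF s] unfolding w_def by (simp only:)
      then have "l1 * Re (cnj w * \<gamma>' s) + (l2 / N) * Re (cnj w * \<gamma>' s) + Re (\<gamma>' s * (cnj \<beta> + of_real rr * \<beta> / w\<^sup>2)) = 0"
        by (simp only: plus_complex.sel Re_of_real_mult)
      moreover have "l1 * (2 * X) + 2 * Y + l2 * (2 * X / N) = 2 * (l1 * X + (l2 / N) * X + Y)" for X Y :: real
        by (simp add: algebra_simps)
      ultimately show ?thesis unfolding n'_def by (simp only: mult_zero_right)
    qed
    ultimately show ?thesis by (simp only:)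
  qed
  then obtain k where "\<forall>s\<in>{0..1}. \<Phi> (\<gamma> s) = k"
    using has_field_derivative_zero_constant[of "{0..1}" "\<lambda>s. \<Phi> (\<gamma> s)"] by auto
  then show ?thesis unfolding \<Phi>_def path_image_def by blast
qed

text \<open>On \<open>\<gamma>\<close> every \<open>cnj (z - a)\<close> in the first integral equals \<open>T / (z - a)\<^sup>2\<close>. Its exponential therefore
  extends to a holomorphic function, constant by boundary uniqueness, but the
  logarithm has residue \<open>-1\<close> at the double pole \<open>a\<close> of \<open>T / (z - a)\<^sup>2\<close>.\<close>

lemma (in C1_loop) no_dipole:
  assumes D: "open D" "connected D" "path_image \<gamma> = frontier D" "a \<in> D"
    and ext: "frontier D \<subseteq> closure (- closure D)"
    and T: "T holomorphic_on D" "continuous_on (closure D) T" "T a \<noteq> 0"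
      "\<And>z. z \<in> frontier D \<Longrightarrow> T z = (z - a)\<^sup>2 * cnj (z - a)"
    and l2: "l2 \<noteq> 0"
    and cond: "\<And>s. s \<in> {0..1} \<Longrightarrow> Re ((of_real l1 * cnj (\<gamma> s - a) + of_real l2 / (\<gamma> s - a)
        + of_real rr * \<beta> / (\<gamma> s - a)\<^sup>2 + cnj \<beta>) * \<gamma>' s) = 0"
  shows False
proof -
  have disj: "D \<inter> frontier D = {}" using D(1) by (simp add: frontier_def interior_open)
  then have aF: "a \<notin> frontier D" using D(4) by blast
  obtain k where k: "\<And>z. z \<in> frontier D \<Longrightarrow> l1 * (cmod (z - a))\<^sup>2 + 2 * Re (cnj \<beta> * (z - a) - of_real rr * \<beta> / (z - a))
      + l2 * ln ((cmod (z - a))\<^sup>2) = k"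
    using multipole_first_integral[of a l1 l2 rr \<beta>] cond aF D(3) by auto
  \<comment> \<open>On the curve \<open>cnj w = T / w^2\<close>, so \<open>|w|^2\<close> becomes
    \<open>T / w\<close>, and \<open>2 * Re X\<close> is written \<open>X + cnj X\<close> before
    substituting. Dividing by \<open>l2\<close> gives the logarithm coefficient 1, so
    \<open>W\<close> contains it as the factor \<open>T / w\<close>, without a branch.\<close>
  define E where "E = (\<lambda>z. (of_real l1 * (T z / (z - a)) + cnj \<beta> * (z - a) + \<beta> * (T z / (z - a)\<^sup>2)
      - of_real rr * \<beta> / (z - a) - of_real rr * cnj \<beta> * ((z - a)\<^sup>2 / T z)) / of_real l2)"
  define W where "W = (\<lambda>z. T z / (z - a) * exp (E z))"
  define K :: complex where "K = of_real (exp (k / l2))"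
  have K: "K \<noteq> 0" by (simp add: K_def)
  have WF: "W z = K" if z: "z \<in> frontier D" for z
  proof -
    define w where "w = z - a"
    have w: "w \<noteq> 0" using z aF by (auto simp: w_def)
    have Tz: "T z = w\<^sup>2 * cnj w" using T(4)[OF z] by (simp add: w_def)
    define N where "N = (cmod w)\<^sup>2"
    have N: "N > 0" using w by (simp add: N_def)
    have Nw: "of_real N = w * cnj w" unfolding N_def by (rule complex_norm_square)
    have t: "T z / w = of_real N" "T z / w\<^sup>2 = cnj w" "w\<^sup>2 / T z = 1 / cnj w"
      using w by (auto simp: Tz Nw power2_eq_square)
    have re: "x + cnj x = of_real (2 * Re x)" for x by (simp add: complex_add_cnj)
    have "E z = (of_real l1 * of_real N + ((cnj \<beta> * w - of_real rr * \<beta> / w) + cnj (cnj \<beta> * w - of_real rr * \<beta> / w))) / of_real l2"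
      unfolding E_def w_def[symmetric] t by (simp add: algebra_simps)
    also have "\<dots> = of_real ((l1 * N + 2 * Re (cnj \<beta> * w - of_real rr * \<beta> / w)) / l2)"
      unfolding re by (simp only: of_real_add of_real_mult of_real_divide)
    finally have "W z = of_real N * exp (of_real ((l1 * N + 2 * Re (cnj \<beta> * w - of_real rr * \<beta> / w)) / l2))"
      unfolding W_def w_def[symmetric] t by simp
    also have "of_real N = exp (of_real (ln N) :: complex)" using N by (simp only: exp_of_real exp_ln)
    also have "exp (of_real (ln N)) * exp (of_real ((l1 * N + 2 * Re (cnj \<beta> * w - of_real rr * \<beta> / w)) / l2))
       = (of_real (exp (ln N + (l1 * N + 2 * Re (cnj \<beta> * w - of_real rr * \<beta> / w)) / l2)) :: complex)"
      by (simp only: exp_add of_real_mult exp_of_real)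
    also have "ln N + (l1 * N + 2 * Re (cnj \<beta> * w - of_real rr * \<beta> / w)) / l2 = k / l2"
      using k[OF z] l2 unfolding N_def w_def by (simp add: field_simps)
    finally show ?thesis by (simp add: K_def)
  qed
  \<comment> \<open>The possible singularities of \<open>E\<close> and \<open>W\<close>. As
    \<open>T a\<close> is nonzero, \<open>T\<close> does not vanish identically, so they are
    countable and \<open>D - Z\<close> stays connected.\<close>
  define Z where "Z = insert a {z \<in> D. T z = 0}"
  have "countable {z \<in> D. T z = 0}"
  proof (cases "T constant_on D")
    case True
    then have "{z \<in> D. T z = 0} = {}" using T(3) D(4) unfolding constant_on_def by auto
    then show ?thesis by (simp only: countable_empty)
  next
    case False
    then show ?thesis
      by (intro holomorphic_countable_zeros T(1) D(1,2)) (use D(1) False in \<open>auto simp: open_imp_fsigma\<close>)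
  qed
  then have "countable Z" by (simp add: Z_def)
  then have conO: "connected (D - Z)"
    by (intro connected_open_diff_countable D(1,2)) simp_all
  have opO: "open (D - Z)"
  proof -
    have "open (D \<inter> T -` (- {0}))"
      by (intro continuous_open_preimage D(1) holomorphic_on_imp_continuous_on[OF T(1)]) auto
    then have "open (D \<inter> T -` (- {0}) - {a})" by auto
    moreover have "D \<inter> T -` (- {0}) - {a} = D - Z" by (auto simp: Z_def)
    ultimately show ?thesis by simp
  qed
  have Ehol: "E holomorphic_on D - Z"
    unfolding E_def using l2 by (intro holomorphic_intros holomorphic_on_subset[OF T(1)]) (auto simp: Z_def)
  have Whol: "W holomorphic_on D - Z"
    unfolding W_def by (intro holomorphic_intros Ehol holomorphic_on_subset[OF T(1)]) (auto simp: Z_def)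
  obtain p where p: "p \<in> frontier D" using path_image_nonempty[of \<gamma>] D(3) by auto
  have "p \<in> closure D" using p by (simp add: frontier_def)
  moreover have "T p \<noteq> 0" using T(4)[OF p] p aF by auto
  ultimately obtain d where d: "d > 0" "\<And>z. z \<in> closure D \<Longrightarrow> dist z p < d \<Longrightarrow> dist (T z) (T p) < cmod (T p)"
    using T(2) unfolding continuous_on_iff by (metis zero_less_norm_iff)
  \<comment> \<open>Small enough to exclude the zeros of \<open>T\<close> and the point
    \<open>a\<close>, so that \<open>W\<close> is continuous up to the curve near
    \<open>p\<close>.\<close>
  define \<delta> where "\<delta> = min d (cmod (p - a)) / 2"
  have \<delta>: "\<delta> > 0" "\<delta> < d" "\<delta> < cmod (p - a)" using d p aF by (auto simp: \<delta>_def min_def)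
  have nz: "T z \<noteq> 0" "z - a \<noteq> 0" if "z \<in> closure D" "z \<in> cball p \<delta>" for z
    using d(2)[of z] that \<delta> by (auto simp: dist_commute dist_norm)
  have DZ: "D \<inter> ball p \<delta> \<subseteq> D - Z"
    using nz closure_subset[of D] by (auto simp: Z_def) (metis closure_subset less_eq_real_def nz mem_cball subsetD diff_self)+
  obtain e z0 where e: "e > 0" "ball z0 e \<subseteq> D \<inter> ball p \<delta>" "\<And>w. w \<in> ball z0 e \<Longrightarrow> W w - K = 0"
  proof (rule boundary_uniqueness[OF D(1) \<delta>(1), of "\<lambda>z. W z - K" p])
    show "(\<lambda>z. W z - K) holomorphic_on D \<inter> ball p \<delta>"
      by (intro holomorphic_intros holomorphic_on_subset[OF Whol DZ])
    have cT: "continuous_on (closure D \<inter> cball p \<delta>) T" by (rule continuous_on_subset[OF T(2)]) auto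
    have "continuous_on (closure D \<inter> cball p \<delta>) E"
      unfolding E_def using l2 nz by (intro continuous_intros cT) auto
    then show "continuous_on (closure D \<inter> cball p \<delta>) (\<lambda>z. W z - K)"
      unfolding W_def using nz by (intro continuous_intros cT) auto
  qed (use WF p ext in auto)
  have WK: "W z = K" if "z \<in> D - Z" for z
  proof (rule analytic_continuation_open[of "ball z0 e" "D - Z" W "\<lambda>_. K" z])
    show "ball z0 e \<subseteq> D - Z" using e(2) DZ by blast
    show "W w = K" if "w \<in> ball z0 e" for w using e(3)[OF that] by simp
  qed (use e(1) opO conO Whol that in auto)
  have "open (D \<inter> T -` (- {0}))"
    by (intro continuous_open_preimage D(1) holomorphic_on_imp_continuous_on[OF T(1)]) auto
  then obtain \<epsilon> where \<epsilon>: "\<epsilon> > 0" "ball a \<epsilon> \<subseteq> D \<inter> T -` (- {0})"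
    using openE[of "D \<inter> T -` (- {0})" a] D(4) T(3) by auto
  have pun: "ball a \<epsilon> - {a} \<subseteq> D - Z" using \<epsilon>(2) by (auto simp: Z_def)
  have Tb: "T holomorphic_on ball a \<epsilon>" "\<And>z. z \<in> ball a \<epsilon> \<Longrightarrow> T z \<noteq> 0"
    using \<epsilon>(2) holomorphic_on_subset[OF T(1)] by auto
  \<comment> \<open>Near \<open>a\<close> the function \<open>T\<close> has no zero and hence a
    logarithm; \<open>W = K\<close> then says \<open>exp (L + E) = K * (z - a)\<close> on a
    punctured disc.\<close>
  obtain L where L: "L holomorphic_on ball a \<epsilon>" "\<And>z. z \<in> ball a \<epsilon> \<Longrightarrow> exp (L z) = T z"
    using holomorphic_logarithm_exists[of "ball a \<epsilon>" T a] Tb \<epsilon>(1) by (metis centre_in_ball convex_ball open_ball)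
  show False
  proof (rule no_holomorphic_log_at_zero[OF \<epsilon>(1), of "\<lambda>z. L z + E z" a K])
    show "(\<lambda>z. L z + E z) holomorphic_on ball a \<epsilon> - {a}"
      by (intro holomorphic_intros holomorphic_on_subset[OF L(1)] holomorphic_on_subset[OF Ehol pun]) auto
    fix z assume z: "z \<in> ball a \<epsilon> - {a}"
    then have "T z / (z - a) * exp (E z) = K" using WK[of z] pun unfolding W_def by blast
    then show "exp (L z + E z) = K * (z - a)" using L(2)[of z] z by (simp add: exp_add field_simps)
  qed (rule K)
qed

text \<open>On the outer circle the tangential condition makes a function of the exterior Cauchy
  transform real. Inversion moves it to a disc, where it must be constant; \<open>\<beta>\<close>,
  the displacement of the centre of mass from \<open>a\<close> times \<open>\<Omega>\<close>,
  becomes the dipole.\<close>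

lemma (in rotating_patches) inner_circle:
  assumes C: "C1_jordan_curve (frontier D1)" "C1_jordan_curve (frontier D2)" and sph: "frontier D1 = sphere a r" and r: "r > 0"
  shows "\<exists>s>0. frontier D2 = sphere a s"
proof -
  have D1: "D1 = ball a r" using frontier_subset_sphere[OF open1 bounded1 nonempty1 _ r] sph by simp
  let ?C = "cauchy_transform D2"
  define A where "A = measure lborel D2"
  have A: "A > 0"
  proof -
    obtain x where "x \<in> D2" using nonempty2 by blast
    then obtain e where e: "e > 0" "ball x e \<subseteq> D2" using openE[OF open2] by blast
    then have "measure lborel (ball x e) \<le> A"
      unfolding A_def using finite12(2) sets12 by (intro measure_mono_fmeasurable) (auto simp: fmeasurable_def)
    moreover have "measure lborel (ball x e) > 0" using e(1) by (simp add: measure_ball_complex)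
    ultimately show ?thesis by linarith
  qed
  define k2 :: complex where "k2 = of_real ((\<alpha> - 1) / (2 * pi))"
  have k2: "k2 \<noteq> 0" using alpha by (simp add: k2_def)
  define l2 where "l2 = (\<alpha> - 1) * A / (2 * pi)"
  have l2: "l2 \<noteq> 0" using alpha A by (simp add: l2_def)
  have l2k: "of_real l2 = k2 * of_real A" by (simp add: l2_def k2_def)
  define \<beta> where "\<beta> = of_real \<Omega> * (c - a)"
  have cC: "continuous_on S ?C" for S
    using cauchy_transform_continuous[of D2] finite12(2) sets12 by (auto intro: continuous_on_subset)
  have rel: "rel_field \<Omega> c z = of_real (1/2 - \<Omega>) * cnj (z - a) + k2 * ?C z + cnj \<beta>"
    if "z \<in> closure D1" for z
  proof -
    have z: "cmod (z - a) \<le> r" using that r unfolding D1 by (simp add: dist_norm norm_minus_commute)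
    have C1: "cauchy_transform D1 z = of_real pi * cnj (z - a)"
    proof (cases "cmod (z - a) < r")
      case True
      then show ?thesis unfolding D1 by (rule cauchy_transform_ball_inside)
    next
      case False
      then have e: "cmod (z - a) = r" and nz: "z - a \<noteq> 0" using z r by auto
      have "of_real (r\<^sup>2) = (z - a) * cnj (z - a)" unfolding e[symmetric] by (rule complex_norm_square)
      then show ?thesis unfolding D1 using cauchy_transform_ball_outside[OF r, of z a] e nz by simp
    qed
    show ?thesis unfolding rel_field_def total_transform_def k2_def \<beta>_def C1 by (simp add: field_simps)
  qed
  obtain \<gamma>1 \<gamma>1' where g1: "C1_loop \<gamma>1 \<gamma>1'" "path_image \<gamma>1 = frontier D1" "inside (frontier D1) = D1"
    "\<And>s. s \<in> {0..1} \<Longrightarrow> \<gamma>1' s \<noteq> 0" "\<And>s. s \<in> {0..1} \<Longrightarrow> Re (rel_field \<Omega> c (\<gamma>1 s) * \<gamma>1' s) = 0"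
    using tangential[of D1] C by metis
  have im: "Im ((z - a) * (k2 * ?C z) - \<beta> * cnj (z - a)) = 0" if z: "z \<in> sphere a r" for z
  proof -
    have H: "Im ((z - a) * rel_field \<Omega> c z) = 0"
      by (rule C1_loop.circle_tangential[OF g1(1) _ r g1(4,5) z]) (use g1(2) sph in auto)
    have zc: "z \<in> closure D1" using z r unfolding D1 by simp
    \<comment> \<open>Replacing \<open>w * cnj b\<close> by \<open>- b * cnj w\<close> keeps the
      imaginary part; on the circle this trades a term growing at infinity for
      \<open>\<beta> * r^2 / w\<close>, which decays.\<close>
    have "Im (w * (of_real l * cnj w + x + cnj b)) = Im (w * x - b * cnj w)" for w x b :: complex and l
      by (simp add: algebra_simps)
    then show ?thesis using H unfolding rel[OF zc] by (simp only:)
  qed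
  \<comment> \<open>The real expression after the inversion \<open>\<zeta> = 1 / (z - a)\<close>,
    with \<open>r^2 * \<zeta>\<close> for \<open>cnj (z - a)\<close>. The value at 0 is the limit
    from infinity and makes the singularity removable.\<close>
  define Z where "Z = (\<lambda>\<zeta>. if \<zeta> = 0 then of_real l2 else k2 * ((1 / \<zeta>) * ?C (a + 1 / \<zeta>)) - \<beta> * of_real (r\<^sup>2) * \<zeta>)"
  have cD2: "closure D2 \<subseteq> ball a r" using nested D1 by simp
  have hC: "?C holomorphic_on - closure D2"
    by (rule cauchy_transform_holomorphic_off) (use finite12 sets12 in auto)
  have Zcont: "continuous_on UNIV Z"
    unfolding continuous_on_eq_continuous_at[OF open_UNIV]
  proof
    fix \<zeta>0 :: complex
    show "isCont Z \<zeta>0"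
    proof (cases "\<zeta>0 = 0")
      case True
      have "filterlim (\<lambda>\<zeta>::complex. inverse \<zeta>) at_infinity (at 0)" by (rule filterlim_inverse_at_infinity)
      then have "filterlim (\<lambda>\<zeta>::complex. a + 1 / \<zeta>) at_infinity (at 0)"
        using tendsto_add_filterlim_at_infinity[OF tendsto_const[of a]] by (simp add: inverse_eq_divide)
      from filterlim_compose[OF cauchy_transform_at_infinity[OF _ bounded2, of a] this]
      have "((\<lambda>\<zeta>. (1 / \<zeta>) * ?C (a + 1 / \<zeta>)) \<longlongrightarrow> of_real A) (at 0)"
        using sets12 by (simp add: A_def)
      then have "((\<lambda>\<zeta>. k2 * ((1 / \<zeta>) * ?C (a + 1 / \<zeta>)) - \<beta> * of_real (r\<^sup>2) * \<zeta>) \<longlongrightarrow> k2 * of_real A - \<beta> * of_real (r\<^sup>2) * 0) (at 0)"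
        by (intro tendsto_diff tendsto_mult tendsto_const tendsto_ident_at)
      then have "((\<lambda>\<zeta>. k2 * ((1 / \<zeta>) * ?C (a + 1 / \<zeta>)) - \<beta> * of_real (r\<^sup>2) * \<zeta>) \<longlongrightarrow> Z 0) (at 0)"
        by (simp add: Z_def l2k)
      moreover have "\<forall>\<^sub>F \<zeta> in at 0. k2 * ((1 / \<zeta>) * ?C (a + 1 / \<zeta>)) - \<beta> * of_real (r\<^sup>2) * \<zeta> = Z \<zeta>"
        by (auto simp: eventually_at_filter Z_def)
      ultimately have "(Z \<longlongrightarrow> Z 0) (at 0)" by (rule Lim_transform_eventually)
      then show ?thesis unfolding True isCont_def .
    next
      case False
      have o: "open (- {0 :: complex})" by auto
      have "continuous_on (- {0}) (\<lambda>\<zeta>. k2 * ((1 / \<zeta>) * ?C (a + 1 / \<zeta>)) - \<beta> * of_real (r\<^sup>2) * \<zeta>)"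
        by (intro continuous_intros continuous_on_compose2[OF cC[of UNIV]]) auto
      then have "continuous_on (- {0}) Z"
        by (rule continuous_on_eq) (auto simp: Z_def)
      then show ?thesis using False o by (simp add: continuous_on_eq_continuous_at)
    qed
  qed
  have Zhol: "Z holomorphic_on ball 0 (1 / r)"
  proof (rule no_isolated_singularity)
    show "continuous_on (ball 0 (1 / r)) Z" using Zcont by (rule continuous_on_subset) auto
    have "a + 1 / \<zeta> \<in> - closure D2" if \<zeta>: "\<zeta> \<in> ball 0 (1 / r) - {0}" for \<zeta>
    proof
      assume "a + 1 / \<zeta> \<in> closure D2"
      then have "a + 1 / \<zeta> \<in> ball a r" using cD2 by blast
      then have "cmod (1 / \<zeta>) < r" by (simp add: dist_norm)
      moreover have "cmod \<zeta> < 1 / r" "cmod \<zeta> > 0" using \<zeta> by auto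
      moreover from this have "r < cmod (1 / \<zeta>)" using r by (simp add: norm_divide field_simps)
      ultimately show False by linarith
    qed
    then have ims: "(\<lambda>\<zeta>. a + 1 / \<zeta>) ` (ball 0 (1 / r) - {0}) \<subseteq> - closure D2" by blast
    have "(?C \<circ> (\<lambda>\<zeta>. a + 1 / \<zeta>)) holomorphic_on ball 0 (1 / r) - {0}"
      by (intro holomorphic_on_compose_gen[OF _ hC ims] holomorphic_intros) auto
    then have "(\<lambda>\<zeta>. k2 * ((1 / \<zeta>) * ?C (a + 1 / \<zeta>)) - \<beta> * of_real (r\<^sup>2) * \<zeta>) holomorphic_on ball 0 (1 / r) - {0}"
      by (intro holomorphic_intros) (auto simp: o_def)
    then show "Z holomorphic_on ball 0 (1 / r) - {0}"
      by (rule holomorphic_transform) (simp add: Z_def)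
  qed auto
  have Zim: "Im (Z \<zeta>) = 0" if "\<zeta> \<in> sphere 0 (1 / r)" for \<zeta>
  proof -
    have n: "cmod \<zeta> = 1 / r" and nz: "\<zeta> \<noteq> 0" using that r by auto
    define w where "w = 1 / \<zeta>"
    have w: "cmod w = r" "w \<noteq> 0" using n nz r by (auto simp: w_def norm_divide)
    have "of_real (r\<^sup>2) = w * cnj w" unfolding w(1)[symmetric] by (rule complex_norm_square)
    then have "of_real (r\<^sup>2) * \<zeta> = cnj w" using nz by (simp add: w_def)
    moreover have "a + w \<in> sphere a r" using w by (simp add: dist_norm)
    ultimately have "Z \<zeta> = ((a + w) - a) * (k2 * ?C (a + w)) - \<beta> * cnj ((a + w) - a)"
      using nz by (simp add: Z_def w_def mult.assoc)
    then show ?thesis using im[OF \<open>a + w \<in> sphere a r\<close>] by (simp only:)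
  qed
  define B where "B = \<beta> * of_real (r\<^sup>2) / k2"
  \<comment> \<open>\<open>P = 0\<close> is the expansion into a monopole and a dipole with
    denominators cleared, so that it makes sense at \<open>a\<close> too.\<close>
  define P where "P = (\<lambda>z. (z - a)\<^sup>2 * ?C z - of_real A * (z - a) - B)"
  have Pfar: "P z = 0" if z: "z \<in> - cball a r" for z
  proof -
    define w where "w = z - a"
    have w: "cmod w > r" using z by (simp add: w_def dist_norm norm_minus_commute)
    then have wnz: "w \<noteq> 0" using r by auto
    have "1 / cmod w < 1 / r"
      using w r by (intro divide_strict_left_mono) (auto intro!: mult_pos_pos less_trans[OF r w])
    then have "1 / w \<in> ball 0 (1 / r)" by (simp add: norm_divide)
    then have "Z (1 / w) = Z 0"
      using holomorphic_real_on_sphere_constant(1)[of Z 0 "1 / r" "1 / w"] Zhol continuous_on_subset[OF Zcont] r Zim by auto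
    then have e: "k2 * (w * ?C z) - \<beta> * of_real (r\<^sup>2) / w = k2 * of_real A"
      using wnz by (simp add: Z_def l2k w_def)
    have "k2 * P z = w * (k2 * (w * ?C z) - \<beta> * of_real (r\<^sup>2) / w - k2 * of_real A)"
      using k2 wnz unfolding P_def B_def w_def[symmetric] by (simp add: algebra_simps power2_eq_square)
    then show ?thesis using k2 unfolding e by simp
  qed
  obtain \<gamma> \<gamma>' where g: "C1_loop \<gamma> \<gamma>'" "path_image \<gamma> = frontier D2" "inside (frontier D2) = D2"
    "\<And>s. s \<in> {0..1} \<Longrightarrow> \<gamma>' s \<noteq> 0" "\<And>s. s \<in> {0..1} \<Longrightarrow> Re (rel_field \<Omega> c (\<gamma> s) * \<gamma>' s) = 0"
    using tangential[of D2] C by metis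
  define U where "U = outside (frontier D2)"
  have cl: "closure D2 = D2 \<union> frontier D2" by (metis closure_Un_frontier)
  have U: "U = - closure D2"
    unfolding U_def outside_inside g(3) cl by auto
  have J: "open U" "connected U" "frontier U = frontier D2"
    using Jordan_inside_outside[OF C1_loop.simple[OF g(1)] C1_loop.closed[OF g(1)]] unfolding g(2) U_def by simp_all
  have FU: "frontier D2 \<subseteq> closure U" using J(3) by (auto simp: frontier_def)
  have PU: "P z = 0" if "z \<in> U" for z
  proof (rule analytic_continuation_open[of "- cball a r" U P "\<lambda>_. 0" z])
    show "- cball a r \<noteq> {}" using cobounded_imp_unbounded[of "cball a r"] by auto
    show "- cball a r \<subseteq> U" unfolding U using cD2 ball_subset_cball[of a r] by blast
    show "P holomorphic_on U" unfolding P_def U by (intro holomorphic_intros hC)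
  qed (use J that Pfar in auto)
  have Pcl: "P z = 0" if "z \<in> closure U" for z
  proof -
    have "closed {z. P z = 0}" unfolding P_def by (intro closed_Collect_eq continuous_intros cC)
    then have "closure U \<subseteq> {z. P z = 0}" using PU by (intro closure_minimal) auto
    then show ?thesis using that by auto
  qed
  \<comment> \<open>If \<open>a\<close> were on the inner curve, continuity would first force
    \<open>B = 0\<close> and then, after cancelling one factor \<open>z - a\<close>, also
    \<open>A = 0\<close>.\<close>
  have aF: "a \<notin> frontier D2"
  proof
    assume aF: "a \<in> frontier D2"
    then have "a \<in> closure U" using FU by auto
    then have B0: "B = 0" using Pcl[of a] by (simp add: P_def)
    have "a \<notin> U" using aF by (simp add: U cl)
    then have "U \<subseteq> {z. (z - a) * ?C z = of_real A}"
      using PU B0 by (auto simp: P_def power2_eq_square)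
    moreover have "closed {z. (z - a) * ?C z = of_real A}" by (intro closed_Collect_eq continuous_intros cC)
    ultimately have "closure U \<subseteq> {z. (z - a) * ?C z = of_real A}" by (rule closure_minimal)
    then show False using \<open>a \<in> closure U\<close> A by auto
  qed
  have relF: "rel_field \<Omega> c z = of_real (1/2 - \<Omega>) * cnj (z - a) + of_real l2 / (z - a) + of_real (r\<^sup>2) * \<beta> / (z - a)\<^sup>2 + cnj \<beta>"
    if z: "z \<in> frontier D2" for z
  proof -
    have zc: "z \<in> closure D1" using z nested closure_subset[of D1] by (auto simp: frontier_def)
    have nz: "z - a \<noteq> 0" using z aF by auto
    have "(z - a)\<^sup>2 * ?C z = of_real A * (z - a) + B"
      using Pcl[of z] z FU by (auto simp: P_def algebra_simps)
    moreover have "x = p / w + b / w\<^sup>2" if "w\<^sup>2 * x = p * w + b" "w \<noteq> 0" for x p b w :: complex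
      using that by (simp add: field_simps power2_eq_square)
    ultimately have "?C z = of_real A / (z - a) + B / (z - a)\<^sup>2" using nz by blast
    then have kC: "k2 * ?C z = of_real l2 / (z - a) + of_real (r\<^sup>2) * \<beta> / (z - a)\<^sup>2"
      using k2 by (simp add: l2k B_def distrib_left mult.commute)
    show ?thesis unfolding rel[OF zc] kC by (simp only: add.assoc)
  qed
  have cond: "Re ((of_real (1/2 - \<Omega>) * cnj (\<gamma> s - a) + of_real l2 / (\<gamma> s - a) + of_real (r\<^sup>2) * \<beta> / (\<gamma> s - a)\<^sup>2 + cnj \<beta>) * \<gamma>' s) = 0"
    if s: "s \<in> {0..1}" for s
  proof -
    have "\<gamma> s \<in> frontier D2" unfolding g(2)[symmetric] path_image_def using s by blast
    from g(5)[OF s, unfolded relF[OF this]] show ?thesis .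
  qed
  have "\<beta> = 0"
  proof (rule ccontr)
    assume "\<beta> \<noteq> 0"
    then have B0: "B \<noteq> 0" using k2 r by (simp add: B_def)
    \<comment> \<open>\<open>P a = - B\<close> is nonzero, while \<open>P\<close> vanishes on the
      closed exterior.\<close>
    have "a \<notin> closure U" using Pcl[of a] B0 by (auto simp: P_def)
    then have aD: "a \<in> D2" using aF closure_subset[of U] by (auto simp: U cl)
    \<comment> \<open>\<open>cnj z - C / pi\<close>, with \<open>C\<close> the transform of
      \<open>D2\<close>, is holomorphic in \<open>D2\<close>; on the curve \<open>P = 0\<close>
      expresses \<open>C\<close> by its poles. Adding them back yields the Schwarz function, and the
      factor \<open>(z - a)^2\<close> removes its double pole, leaving
      \<open>T a = B / pi\<close>.\<close>
    define T where "T = (\<lambda>z. (z - a)\<^sup>2 * (cnj (z - a) - ?C z / of_real pi) + of_real (A / pi) * (z - a) + B / of_real pi)"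
    show False
    proof (rule C1_loop.no_dipole[OF g(1) open2 connected2 g(2) aD, of T l2 "1/2 - \<Omega>" "r\<^sup>2" \<beta>])
      show "frontier D2 \<subseteq> closure (- closure D2)" using FU U by simp
      define H where "H = (\<lambda>z. ?C z - of_real pi * cnj z)"
      have "H holomorphic_on D2"
        unfolding H_def by (rule cauchy_transform_dbar[OF open2 finite12(2)])
      then have "(\<lambda>z. (z - a)\<^sup>2 * (- H z / of_real pi - cnj a) + of_real (A / pi) * (z - a) + B / of_real pi) holomorphic_on D2"
        by (intro holomorphic_intros) auto
      then show "T holomorphic_on D2"
      proof (rule holomorphic_transform)
        fix z
        have "- H z / of_real pi - cnj a = cnj (z - a) - ?C z / of_real pi"
          by (simp add: H_def field_simps)
        then show "(z - a)\<^sup>2 * (- H z / of_real pi - cnj a) + of_real (A / pi) * (z - a) + B / of_real pi = T z"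
          unfolding T_def by (simp only:)
      qed
      show "continuous_on (closure D2) T" unfolding T_def by (intro continuous_intros cC) auto
      show "T a \<noteq> 0" using B0 by (simp add: T_def)
      show "T z = (z - a)\<^sup>2 * cnj (z - a)" if z: "z \<in> frontier D2" for z
      proof -
        have "(z - a)\<^sup>2 * ?C z = of_real A * (z - a) + B"
          using Pcl[of z] z FU by (auto simp: P_def algebra_simps)
        then have "(z - a)\<^sup>2 * (?C z / of_real pi) = (of_real A * (z - a) + B) / of_real pi" by simp
        then show ?thesis unfolding T_def right_diff_distrib by (simp add: add_divide_distrib diff_divide_distrib)
      qed
    qed (rule l2, erule cond)
  qed
  have "Re ((of_real (1/2 - \<Omega>) * cnj (\<gamma> s - a) + of_real l2 / (\<gamma> s - a)) * \<gamma>' s) = 0" if "s \<in> {0..1}" for s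
    using cond[OF that] by (simp only: \<open>\<beta> = 0\<close> complex_cnj_zero mult_zero_right div_0 add_0_right)
  moreover have "a \<notin> path_image \<gamma>" using aF g(2) by simp
  ultimately have "\<exists>\<rho>>0. path_image \<gamma> \<subseteq> sphere a \<rho>"
    using C1_loop.radial_tangential[OF g(1) _ l2] by blast
  then obtain \<rho> where \<rho>: "\<rho> > 0" "frontier D2 \<subseteq> sphere a \<rho>" using g(2) by auto
  then have "D2 = ball a \<rho>" using frontier_subset_sphere[OF open2 bounded2 nonempty2] by blast
  then show ?thesis using \<rho>(1) by auto
qed

theorem theorem1:
  fixes D1 D2 :: "complex set" and \<alpha> :: real
    and \<omega>0 :: "complex \<Rightarrow> real" and \<omega> :: "real \<Rightarrow> complex \<Rightarrow> real"
  assumes "open D1" "connected D1" "bounded D1" "simply_connected D1"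
    and "open D2" "connected D2" "bounded D2" "simply_connected D2"
    and "closure D2 \<subseteq> D1"
    and "C1_jordan_curve (frontier D1)" "C1_jordan_curve (frontier D2)"
    and "\<alpha> \<noteq> 1"
    and "\<omega>0 = (\<lambda>z. indicator D1 z + (\<alpha> - 1) * indicator D2 z)"
    and "(LINT z|lebesgue. \<omega>0 z) \<noteq> 0"
    and "euler_weak_solution \<omega>0 \<omega>"
    and "rotates_uniformly \<omega>0 \<omega>"
  shows "(\<forall>a r. r > 0 \<and> frontier D1 = sphere a r \<longrightarrow> (\<exists>s>0. frontier D2 = sphere a s)) \<and>
         (\<forall>a r. r > 0 \<and> frontier D2 = sphere a r \<longrightarrow> (\<exists>s>0. frontier D1 = sphere a s))"
proof -
  \<comment> \<open>A parametrised frontier is nonempty, which excludes the empty domain.\<close>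
  have ne: "D \<noteq> {}" if "C1_jordan_curve (frontier D)" for D
    using that path_image_nonempty unfolding C1_jordan_curve_def by force
  interpret two_patches D1 D2 \<alpha> using assms by unfold_locales
  have \<omega>0: "\<omega>0 = vort" using assms(13) by (simp add: vort_def)
  obtain \<Omega> where rot: "\<And>t. t \<ge> 0 \<Longrightarrow> AE \<zeta> in lebesgue. \<omega> t (center_of_mass \<omega>0 + \<zeta>) =
      vort (center_of_mass \<omega>0 + exp (- \<i> * of_real (t * \<Omega>)) * \<zeta>)"
    using assms(16) unfolding rotates_uniformly_def \<omega>0 by blast
  interpret rotating_patches D1 D2 \<alpha> \<Omega> "center_of_mass \<omega>0"
    using assms(2,6,9,12) ne[OF assms(10)] ne[OF assms(11)]
      rotating_solution_stationary[OF assms(15)[unfolded \<omega>0] rot]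
    by unfold_locales
  show ?thesis
    using inner_circle[OF assms(10,11)] outer_circle[OF assms(10,11)] by blast
qed

end
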